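(* Let $q$ be a power of an odd prime, let $V=X\oplus Y$ be a $2n$-dimensional symplectic vector space over $\mathbb{F}_q$ with $X,Y$ complementary Lagrangian subspaces in duality, let $Sp=Sp(V)$, let $(U,\beta)$ be a $k$-dimensional vector space over $\mathbb{F}_q$ with a non-degenerate symmetric bilinear form $\beta$, with isometry group $O_\beta$, and let $\omega_{V\otimes U}$ be the oscillator representation of $Sp(V\otimes U)$ (attached to a non-trivial additive character $\psi$ of $\mathbb{F}_q$). Assume that $\dim(U)=k<n$. Write $$\omega_{V\otimes U}|_{Sp\times O_\beta}\simeq\sum_{\tau\in Irr(O_\beta)}\Theta(\tau)\otimes\tau,$$ where each $\Theta(\tau)$ is a representation of $Sp$. Then the following hold: 1. (Rank $k$ piece) For each $\tau\in Irr(O_\beta)$ the representation $\Theta(\tau)$ contains a unique irreducible constituent $\eta(\tau)$ of rank $k$; all other constituents have rank less than $k$. 2. (Injection) The mapping $\tau\mapsto\eta(\tau)$ gives an embedding (injective map) $$\eta: Irr(O_\beta)\longrightarrow Irr(Sp)_{k\beta},$$ where $Irr(Sp)_{k\beta}$ is the set of equivalence classes of irreducible representations of $Sp$ of rank $k$ and type $\mathcal{O}_\beta$. 3. (Spectrum) The multiplicity of the orbit $\mathcal{O}_\beta$ in the restriction $\eta(\tau)|_N$ is $\dim(\tau)$; that is, each character of $N$ belonging to $\mathcal{O}_\beta$ occurs in $\eta(\tau)|_N$ with multiplicity $\dim(\tau)$.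
   Context: All representations are finite-dimensional and complex; $Irr(G)$ is the set of isomorphism classes of irreducible representations of a finite group $G$. Symplectic space. $V=X\oplus Y$ with $X,Y$ $n$-dimensional and dual to each other via a pairing $\bullet$; the symplectic form is $\langle (x_1,y_1),(x_2,y_2)\rangle=x_1\bullet y_2-x_2\bullet y_1$. The group $Sp=Sp(V)$ is the isometry group of $\langle\,,\rangle$. The Siegel unipotent radical is the abelian group $N=\left\{\begin{pmatrix} I&A\\0&I\end{pmatrix}: A:Y\to X \text{ symmetric}\right\}\subset Sp$ (symmetric means that $A$ corresponds to a symmetric bilinear form on $Y=X^*$); its elements are denoted by $A$. Characters of $N$. Let $\psi$ be the non-trivial additive character of $\mathbb{F}_q$ used (as central character) to define $\omega_{V\otimes U}$. Characters of $N$ are identified with symmetric bilinear forms $B$ on $X$ (viewed as symmetric maps $B:X\to X^*=Y$) by $B\mapsto\psi_B$, $\psi_B(A)=\psi(\tfrac12 Tr(BA))$, where $Tr(BA)$ is the trace of $Y\xrightarrow{A}X\xrightarrow{B}Y$. The rank of $\psi_B$ is the rank of $B$. For a given $r\geq 1$ there are exactly two isomorphism classes ($GL(X)$-orbits) of symmetric bilinear forms of rank $r$ on $X$, distinguished by the discriminant in $\mathbb{F}_q^*/\mathbb{F}_q^{*2}$. For $k=\dim U$, $\mathcal{O}_\beta$ denotes the orbit of rank $k$ forms $B$ on $X$ such that $X/rad(B)$ with the induced form is isometric to $(U,\beta)$ (and also the corresponding set of characters $\psi_B$). Rank and type. The restriction to $N$ of a representation $\rho$ of $Sp$ decomposes as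 $\rho|_N=\sum_B m_B\psi_B$, and $m_B$ depends only on the isomorphism class of $B$; the multiplicity of an orbit is the common value of $m_B$ on it. $\rho$ is of rank $k$ if $\rho|_N$ contains characters of rank $k$ but of no higher rank. A representation of rank $k$ is of type $\mathcal{O}_\beta$ if it contains characters from $\mathcal{O}_\beta$ but none from the other rank $k$ orbit. Oscillator representation. $V\otimes U$ carries the symplectic form $\langle\,,\rangle\otimes\beta$; $Sp$ and $O_\beta$ act on it through the first and second factors, giving commuting subgroups and a homomorphism $Sp\times O_\beta\to Sp(V\otimes U)$, through which $\omega_{V\otimes U}$ is restricted. For a symplectic space $W=X_W\oplus Y_W$ over $\mathbb{F}_q$, with $X_W,Y_W$ Lagrangian subspaces dual to each other via a pairing $\bullet_W$ such that the symplectic form of $W$ is $\langle (x_1,y_1),(x_2,y_2)\rangle_W=x_1\bullet_W y_2-x_2\bullet_W y_1$ for $x_1,x_2\in X_W$, $y_1,y_2\in Y_W$, the oscillator (Weil) representation of $Sp(W)$ attached to $\psi$ is the representation on $L^2(Y_W)$ (complex functions on $Y_W$) determined by: (A) $\begin{pmatrix} I&A\\0&I\end{pmatrix}$ acts by $f(y)\mapsto\psi(\tfrac12A(y,y))f(y)$ for symmetric $A:Y_W\to X_W$; (B) $\begin{pmatrix}0&B\\-B^{-1}&0\end{pmatrix}$ acts by $f(y)\mapsto\frac{1}{\gamma(B,\psi)}\sum_{y'\in Y_W}\psi(B(y,y'))f(y')$ for a symmetric isomorphism $B:Y_W\to X_W$, where $\gamma(B,\psi)=\sum_{y\in Y_W}\psi(-\tfrac12B(y,y))$;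 (C) $\begin{pmatrix}{}^tC^{-1}&0\\0&C\end{pmatrix}$ acts by $f(y)\mapsto\left(\frac{\det C}{q}\right)f(C^{-1}y)$ for $C\in GL(Y_W)$, with $\left(\frac{\cdot}{q}\right)=+1$ on non-zero squares of $\mathbb{F}_q$ and $-1$ on non-squares. For $\omega_{V\otimes U}$ take $W=V\otimes U$, $X_W=X\otimes U$, $Y_W=Y\otimes U\cong Hom(X,U)$. In this model $A\in N$ acts by $(\omega_{V\otimes U}(A)f)(T)=\psi(\tfrac12Tr(\beta_T\circ A))f(T)$, where $\beta_T(x,x')=\beta(T(x),T(x'))$, and $r\in O_\beta$ acts by $(\omega_{V\otimes U}(r)f)(T)=\left(\frac{\det(r)^n}{q}\right)f(r^{-1}\circ T)$. *)

theory Defs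
  imports
    "HOL-Algebra.Group"
    "HOL-Library.Cardinality"
    "HOL-Analysis.Product_Vector"
    "Jordan_Normal_Form.VS_Connect"
begin

section \<open>Finite-dimensional complex representations\<close>

text \<open>A representation of degree \<open>d\<close> is a homomorphism from the group into \<open>GL\<^sub>d(\<complex>)\<close>.
  Degree zero is allowed here and excluded for irreducible representations.\<close>

definition GL :: "nat \<Rightarrow> complex mat monoid" where
  "GL d = units_of (ring_mat TYPE(complex) d ())"

definition representation :: "'g monoid \<Rightarrow> ('g \<Rightarrow> complex mat) \<Rightarrow> bool" where
  "representation G \<rho> \<longleftrightarrow> (\<exists>d. \<rho> \<in> hom G (GL d))"

definition rep_degree :: "'g monoid \<Rightarrow> ('g \<Rightarrow> complex mat) \<Rightarrow> nat" where
  "rep_degree G \<rho> = dim_row (\<rho> \<one>\<^bsub>G\<^esub>)"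

definition irreducible_rep :: "'g monoid \<Rightarrow> ('g \<Rightarrow> complex mat) \<Rightarrow> bool" where
  "irreducible_rep G \<rho> \<longleftrightarrow>
     representation G \<rho> \<and> rep_degree G \<rho> > 0 \<and>
     (\<forall>S. VectorSpace.subspace class_ring S (module_vec TYPE(complex) (rep_degree G \<rho>)) \<and>
          (\<forall>g\<in>carrier G. \<forall>v\<in>S. \<rho> g *\<^sub>v v \<in> S)
        \<longrightarrow> S = {0\<^sub>v (rep_degree G \<rho>)} \<or> S = carrier_vec (rep_degree G \<rho>))"

definition intertwiners ::
  "'g monoid \<Rightarrow> ('g \<Rightarrow> complex mat) \<Rightarrow> ('g \<Rightarrow> complex mat) \<Rightarrow> complex mat set" where
  "intertwiners G \<pi> \<rho> =
     {M \<in> carrier_mat (rep_degree G \<rho>) (rep_degree G \<pi>). \<forall>g\<in>carrier G. M * \<pi> g = \<rho> g * M}"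

definition equivalent_rep ::
  "'g monoid \<Rightarrow> ('g \<Rightarrow> complex mat) \<Rightarrow> ('g \<Rightarrow> complex mat) \<Rightarrow> bool" where
  "equivalent_rep G \<pi> \<rho> \<longleftrightarrow> (\<exists>M \<in> intertwiners G \<pi> \<rho>. invertible_mat M)"

definition Irr :: "'g monoid \<Rightarrow> ('g \<Rightarrow> complex mat) set set" where
  "Irr G = {\<rho>. irreducible_rep G \<rho>} //
     {(\<pi>, \<rho>). irreducible_rep G \<pi> \<and> irreducible_rep G \<rho> \<and> equivalent_rep G \<pi> \<rho>}"

definition class_rep :: "('g \<Rightarrow> complex mat) set \<Rightarrow> 'g \<Rightarrow> complex mat" where
  "class_rep c = (SOME \<rho>. \<rho> \<in> c)"

text \<open>The multiplicity of an irreducible \<open>\<pi>\<close> in \<open>\<rho>\<close> is \<open>dim Hom\<^sub>G(\<pi>, \<rho>)\<close>.\<close>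

definition rep_multiplicity ::
  "'g monoid \<Rightarrow> ('g \<Rightarrow> complex mat) \<Rightarrow> ('g \<Rightarrow> complex mat) \<Rightarrow> nat" where
  "rep_multiplicity G \<pi> \<rho> =
     vectorspace.dim class_ring
       (module_mat TYPE(complex) (rep_degree G \<rho>) (rep_degree G \<pi>)\<lparr>carrier := intertwiners G \<pi> \<rho>\<rparr>)"

definition constituent ::
  "'g monoid \<Rightarrow> ('g \<Rightarrow> complex mat) \<Rightarrow> ('g \<Rightarrow> complex mat) \<Rightarrow> bool" where
  "constituent G \<pi> \<rho> \<longleftrightarrow> irreducible_rep G \<pi> \<and> rep_multiplicity G \<pi> \<rho> > 0"

text \<open>\<open>is_theta_decomposition G H \<omega> \<Theta>\<close>: the action \<open>\<omega>\<close> of \<open>G \<times> H\<close> on the functions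
  \<open>'w \<Rightarrow> complex\<close> is isomorphic to the direct sum over \<open>c \<in> Irr H\<close> of \<open>\<Theta> c \<otimes> \<tau>\<^sub>c\<close>, where
  \<open>\<tau>\<^sub>c\<close> is a representative of the class \<open>c\<close>.  The space of \<open>\<Theta> c \<otimes> \<tau>\<^sub>c\<close> is realised as the
  matrices of size \<open>deg (\<Theta> c) \<times> deg \<tau>\<^sub>c\<close>, the vector \<open>u \<otimes> v\<close> being the matrix \<open>u v\<^sup>T\<close>; thus
  \<open>(g, h)\<close> acts by \<open>m \<mapsto> \<Theta> c g * m * (\<tau>\<^sub>c h)\<^sup>T\<close>.\<close>

definition is_theta_decomposition ::
  "'g monoid \<Rightarrow> 'h monoid \<Rightarrow> ('g \<Rightarrow> 'h \<Rightarrow> ('w \<Rightarrow> complex) \<Rightarrow> ('w \<Rightarrow> complex))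
    \<Rightarrow> (('h \<Rightarrow> complex mat) set \<Rightarrow> 'g \<Rightarrow> complex mat) \<Rightarrow> bool" where
  "is_theta_decomposition G H \<omega> \<Theta> \<longleftrightarrow>
     (\<forall>c\<in>Irr H. representation G (\<Theta> c)) \<and>
     (let E = (\<Pi>\<^sub>E c\<in>Irr H. carrier_mat (rep_degree G (\<Theta> c)) (rep_degree H (class_rep c)))
      in \<exists>\<Phi>. bij_betw \<Phi> E UNIV \<and>
           (\<forall>m\<in>E. \<forall>m'\<in>E. \<Phi> (\<lambda>c\<in>Irr H. m c + m' c) = (\<lambda>y. \<Phi> m y + \<Phi> m' y)) \<and>
           (\<forall>a. \<forall>m\<in>E. \<Phi> (\<lambda>c\<in>Irr H. a \<cdot>\<^sub>m m c) = (\<lambda>y. a * \<Phi> m y)) \<and>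
           (\<forall>g\<in>carrier G. \<forall>h\<in>carrier H. \<forall>m\<in>E.
              \<Phi> (\<lambda>c\<in>Irr H. \<Theta> c g * m c * transpose_mat (class_rep c h)) = \<omega> g h (\<Phi> m)))"


section \<open>Linear algebra over a finite field\<close>

text \<open>A finite-dimensional vector space over the finite field \<open>'f\<close> is a finite additive group
  type together with a scalar multiplication \<open>s\<close> satisfying \<open>vector_space s\<close>.\<close>

definition bilinear_map ::
  "('f::field \<Rightarrow> 'a::ab_group_add \<Rightarrow> 'a) \<Rightarrow> ('f \<Rightarrow> 'b::ab_group_add \<Rightarrow> 'b)
    \<Rightarrow> ('f \<Rightarrow> 'c::ab_group_add \<Rightarrow> 'c) \<Rightarrow> ('a \<Rightarrow> 'b \<Rightarrow> 'c) \<Rightarrow> bool" where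
  "bilinear_map s1 s2 s3 t \<longleftrightarrow>
     (\<forall>v. Vector_Spaces.linear s2 s3 (t v)) \<and> (\<forall>u. Vector_Spaces.linear s1 s3 (\<lambda>v. t v u))"

text \<open>A perfect pairing: \<open>X\<close> and \<open>Y\<close> are dual to each other.\<close>

definition perfect_pairing ::
  "('f::field \<Rightarrow> 'x::ab_group_add \<Rightarrow> 'x) \<Rightarrow> ('f \<Rightarrow> 'y::ab_group_add \<Rightarrow> 'y)
    \<Rightarrow> ('x \<Rightarrow> 'y \<Rightarrow> 'f) \<Rightarrow> bool" where
  "perfect_pairing sX sY p \<longleftrightarrow>
     bilinear_map sX sY (*) p \<and>
     (\<forall>x. (\<forall>y. p x y = 0) \<longrightarrow> x = 0) \<and> (\<forall>y. (\<forall>x. p x y = 0) \<longrightarrow> y = 0)"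

definition nondegenerate_symmetric_form ::
  "('f::field \<Rightarrow> 'u::ab_group_add \<Rightarrow> 'u) \<Rightarrow> ('u \<Rightarrow> 'u \<Rightarrow> 'f) \<Rightarrow> bool" where
  "nondegenerate_symmetric_form sU \<beta> \<longleftrightarrow>
     bilinear_map sU sU (*) \<beta> \<and> (\<forall>u v. \<beta> u v = \<beta> v u) \<and> (\<forall>u. (\<forall>v. \<beta> u v = 0) \<longrightarrow> u = 0)"

text \<open>The space with scalar multiplication \<open>s3\<close>, together with \<open>t\<close>, is a tensor product of the
  first two.  In the universal property it suffices, in finite dimension, to consider bilinear
  maps into the ground field.\<close>

definition is_tensor_product ::
  "('f::field \<Rightarrow> 'a::ab_group_add \<Rightarrow> 'a) \<Rightarrow> ('f \<Rightarrow> 'b::ab_group_add \<Rightarrow> 'b)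
    \<Rightarrow> ('f \<Rightarrow> 'c::ab_group_add \<Rightarrow> 'c) \<Rightarrow> ('a \<Rightarrow> 'b \<Rightarrow> 'c) \<Rightarrow> bool" where
  "is_tensor_product s1 s2 s3 t \<longleftrightarrow>
     bilinear_map s1 s2 s3 t \<and>
     (\<forall>b. bilinear_map s1 s2 (*) b \<longrightarrow>
        (\<exists>!l. Vector_Spaces.linear s3 (*) l \<and> (\<forall>v u. l (t v u) = b v u)))"

text \<open>\<open>(X \<oplus> Y) \<otimes> U = (X \<otimes> U) \<oplus> (Y \<otimes> U)\<close>.\<close>

definition sum_tensor ::
  "('x \<Rightarrow> 'u \<Rightarrow> 'xu) \<Rightarrow> ('y \<Rightarrow> 'u \<Rightarrow> 'yu) \<Rightarrow> 'x \<times> 'y \<Rightarrow> 'u \<Rightarrow> 'xu \<times> 'yu" where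
  "sum_tensor tX tY v u = (tX (fst v) u, tY (snd v) u)"

text \<open>The map \<open>g \<otimes> h\<close> of the tensor product \<open>(s, t)\<close>.\<close>

definition tensor_map ::
  "('f::field \<Rightarrow> 'w::ab_group_add \<Rightarrow> 'w) \<Rightarrow> ('v \<Rightarrow> 'u \<Rightarrow> 'w)
    \<Rightarrow> ('v \<Rightarrow> 'v) \<Rightarrow> ('u \<Rightarrow> 'u) \<Rightarrow> 'w \<Rightarrow> 'w" where
  "tensor_map s t g h =
     (THE L. Vector_Spaces.linear s s L \<and> (\<forall>v u. L (t v u) = t (g v) (h u)))"

text \<open>Trace and determinant of an endomorphism are those of its matrix in an (arbitrary)
  ordered basis.\<close>

definition basis_list :: "('f::field \<Rightarrow> 'a::ab_group_add \<Rightarrow> 'a) \<Rightarrow> 'a list" where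
  "basis_list s =
     (SOME bs. distinct bs \<and> \<not> Modules.module.dependent s (set bs) \<and> Modules.module.span s (set bs) = UNIV)"

definition lin_matrix :: "('f::field \<Rightarrow> 'a::ab_group_add \<Rightarrow> 'a) \<Rightarrow> ('a \<Rightarrow> 'a) \<Rightarrow> 'f mat" where
  "lin_matrix s L =
     (let bs = basis_list s
      in mat (length bs) (length bs)
           (\<lambda>(i, j). Modules.module.representation s (set bs) (L (bs ! j)) (bs ! i)))"

definition lin_trace :: "('f::field \<Rightarrow> 'a::ab_group_add \<Rightarrow> 'a) \<Rightarrow> ('a \<Rightarrow> 'a) \<Rightarrow> 'f" where
  "lin_trace s L = sum_list (diag_mat (lin_matrix s L))"

definition lin_det :: "('f::field \<Rightarrow> 'a::ab_group_add \<Rightarrow> 'a) \<Rightarrow> ('a \<Rightarrow> 'a) \<Rightarrow> 'f" where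
  "lin_det s L = Determinant.det (lin_matrix s L)"

definition isometry_group ::
  "('f::field \<Rightarrow> 'a::ab_group_add \<Rightarrow> 'a) \<Rightarrow> ('a \<Rightarrow> 'a \<Rightarrow> 'f) \<Rightarrow> ('a \<Rightarrow> 'a) monoid" where
  "isometry_group s b =
     \<lparr>carrier = {g. Vector_Spaces.linear s s g \<and> bij g \<and> (\<forall>v w. b (g v) (g w) = b v w)},
      mult = (\<circ>), one = id\<rparr>"


section \<open>The symplectic group of \<open>X \<oplus> Y\<close> and its Siegel unipotent radical\<close>

definition symplectic_form :: "('x \<Rightarrow> 'y \<Rightarrow> 'f::field) \<Rightarrow> 'x \<times> 'y \<Rightarrow> 'x \<times> 'y \<Rightarrow> 'f" where
  "symplectic_form p v w = p (fst v) (snd w) - p (fst w) (snd v)"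

definition Sp ::
  "('f::field \<Rightarrow> 'x::ab_group_add \<Rightarrow> 'x) \<Rightarrow> ('f \<Rightarrow> 'y::ab_group_add \<Rightarrow> 'y)
    \<Rightarrow> ('x \<Rightarrow> 'y \<Rightarrow> 'f) \<Rightarrow> ('x \<times> 'y \<Rightarrow> 'x \<times> 'y) monoid" where
  "Sp sX sY p = isometry_group (module_prod.scale sX sY) (symplectic_form p)"

text \<open>Symmetric maps \<open>Y \<rightarrow> X\<close>, i.e. symmetric bilinear forms \<open>(y, y') \<mapsto> A y \<bullet> y'\<close> on \<open>Y\<close>, and
  symmetric maps \<open>X \<rightarrow> Y\<close>, i.e. symmetric bilinear forms \<open>(x, x') \<mapsto> x' \<bullet> B x\<close> on \<open>X\<close>.\<close>

definition symmetric_YX ::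
  "('f::field \<Rightarrow> 'x::ab_group_add \<Rightarrow> 'x) \<Rightarrow> ('f \<Rightarrow> 'y::ab_group_add \<Rightarrow> 'y)
    \<Rightarrow> ('x \<Rightarrow> 'y \<Rightarrow> 'f) \<Rightarrow> ('y \<Rightarrow> 'x) set" where
  "symmetric_YX sX sY p =
     {A. Vector_Spaces.linear sY sX A \<and> (\<forall>y y'. p (A y) y' = p (A y') y)}"

definition symmetric_XY ::
  "('f::field \<Rightarrow> 'x::ab_group_add \<Rightarrow> 'x) \<Rightarrow> ('f \<Rightarrow> 'y::ab_group_add \<Rightarrow> 'y)
    \<Rightarrow> ('x \<Rightarrow> 'y \<Rightarrow> 'f) \<Rightarrow> ('x \<Rightarrow> 'y) set" where
  "symmetric_XY sX sY p =
     {B. Vector_Spaces.linear sX sY B \<and> (\<forall>x x'. p x' (B x) = p x (B x'))}"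

definition unipotent :: "('y \<Rightarrow> 'x::ab_group_add) \<Rightarrow> 'x \<times> 'y \<Rightarrow> 'x \<times> 'y" where
  "unipotent A v = (fst v + A (snd v), snd v)"

definition weyl :: "('y::ab_group_add \<Rightarrow> 'x::ab_group_add) \<Rightarrow> 'x \<times> 'y \<Rightarrow> 'x \<times> 'y" where
  "weyl B v = (B (snd v), - inv_into UNIV B (fst v))"

definition adjoint_X :: "('x \<Rightarrow> 'y \<Rightarrow> 'f) \<Rightarrow> ('y \<Rightarrow> 'y) \<Rightarrow> 'x \<Rightarrow> 'x" where
  "adjoint_X p C x = (THE x'. \<forall>y. p x' y = p x (C y))"

definition levi :: "('x \<Rightarrow> 'y \<Rightarrow> 'f) \<Rightarrow> ('y \<Rightarrow> 'y) \<Rightarrow> 'x \<times> 'y \<Rightarrow> 'x \<times> 'y" where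
  "levi p C v = (adjoint_X p (inv_into UNIV C) (fst v), C (snd v))"

definition Siegel ::
  "('f::field \<Rightarrow> 'x::ab_group_add \<Rightarrow> 'x) \<Rightarrow> ('f \<Rightarrow> 'y::ab_group_add \<Rightarrow> 'y)
    \<Rightarrow> ('x \<Rightarrow> 'y \<Rightarrow> 'f) \<Rightarrow> ('x \<times> 'y \<Rightarrow> 'x \<times> 'y) monoid" where
  "Siegel sX sY p = (Sp sX sY p)\<lparr>carrier := unipotent ` symmetric_YX sX sY p\<rparr>"


section \<open>The oscillator representation\<close>

definition nontrivial_additive_character :: "('f::field \<Rightarrow> complex) \<Rightarrow> bool" where
  "nontrivial_additive_character \<psi> \<longleftrightarrow>
     \<psi> 0 = 1 \<and> (\<forall>a b. \<psi> (a + b) = \<psi> a * \<psi> b) \<and> (\<exists>a. \<psi> a \<noteq> 1)"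

definition quadratic_character :: "'f::field \<Rightarrow> complex" where
  "quadratic_character a = (if a = 0 then 0 else if \<exists>b. a = b ^ 2 then 1 else - 1)"

text \<open>\<open>\<omega>\<close> is the representation of \<open>Sp(X \<oplus> Y)\<close> on the functions on \<open>Y\<close> which is determined by
  its values on the generators \<open>unipotent A\<close>, \<open>weyl B\<close> and \<open>levi p C\<close>.  The values of \<open>\<omega>\<close>
  outside \<open>Sp(X \<oplus> Y)\<close> are irrelevant.\<close>

definition is_oscillator_rep ::
  "('f::field \<Rightarrow> 'x::ab_group_add \<Rightarrow> 'x) \<Rightarrow> ('f \<Rightarrow> 'y::{ab_group_add, finite} \<Rightarrow> 'y)
    \<Rightarrow> ('x \<Rightarrow> 'y \<Rightarrow> 'f) \<Rightarrow> ('f \<Rightarrow> complex)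
    \<Rightarrow> (('x \<times> 'y \<Rightarrow> 'x \<times> 'y) \<Rightarrow> ('y \<Rightarrow> complex) \<Rightarrow> ('y \<Rightarrow> complex)) \<Rightarrow> bool" where
  "is_oscillator_rep sX sY p \<psi> \<omega> \<longleftrightarrow>
     (\<forall>g\<in>carrier (Sp sX sY p). \<forall>a b f f'.
        \<omega> g (\<lambda>y. a * f y + b * f' y) = (\<lambda>y. a * \<omega> g f y + b * \<omega> g f' y)) \<and>
     \<omega> id = id \<and>
     (\<forall>g\<in>carrier (Sp sX sY p). \<forall>h\<in>carrier (Sp sX sY p). \<omega> (g \<circ> h) = \<omega> g \<circ> \<omega> h) \<and>
     (\<forall>A\<in>symmetric_YX sX sY p. \<forall>f y. \<omega> (unipotent A) f y = \<psi> (p (A y) y / 2) * f y) \<and>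
     (\<forall>B\<in>symmetric_YX sX sY p. bij B \<longrightarrow>
        (\<forall>f y. \<omega> (weyl B) f y =
           1 / (\<Sum>z\<in>UNIV. \<psi> (- (p (B z) z / 2))) * (\<Sum>y'\<in>UNIV. \<psi> (p (B y) y') * f y'))) \<and>
     (\<forall>C. Vector_Spaces.linear sY sY C \<and> bij C \<longrightarrow>
        (\<forall>f y. \<omega> (levi p C) f y = quadratic_character (lin_det sY C) * f (inv_into UNIV C y)))"


section \<open>Rank and type\<close>

text \<open>The character \<open>\<psi>\<^sub>B\<close> of \<open>N\<close> as a representation of degree one; if \<open>g = unipotent A\<close> then
  \<open>fst (g (0, y)) = A y\<close>.\<close>

definition siegel_character ::
  "('f::field \<Rightarrow> 'y::ab_group_add \<Rightarrow> 'y) \<Rightarrow> ('f \<Rightarrow> complex) \<Rightarrow> ('x::ab_group_add \<Rightarrow> 'y)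
    \<Rightarrow> ('x \<times> 'y \<Rightarrow> 'x \<times> 'y) \<Rightarrow> complex mat" where
  "siegel_character sY \<psi> B g =
     mat 1 1 (\<lambda>_. \<psi> (lin_trace sY (\<lambda>y. B (fst (g (0, y)))) / 2))"

definition form_rank :: "('f::field \<Rightarrow> 'y::ab_group_add \<Rightarrow> 'y) \<Rightarrow> ('x \<Rightarrow> 'y) \<Rightarrow> nat" where
  "form_rank sY B = vector_space.dim sY (range B)"

text \<open>The multiplicity \<open>m\<^sub>B\<close> of \<open>\<psi>\<^sub>B\<close> in \<open>\<rho>|\<^sub>N\<close>.\<close>

definition form_multiplicity ::
  "('f::field \<Rightarrow> 'x::ab_group_add \<Rightarrow> 'x) \<Rightarrow> ('f \<Rightarrow> 'y::ab_group_add \<Rightarrow> 'y)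
    \<Rightarrow> ('x \<Rightarrow> 'y \<Rightarrow> 'f) \<Rightarrow> ('f \<Rightarrow> complex)
    \<Rightarrow> (('x \<times> 'y \<Rightarrow> 'x \<times> 'y) \<Rightarrow> complex mat) \<Rightarrow> ('x \<Rightarrow> 'y) \<Rightarrow> nat" where
  "form_multiplicity sX sY p \<psi> \<rho> B = rep_multiplicity (Siegel sX sY p) (siegel_character sY \<psi> B) \<rho>"

definition has_rank ::
  "('f::field \<Rightarrow> 'x::ab_group_add \<Rightarrow> 'x) \<Rightarrow> ('f \<Rightarrow> 'y::ab_group_add \<Rightarrow> 'y)
    \<Rightarrow> ('x \<Rightarrow> 'y \<Rightarrow> 'f) \<Rightarrow> ('f \<Rightarrow> complex)
    \<Rightarrow> (('x \<times> 'y \<Rightarrow> 'x \<times> 'y) \<Rightarrow> complex mat) \<Rightarrow> nat \<Rightarrow> bool" where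
  "has_rank sX sY p \<psi> \<rho> r \<longleftrightarrow>
     (\<exists>B\<in>symmetric_XY sX sY p. form_rank sY B = r \<and> form_multiplicity sX sY p \<psi> \<rho> B > 0) \<and>
     (\<forall>B\<in>symmetric_XY sX sY p. form_multiplicity sX sY p \<psi> \<rho> B > 0 \<longrightarrow> form_rank sY B \<le> r)"

definition radical :: "('x \<Rightarrow> 'y::zero) \<Rightarrow> 'x set" where
  "radical B = {x. B x = 0}"

definition vcoset :: "'x::ab_group_add set \<Rightarrow> 'x \<Rightarrow> 'x set" where
  "vcoset R x = {x + r | r. r \<in> R}"

text \<open>The orbit \<open>\<O>\<^sub>\<beta>\<close>: \<open>\<phi>\<close> is an isometry from the quotient \<open>X/rad B\<close> (the set of cosets) with
  the form induced by \<open>B\<close> onto \<open>(U, \<beta>)\<close>.  Linearity on the quotient is linearity of the composite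
  with the projection \<open>X \<rightarrow> X/rad B\<close>.\<close>

definition orbit_of ::
  "('f::field \<Rightarrow> 'x::ab_group_add \<Rightarrow> 'x) \<Rightarrow> ('f \<Rightarrow> 'y::ab_group_add \<Rightarrow> 'y)
    \<Rightarrow> ('f \<Rightarrow> 'u::ab_group_add \<Rightarrow> 'u) \<Rightarrow> ('x \<Rightarrow> 'y \<Rightarrow> 'f) \<Rightarrow> ('u \<Rightarrow> 'u \<Rightarrow> 'f)
    \<Rightarrow> ('x \<Rightarrow> 'y) set" where
  "orbit_of sX sY sU p \<beta> =
     {B \<in> symmetric_XY sX sY p. form_rank sY B = vector_space.dim sU UNIV \<and>
        (\<exists>\<phi>. bij_betw \<phi> (range (vcoset (radical B))) UNIV \<and>
             Vector_Spaces.linear sX sU (\<lambda>x. \<phi> (vcoset (radical B) x)) \<and>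
             (\<forall>x x'. \<beta> (\<phi> (vcoset (radical B) x)) (\<phi> (vcoset (radical B) x')) = p x' (B x)))}"

text \<open>\<open>\<rho>\<close> has rank \<open>k = dim U\<close> and type \<open>\<O>\<^sub>\<beta>\<close>; the forms of rank \<open>k\<close> not in \<open>\<O>\<^sub>\<beta>\<close> form the other
  orbit of rank \<open>k\<close>.\<close>

definition has_type ::
  "('f::field \<Rightarrow> 'x::ab_group_add \<Rightarrow> 'x) \<Rightarrow> ('f \<Rightarrow> 'y::ab_group_add \<Rightarrow> 'y)
    \<Rightarrow> ('f \<Rightarrow> 'u::ab_group_add \<Rightarrow> 'u) \<Rightarrow> ('x \<Rightarrow> 'y \<Rightarrow> 'f) \<Rightarrow> ('u \<Rightarrow> 'u \<Rightarrow> 'f)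
    \<Rightarrow> ('f \<Rightarrow> complex) \<Rightarrow> (('x \<times> 'y \<Rightarrow> 'x \<times> 'y) \<Rightarrow> complex mat) \<Rightarrow> bool" where
  "has_type sX sY sU p \<beta> \<psi> \<rho> \<longleftrightarrow>
     has_rank sX sY p \<psi> \<rho> (vector_space.dim sU UNIV) \<and>
     (\<exists>B\<in>orbit_of sX sY sU p \<beta>. form_multiplicity sX sY p \<psi> \<rho> B > 0) \<and>
     (\<forall>B\<in>symmetric_XY sX sY p - orbit_of sX sY sU p \<beta>.
        form_rank sY B = vector_space.dim sU UNIV \<longrightarrow> form_multiplicity sX sY p \<psi> \<rho> B = 0)"

definition Irr_type ::
  "('f::field \<Rightarrow> 'x::ab_group_add \<Rightarrow> 'x) \<Rightarrow> ('f \<Rightarrow> 'y::ab_group_add \<Rightarrow> 'y)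
    \<Rightarrow> ('f \<Rightarrow> 'u::ab_group_add \<Rightarrow> 'u) \<Rightarrow> ('x \<Rightarrow> 'y \<Rightarrow> 'f) \<Rightarrow> ('u \<Rightarrow> 'u \<Rightarrow> 'f)
    \<Rightarrow> ('f \<Rightarrow> complex) \<Rightarrow> (('x \<times> 'y \<Rightarrow> 'x \<times> 'y) \<Rightarrow> complex mat) set set" where
  "Irr_type sX sY sU p \<beta> \<psi> =
     {c \<in> Irr (Sp sX sY p). \<forall>\<rho>\<in>c. has_type sX sY sU p \<beta> \<psi> \<rho>}"

end

theory Submission
  imports Defs "Jordan_Normal_Form.Spectral_Radius" "HOL-Number_Theory.Residues"
begin

text \<open>Identify \<open>Y \<otimes> U\<close> with \<open>Hom(X, U)\<close>.  In the Schroedinger model \<open>N\<close> acts on the delta function of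
  \<open>T\<close> through the character of the form \<open>x, x' \<mapsto> \<beta>(T x, T x')\<close>, which has rank \<open>k\<close> exactly
  when \<open>T\<close> is surjective, and then lies in \<open>\<O>\<^sub>\<beta>\<close>.  The maps with a given form \<open>B \<in> \<O>\<^sub>\<beta>\<close> are
  a torsor under \<open>O\<^sub>\<beta>\<close>, and the action of \<open>O\<^sub>\<beta>\<close> on it can be imitated by elements of the Siegel
  Levi subgroup.  So the \<open>B\<close>-weight space of \<open>\<omega>\<close> is, up to signs, the regular bimodule of
  \<open>O\<^sub>\<beta>\<close>, and the \<open>B\<close>-weight space of \<open>\<Theta>(\<tau>)\<close> is the (twisted) dual of \<open>\<tau>\<close>, on which those
  Levi elements act irreducibly.  Hence only one irreducible constituent \<open>\<eta>(\<tau>)\<close> of \<open>\<Theta>(\<tau>)\<close>, the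
  submodule generated by this weight space, contains characters from \<open>\<O>\<^sub>\<beta>\<close>, and it determines \<open>\<tau>\<close>.
  Only the actions of \<open>N\<close>, of the Levi subgroup and of \<open>O\<^sub>\<beta>\<close> are needed.\<close>

section \<open>Linear algebra over the complex numbers\<close>

text \<open>A summand \<open>\<Theta> c \<otimes> \<tau>\<close> is realised by matrices, so each
  component of a function is a linear map from the dual of \<tau> to \<open>\<Theta> c\<close>.
  Everything rests on this map for the delta function of a surjective \<open>T\<close>. That it is
  non-zero for every \<tau> is not given by the decomposition: it follows because
  \<open>O_\<beta>\<close> moves surjective maps freely, so the translates of the delta function
  carry a copy of the group algebra, in which matrix coefficients of \<tau> isolate the
  \<tau>-component. Injectivity then comes from irreducibility of \<tau>. The signs come from the
  quadratic character of determinants. They are carried as unspecified non-zero scalars: subspaces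
  do not see them, and because the Levi element and the scalar attached to an isometry are chosen
  before any component is taken, they cancel when two \<tau> are compared. The submodule generated
  by a weight space is irreducible because an averaged Hermitian form supplies invariant
  complements. Oddness of \<open>q\<close> enters through polarisation, as a form must be recovered
  from its diagonal values; \<open>k < n\<close> provides a surjective map from \<open>X\<close> to
  \<open>U\<close>.\<close>

definition vec_subspace :: "nat \<Rightarrow> complex vec set \<Rightarrow> bool" where
  "vec_subspace d K \<longleftrightarrow> K \<subseteq> carrier_vec d \<and> 0\<^sub>v d \<in> K \<and>
     (\<forall>v\<in>K. \<forall>w\<in>K. v + w \<in> K) \<and> (\<forall>a. \<forall>v\<in>K. a \<cdot>\<^sub>v v \<in> K)"

lemma vec_subspace_iff:
  "VectorSpace.subspace class_ring K (module_vec TYPE(complex) d) \<longleftrightarrow> vec_subspace d K"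
proof -
  have "module class_ring (module_vec TYPE(complex) d)" by (rule vec_module)
  moreover have "vectorspace class_ring (module_vec TYPE(complex) d)" by (rule vec_vs)
  ultimately show ?thesis
    unfolding VectorSpace.subspace_def LinearCombinations.submodule_def vec_subspace_def
    by (auto simp: module_vec_simps)
qed

lemma eq_mat_vecI:
  fixes A B :: "complex mat"
  assumes A: "A \<in> carrier_mat a b" and B: "B \<in> carrier_mat a b"
    and eq: "\<And>v. v \<in> carrier_vec b \<Longrightarrow> A *\<^sub>v v = B *\<^sub>v v"
  shows "A = B"
proof (rule mat_col_eqI)
  fix i assume i: "i < dim_col B"
  hence ib: "i < b" using B by auto
  have "col A i = A *\<^sub>v unit_vec b i" "col B i = B *\<^sub>v unit_vec b i"
    using A B ib by auto
  thus "col A i = col B i" using eq[of "unit_vec b i"] by simp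
qed (use A B in auto)

text \<open>If \<open>d < e\<close>, pad \<open>J\<close> with zero rows and \<open>L\<close> with
  zero columns to square matrices. Their product is still the identity, hence so is the product in
  the other order, but the latter has a zero row.\<close>

lemma left_inverse_dim_le:
  fixes J L :: "complex mat"
  assumes J: "J \<in> carrier_mat d e" and L: "L \<in> carrier_mat e d" and LJ: "L * J = 1\<^sub>m e"
  shows "e \<le> d"
proof (rule ccontr)
  assume "\<not> e \<le> d"
  hence de: "d < e" by simp
  define J0 where "J0 = mat e e (\<lambda>(i,j). if i < d then J $$ (i,j) else 0)"
  define L0 where "L0 = mat e e (\<lambda>(i,j). if j < d then L $$ (i,j) else 0)"
  have "L0 * J0 = 1\<^sub>m e"
  proof (rule eq_matI)
    fix i j assume "i < dim_row (1\<^sub>m e :: complex mat)" "j < dim_col (1\<^sub>m e :: complex mat)"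
    hence ij: "i < e" "j < e" by auto
    have "(L0 * J0) $$ (i,j) = (\<Sum>l<e. (if l < d then L $$ (i,l) else 0) * (if l < d then J $$ (l,j) else 0))"
      using ij by (auto simp: L0_def J0_def scalar_prod_def atLeast0LessThan intro!: sum.cong)
    also have "\<dots> = (\<Sum>l<d. L $$ (i,l) * J $$ (l,j))"
      using de by (intro sum.mono_neutral_cong_right) auto
    also have "\<dots> = (L * J) $$ (i,j)"
      using ij J L by (auto simp: scalar_prod_def atLeast0LessThan intro!: sum.cong)
    finally show "(L0 * J0) $$ (i,j) = 1\<^sub>m e $$ (i,j)" using LJ by simp
  qed (auto simp: L0_def J0_def)
  hence "J0 * L0 = 1\<^sub>m e"
    by (rule mat_mult_left_right_inverse[rotated 2]) (auto simp: L0_def J0_def)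
  hence "(J0 * L0) $$ (d,d) = 1" using de by simp
  moreover have "(J0 * L0) $$ (d,d) = 0"
    using de by (auto simp: J0_def L0_def scalar_prod_def)
  ultimately show False by simp
qed

text \<open>Preimages of the unit vectors are the columns of a right inverse; injectivity makes it
  two-sided, and then the dimension bound applies in both directions.\<close>

lemma bij_mat_inverse:
  fixes N :: "complex mat"
  assumes N: "N \<in> carrier_mat a b"
    and inj: "\<And>v. v \<in> carrier_vec b \<Longrightarrow> N *\<^sub>v v = 0\<^sub>v a \<Longrightarrow> v = 0\<^sub>v b"
    and surj: "\<And>w. w \<in> carrier_vec a \<Longrightarrow> \<exists>v\<in>carrier_vec b. N *\<^sub>v v = w"
  shows "a = b" and "\<exists>R\<in>carrier_mat b a. N * R = 1\<^sub>m a \<and> R * N = 1\<^sub>m b"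
proof -
  have "\<forall>i. \<exists>v. i < a \<longrightarrow> v \<in> carrier_vec b \<and> N *\<^sub>v v = unit_vec a i"
    using surj by (metis unit_vec_carrier)
  then obtain f where f: "\<And>i. i < a \<Longrightarrow> f i \<in> carrier_vec b" "\<And>i. i < a \<Longrightarrow> N *\<^sub>v f i = unit_vec a i"
    by metis
  define R where "R = mat_of_cols b (map f [0..<a])"
  have R: "R \<in> carrier_mat b a" by (auto simp: R_def)
  have NR: "N * R = 1\<^sub>m a"
  proof (rule mat_col_eqI)
    fix i assume "i < dim_col (1\<^sub>m a :: complex mat)"
    hence i: "i < a" by simp
    have "col (N * R) i = N *\<^sub>v col R i" using N R i by (intro col_mult2) auto
    also have "col R i = f i" using i f by (auto simp: R_def col_mat_of_cols)
    finally show "col (N * R) i = col (1\<^sub>m a) i" using f i by simp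
  qed (use N R in auto)
  have RN: "R * N = 1\<^sub>m b"
  proof (rule eq_mat_vecI)
    fix v :: "complex vec" assume v: "v \<in> carrier_vec b"
    have Nv: "N *\<^sub>v v \<in> carrier_vec a" using N v by simp
    have RNv: "R *\<^sub>v (N *\<^sub>v v) \<in> carrier_vec b" using R Nv by simp
    have "N *\<^sub>v (R *\<^sub>v (N *\<^sub>v v) - v) = (N * R) *\<^sub>v (N *\<^sub>v v) - N *\<^sub>v v"
      using N R v Nv RNv by (simp add: mult_minus_distrib_mat_vec)
    also have "\<dots> = 0\<^sub>v a" using NR Nv by simp
    finally have "R *\<^sub>v (N *\<^sub>v v) - v = 0\<^sub>v b" using inj[of "R *\<^sub>v (N *\<^sub>v v) - v"] RNv v by simp
    hence "R *\<^sub>v (N *\<^sub>v v) = v" using RNv v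
      by (metis carrier_vecD eq_vecI index_minus_vec(1) index_zero_vec(1) right_minus_eq)
    thus "R * N *\<^sub>v v = 1\<^sub>m b *\<^sub>v v" using R N v by simp
  qed (use R N in auto)
  show "a = b" using left_inverse_dim_le[OF N R RN] left_inverse_dim_le[OF R N NR] by simp
  show "\<exists>R\<in>carrier_mat b a. N * R = 1\<^sub>m a \<and> R * N = 1\<^sub>m b" using R NR RN by blast
qed

text \<open>This takes the place of choosing a basis: the columns of \<open>J\<close> span
  \<open>K\<close>, and \<open>L\<close> reads off coordinates. A frame with \<open>e\<close>
  maximal is chosen inside \<open>K\<close>; a vector of \<open>K\<close> outside its range would
  allow one more column.\<close>

lemma vec_subspace_frame:
  assumes K: "vec_subspace d K"
  obtains e J L where "J \<in> carrier_mat d e" "L \<in> carrier_mat e d" "L * J = 1\<^sub>m e"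
    "K = (\<lambda>v. J *\<^sub>v v) ` carrier_vec e"
proof -
  define P where "P e \<longleftrightarrow> (\<exists>J L. J \<in> carrier_mat d e \<and> L \<in> carrier_mat e d \<and> L * J = 1\<^sub>m e \<and>
     (\<lambda>v. J *\<^sub>v v) ` carrier_vec e \<subseteq> K)" for e
  have P0: "P 0" unfolding P_def
  proof (intro exI conjI)
    show "(0\<^sub>m 0 d :: complex mat) * 0\<^sub>m d 0 = 1\<^sub>m 0" by (intro eq_matI) auto
    show "(\<lambda>v. 0\<^sub>m d 0 *\<^sub>v v) ` carrier_vec 0 \<subseteq> K"
    proof (rule image_subsetI)
      fix v :: "complex vec" assume "v \<in> carrier_vec 0"
      hence "0\<^sub>m d 0 *\<^sub>v v = 0\<^sub>v d" by (intro eq_vecI) (auto simp: scalar_prod_def)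
      thus "0\<^sub>m d 0 *\<^sub>v v \<in> K" using K by (simp add: vec_subspace_def)
    qed
  qed auto
  have bound: "\<And>e. P e \<Longrightarrow> e \<le> d" unfolding P_def using left_inverse_dim_le by blast
  obtain e where e: "P e" and max: "\<And>e'. P e' \<Longrightarrow> e' \<le> e"
    using Greatest_le_nat[of P _ d] GreatestI_nat[of P 0 d] P0 bound by blast
  obtain J L where J: "J \<in> carrier_mat d e" and L: "L \<in> carrier_mat e d" and LJ: "L * J = 1\<^sub>m e"
    and sub: "(\<lambda>v. J *\<^sub>v v) ` carrier_vec e \<subseteq> K" using e unfolding P_def by blast
  have "K \<subseteq> (\<lambda>v. J *\<^sub>v v) ` carrier_vec e"
  proof (rule ccontr)
    assume "\<not> ?thesis"
    then obtain v where vK: "v \<in> K" and vn: "v \<notin> (\<lambda>v. J *\<^sub>v v) ` carrier_vec e" by blast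
    have v: "v \<in> carrier_vec d" using vK K by (auto simp: vec_subspace_def)
    have Lv: "L *\<^sub>v v \<in> carrier_vec e" using L v by simp
    \<comment> \<open>The part of \<open>v\<close> that is new relative to the frame: it stays in
      \<open>K\<close> and is annihilated by \<open>L\<close>.\<close>
    define w where "w = v + (-1) \<cdot>\<^sub>v (J *\<^sub>v (L *\<^sub>v v))"
    have JLv: "J *\<^sub>v (L *\<^sub>v v) \<in> carrier_vec d" using J Lv by simp
    have w: "w \<in> carrier_vec d" using v JLv by (simp add: w_def)
    have wK: "w \<in> K" using K vK sub Lv unfolding w_def vec_subspace_def by blast
    have "w \<noteq> 0\<^sub>v d"
    proof
      assume w0: "w = 0\<^sub>v d"
      have "v = J *\<^sub>v (L *\<^sub>v v)"
      proof (rule eq_vecI)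
        fix i assume i: "i < dim_vec (J *\<^sub>v (L *\<^sub>v v))"
        hence "w $ i = v $ i - (J *\<^sub>v (L *\<^sub>v v)) $ i" using v J by (simp add: w_def)
        thus "v $ i = (J *\<^sub>v (L *\<^sub>v v)) $ i" using w0 i J by simp
      qed (use v J in auto)
      thus False using vn Lv by blast
    qed
    then obtain i0 where i0: "i0 < d" and wi0: "w $ i0 \<noteq> 0" using w
      by (metis carrier_vecD eq_vecI index_zero_vec(1) index_zero_vec(2))
    have Lw: "L *\<^sub>v w = 0\<^sub>v e"
    proof -
      have "L *\<^sub>v w = L *\<^sub>v v + (-1) \<cdot>\<^sub>v (L *\<^sub>v (J *\<^sub>v (L *\<^sub>v v)))"
        using L v JLv by (simp add: w_def mult_add_distrib_mat_vec[of _ e d] mult_mat_vec[of _ e d])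
      also have "L *\<^sub>v (J *\<^sub>v (L *\<^sub>v v)) = (L * J) *\<^sub>v (L *\<^sub>v v)" using L J Lv by simp
      finally show ?thesis using LJ Lv L by (intro eq_vecI) (auto simp del: index_mult_mat_vec)
    qed
    \<comment> \<open>\<open>Q\<close> kills the columns of \<open>J\<close> and fixes
      \<open>w\<close>. A row of \<open>Q\<close> at which \<open>w\<close> is non-zero, rescaled,
      is therefore the additional row of the enlarged left inverse.\<close>
    define Q where "Q = 1\<^sub>m d - J * L"
    have Q: "Q \<in> carrier_mat d d" using J L by (auto simp: Q_def)
    have QJ: "Q * J = 0\<^sub>m d e"
    proof -
      have "Q * J = J - J * L * J" using J L by (simp add: Q_def minus_mult_distrib_mat[of _ d d _ _ e])
      also have "J * L * J = J" using J L LJ by simp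
      finally show ?thesis using J by auto
    qed
    have Qw: "Q *\<^sub>v w = w"
    proof -
      have "Q *\<^sub>v w = w - J *\<^sub>v (L *\<^sub>v w)"
        using J L w by (simp add: Q_def minus_mult_distrib_mat_vec[of _ d d])
      thus ?thesis using Lw J w by auto
    qed
    define l where "l = (1 / w $ i0) \<cdot>\<^sub>v row Q i0"
    have l: "l \<in> carrier_vec d" using Q i0 by (auto simp: l_def)
    have lw: "l \<bullet> w = 1"
    proof -
      have "row Q i0 \<bullet> w = w $ i0" using Qw Q i0 by (metis carrier_matD(1) index_mult_mat_vec)
      thus ?thesis using wi0 Q w i0 by (simp add: l_def)
    qed
    have lJ: "l \<bullet> col J j = 0" if "j < e" for j
    proof -
      have "row Q i0 \<bullet> col J j = (Q * J) $$ (i0, j)" using Q J i0 that by simp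
      also have "\<dots> = 0" using QJ i0 that by simp
      finally show ?thesis using Q J i0 that by (simp add: l_def)
    qed
    define J' where "J' = mat d (Suc e) (\<lambda>(i,j). if j < e then J $$ (i,j) else w $ i)"
    define L' where "L' = mat (Suc e) d (\<lambda>(i,j). if i < e then L $$ (i,j) else l $ j)"
    have colJ': "col J' j = (if j < e then col J j else w)" if "j < Suc e" for j
      using that J w by (intro eq_vecI) (auto simp: J'_def)
    have rowL': "row L' i = (if i < e then row L i else l)" if "i < Suc e" for i
      using that L l by (intro eq_vecI) (auto simp: L'_def)
    have L'J': "L' * J' = 1\<^sub>m (Suc e)"
    proof (rule eq_matI)
      fix i j assume "i < dim_row (1\<^sub>m (Suc e) :: complex mat)" "j < dim_col (1\<^sub>m (Suc e) :: complex mat)"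
      hence ij: "i < Suc e" "j < Suc e" by auto
      have eq: "(L' * J') $$ (i,j) = row L' i \<bullet> col J' j" using ij by (simp add: L'_def J'_def)
      have 1: "row L i \<bullet> col J j = (if i = j then 1 else 0)" if "i < e" "j < e"
        using that LJ L J by (metis carrier_matD(1) carrier_matD(2) index_mult_mat(1) index_one_mat(1))
      have 2: "row L i \<bullet> w = 0" if "i < e"
        using that Lw L by (metis carrier_matD(1) index_mult_mat_vec index_zero_vec(1))
      have "i < e \<or> i = e" "j < e \<or> j = e" using ij by auto
      thus "(L' * J') $$ (i,j) = 1\<^sub>m (Suc e) $$ (i,j)"
        unfolding eq colJ'[OF ij(2)] rowL'[OF ij(1)] using ij 1 2 lJ lw by auto
    qed (auto simp: L'_def J'_def)
    have "P (Suc e)" unfolding P_def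
    proof (intro exI conjI)
      show "J' \<in> carrier_mat d (Suc e)" "L' \<in> carrier_mat (Suc e) d" by (auto simp: J'_def L'_def)
      show "L' * J' = 1\<^sub>m (Suc e)" by fact
      show "(\<lambda>v. J' *\<^sub>v v) ` carrier_vec (Suc e) \<subseteq> K"
      proof (rule image_subsetI)
        fix u :: "complex vec" assume u: "u \<in> carrier_vec (Suc e)"
        define u' where "u' = vec e (\<lambda>i. u $ i)"
        have "J' *\<^sub>v u = J *\<^sub>v u' + (u $ e) \<cdot>\<^sub>v w"
        proof (rule eq_vecI)
          fix i assume "i < dim_vec (J *\<^sub>v u' + (u $ e) \<cdot>\<^sub>v w)"
          hence i: "i < d" using w by simp
          have "(J' *\<^sub>v u) $ i = (\<Sum>j<Suc e. J' $$ (i,j) * u $ j)"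
            using i u by (auto simp: J'_def scalar_prod_def atLeast0LessThan intro!: sum.cong)
          also have "\<dots> = (\<Sum>j<e. J $$ (i,j) * u $ j) + w $ i * u $ e"
            using i by (simp add: J'_def)
          also have "(\<Sum>j<e. J $$ (i,j) * u $ j) = (J *\<^sub>v u') $ i"
            using i J by (auto simp: u'_def scalar_prod_def atLeast0LessThan intro!: sum.cong)
          finally show "(J' *\<^sub>v u) $ i = (J *\<^sub>v u' + (u $ e) \<cdot>\<^sub>v w) $ i" using i w J by simp
        qed (use w in \<open>auto simp: J'_def\<close>)
        moreover have "J *\<^sub>v u' \<in> K" using sub by (auto simp: u'_def)
        moreover have "(u $ e) \<cdot>\<^sub>v w \<in> K" using K wK by (simp add: vec_subspace_def)
        ultimately show "J' *\<^sub>v u \<in> K" using K by (simp add: vec_subspace_def)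
      qed
    qed
    from max[OF this] show False by simp
  qed
  with sub have "K = (\<lambda>v. J *\<^sub>v v) ` carrier_vec e" by blast
  from that[OF J L LJ this] show thesis .
qed

text \<open>Multiplicities are dimensions of a matrix module whose carrier is overwritten by a set
  of intertwiners. A linear parametrisation by \<open>carrier_vec e\<close> determines them,
  including the value 0 for \<open>e = 0\<close>.\<close>

lemma dim_of_linear_bij:
  fixes f :: "complex vec \<Rightarrow> complex mat"
  assumes f: "\<And>v. v \<in> carrier_vec e \<Longrightarrow> f v \<in> carrier_mat a b"
    and add: "\<And>v w. v \<in> carrier_vec e \<Longrightarrow> w \<in> carrier_vec e \<Longrightarrow> f (v + w) = f v + f w"
    and smult: "\<And>c v. v \<in> carrier_vec e \<Longrightarrow> f (c \<cdot>\<^sub>v v) = c \<cdot>\<^sub>m f v"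
    and inj: "\<And>v. v \<in> carrier_vec e \<Longrightarrow> f v = 0\<^sub>m a b \<Longrightarrow> v = 0\<^sub>v e"
    and S: "S = f ` carrier_vec e"
  shows "vectorspace.dim class_ring (module_mat TYPE(complex) a b\<lparr>carrier := S\<rparr>) = e"
proof -
  let ?M = "module_mat TYPE(complex) a b"
  let ?V = "module_vec TYPE(complex) e"
  have SM: "S \<subseteq> carrier_mat a b" using f S by auto
  have z: "0\<^sub>m a b \<in> S"
  proof -
    have "f (0 \<cdot>\<^sub>v 0\<^sub>v e) = 0 \<cdot>\<^sub>m f (0\<^sub>v e)" by (rule smult) simp
    moreover have "0 \<cdot>\<^sub>m f (0\<^sub>v e) = 0\<^sub>m a b" using f[of "0\<^sub>v e"] by (intro eq_matI) auto
    ultimately show ?thesis unfolding S by (metis imageI smult_carrier_vec zero_carrier_vec)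
  qed
  have vsM: "vectorspace class_ring ?M" by (rule matrix_vs)
  interpret M: vectorspace class_ring ?M by (rule matrix_vs)
  have "subspace class_ring S ?M"
    unfolding VectorSpace.subspace_def LinearCombinations.submodule_def
  proof (intro conjI allI impI)
    show "vectorspace class_ring ?M" by (rule matrix_vs)
    show "module class_ring ?M" by (rule M.module_axioms)
    show "S \<subseteq> carrier ?M" using SM by (simp add: module_mat_simps)
    show "\<zero>\<^bsub>?M\<^esub> \<in> S" using z by (simp add: module_mat_simps)
  next
    fix v w assume "v \<in> S" "w \<in> S"
    thus "v \<oplus>\<^bsub>?M\<^esub> w \<in> S" unfolding S using add by (auto simp: module_mat_simps) (metis add_carrier_vec imageI)
  next
    fix c v assume "v \<in> S"
    thus "c \<odot>\<^bsub>?M\<^esub> v \<in> S" unfolding S using smult by (auto simp: module_mat_simps) (metis smult_carrier_vec imageI)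
  qed
  hence vsS: "vectorspace class_ring (?M\<lparr>carrier := S\<rparr>)" by (rule M.subspace_is_vs)
  interpret S: vectorspace class_ring "?M\<lparr>carrier := S\<rparr>" by (rule vsS)
  interpret V: vec_space "TYPE(complex)" e .
  have lm: "linear_map class_ring ?V (?M\<lparr>carrier := S\<rparr>) f"
  proof (intro linear_map.intro mod_hom.intro vec_vs vsS vec_module S.module_axioms mod_hom_axioms.intro)
    show "f \<in> module_hom class_ring ?V (?M\<lparr>carrier := S\<rparr>)"
      unfolding LinearCombinations.module_hom_def using add smult S
      by (auto simp: module_mat_simps module_vec_simps)
  qed
  have injf: "inj_on f (carrier_vec e)"
  proof (rule inj_onI)
    fix v w assume v: "v \<in> carrier_vec e" and w: "w \<in> carrier_vec e" and eq: "f v = f w"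
    have "f (v + (-1) \<cdot>\<^sub>v w) = f v + (-1) \<cdot>\<^sub>m f w" using v w add smult by simp
    also have "\<dots> = 0\<^sub>m a b" using eq f[OF w] by (intro eq_matI) auto
    finally have vw: "v + (-1) \<cdot>\<^sub>v w = 0\<^sub>v e" using inj v w by simp
    show "v = w"
    proof (rule eq_vecI)
      fix i assume i: "i < dim_vec w"
      have "(v + (-1) \<cdot>\<^sub>v w) $ i = 0" using vw i w by simp
      thus "v $ i = w $ i" using i v w by simp
    qed (use v w in auto)
  qed
  have "vectorspace.dim class_ring ?V = vectorspace.dim class_ring (?M\<lparr>carrier := S\<rparr>)"
  proof (rule linear_map.dim_eq[OF lm])
    show "vectorspace.fin_dim class_ring ?V" by (rule V.fin_dim)
    show "inj_on f (carrier ?V)" using injf by (simp only: module_vec_simps)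
    show "f ` carrier ?V = carrier (?M\<lparr>carrier := S\<rparr>)" using S by (simp add: module_vec_simps)
  qed
  thus ?thesis using V.dim_is_n by (rule HOL.trans[OF HOL.sym])
qed

section \<open>Representations and Schur's lemma\<close>

text \<open>The degree is an explicit argument and preservation of the unit stands in for
  invertibility; over a group the inverse of \<open>\<rho> g\<close> is the image of the inverse of
  \<open>g\<close>.\<close>

definition is_rep :: "'g monoid \<Rightarrow> nat \<Rightarrow> ('g \<Rightarrow> complex mat) \<Rightarrow> bool" where
  "is_rep G d \<rho> \<longleftrightarrow> (\<forall>g\<in>carrier G. \<rho> g \<in> carrier_mat d d) \<and> \<rho> \<one>\<^bsub>G\<^esub> = 1\<^sub>m d \<and>
     (\<forall>g\<in>carrier G. \<forall>h\<in>carrier G. \<rho> (g \<otimes>\<^bsub>G\<^esub> h) = \<rho> g * \<rho> h)"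

lemma is_repD:
  assumes "is_rep G d \<rho>"
  shows "g \<in> carrier G \<Longrightarrow> \<rho> g \<in> carrier_mat d d" "\<rho> \<one>\<^bsub>G\<^esub> = 1\<^sub>m d"
    "g \<in> carrier G \<Longrightarrow> h \<in> carrier G \<Longrightarrow> \<rho> (g \<otimes>\<^bsub>G\<^esub> h) = \<rho> g * \<rho> h"
  using assms by (auto simp: is_rep_def)

lemma is_rep_degree: "is_rep G d \<rho> \<Longrightarrow> rep_degree G \<rho> = d"
  by (simp add: is_rep_def rep_degree_def)

lemma is_rep_mult_vec:
  assumes "is_rep G d \<rho>" "g \<in> carrier G" "h \<in> carrier G" "v \<in> carrier_vec d"
  shows "\<rho> (g \<otimes>\<^bsub>G\<^esub> h) *\<^sub>v v = \<rho> g *\<^sub>v (\<rho> h *\<^sub>v v)"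
  using assms by (simp add: is_repD[OF assms(1)] assoc_mult_mat_vec[of _ d d _ d])

lemma is_rep_vec:
  "is_rep G d \<rho> \<Longrightarrow> g \<in> carrier G \<Longrightarrow> v \<in> carrier_vec d \<Longrightarrow> \<rho> g *\<^sub>v v \<in> carrier_vec d"
  by (auto simp: is_rep_def)

lemma representation_iff:
  assumes G: "group G"
  shows "representation G \<rho> \<longleftrightarrow> is_rep G (rep_degree G \<rho>) \<rho>"
proof
  interpret group G by (rule G)
  assume "representation G \<rho>"
  then obtain d where h: "\<rho> \<in> hom G (GL d)" by (auto simp: representation_def)
  have c: "\<rho> g \<in> carrier_mat d d" and inv: "\<exists>B\<in>carrier_mat d d. B * \<rho> g = 1\<^sub>m d" if "g \<in> carrier G" for g
    using that h by (auto simp: hom_def GL_def units_of_def Units_def ring_mat_simps)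
  have m: "\<rho> (g \<otimes>\<^bsub>G\<^esub> g') = \<rho> g * \<rho> g'" if "g \<in> carrier G" "g' \<in> carrier G" for g g'
    using that h by (auto simp: hom_def GL_def units_of_def ring_mat_simps)
  obtain B where B: "B \<in> carrier_mat d d" "B * \<rho> \<one>\<^bsub>G\<^esub> = 1\<^sub>m d" using inv by blast
  \<comment> \<open>A homomorphism is only required to respect products, so the image of the unit is
    known to be an idempotent with left inverse \<open>B\<close>; such a matrix is the
    identity.\<close>
  have "\<rho> \<one>\<^bsub>G\<^esub> = (B * \<rho> \<one>\<^bsub>G\<^esub>) * \<rho> \<one>\<^bsub>G\<^esub>" using B c[OF one_closed] by simp
  also have "\<dots> = B * (\<rho> \<one>\<^bsub>G\<^esub> * \<rho> \<one>\<^bsub>G\<^esub>)"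
    using B(1) c[OF one_closed] by (intro assoc_mult_mat) auto
  also have "\<dots> = 1\<^sub>m d" using m[of "\<one>\<^bsub>G\<^esub>" "\<one>\<^bsub>G\<^esub>"] B by simp
  finally have "is_rep G d \<rho>" using c m by (auto simp: is_rep_def)
  thus "is_rep G (rep_degree G \<rho>) \<rho>" by (simp add: is_rep_degree)
next
  interpret group G by (rule G)
  let ?d = "rep_degree G \<rho>"
  assume r: "is_rep G ?d \<rho>"
  have "\<rho> g \<in> Units (ring_mat TYPE(complex) ?d ())" if g: "g \<in> carrier G" for g
    unfolding Units_def
  proof (intro CollectI conjI bexI)
    show "\<rho> (inv\<^bsub>G\<^esub> g) \<otimes>\<^bsub>ring_mat TYPE(complex) ?d ()\<^esub> \<rho> g = \<one>\<^bsub>ring_mat TYPE(complex) ?d ()\<^esub>"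
      using g is_repD(3)[OF r, of "inv\<^bsub>G\<^esub> g" g] is_repD(2)[OF r] by (simp add: ring_mat_simps)
    show "\<rho> g \<otimes>\<^bsub>ring_mat TYPE(complex) ?d ()\<^esub> \<rho> (inv\<^bsub>G\<^esub> g) = \<one>\<^bsub>ring_mat TYPE(complex) ?d ()\<^esub>"
      using g is_repD(3)[OF r, of g "inv\<^bsub>G\<^esub> g"] is_repD(2)[OF r] by (simp add: ring_mat_simps)
  qed (use g is_repD(1)[OF r] in \<open>auto simp: ring_mat_simps\<close>)
  thus "representation G \<rho>" unfolding representation_def
    by (intro exI[of _ ?d]) (auto simp: hom_def GL_def units_of_def is_repD(3)[OF r] ring_mat_simps)
qed

definition invariant :: "'g monoid \<Rightarrow> ('g \<Rightarrow> complex mat) \<Rightarrow> complex vec set \<Rightarrow> bool" where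
  "invariant G \<rho> K \<longleftrightarrow> (\<forall>g\<in>carrier G. \<forall>v\<in>K. \<rho> g *\<^sub>v v \<in> K)"

lemma irreducible_iff:
  assumes "group G"
  shows "irreducible_rep G \<rho> \<longleftrightarrow> is_rep G (rep_degree G \<rho>) \<rho> \<and> rep_degree G \<rho> > 0 \<and>
    (\<forall>K. vec_subspace (rep_degree G \<rho>) K \<and> invariant G \<rho> K \<longrightarrow>
       K = {0\<^sub>v (rep_degree G \<rho>)} \<or> K = carrier_vec (rep_degree G \<rho>))"
  unfolding irreducible_rep_def representation_iff[OF assms] vec_subspace_iff invariant_def by blast

lemma irreducible_repD:
  assumes "group G" "irreducible_rep G \<rho>" "is_rep G d \<rho>"
  shows "d > 0" "vec_subspace d K \<Longrightarrow> invariant G \<rho> K \<Longrightarrow> K = {0\<^sub>v d} \<or> K = carrier_vec d"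
  using irreducible_iff[OF assms(1), of \<rho>] assms is_rep_degree[OF assms(3)] by auto

lemma irreducible_is_rep:
  "group G \<Longrightarrow> irreducible_rep G \<rho> \<Longrightarrow> is_rep G (rep_degree G \<rho>) \<rho>"
  using irreducible_iff by blast

lemma vec_subspace_vimage:
  assumes M: "M \<in> carrier_mat d e" and K: "vec_subspace d K"
  shows "vec_subspace e {v \<in> carrier_vec e. M *\<^sub>v v \<in> K}"
proof -
  have "M *\<^sub>v 0\<^sub>v e = 0\<^sub>v d" using M by (intro eq_vecI) auto
  thus ?thesis using M K
    by (auto simp: vec_subspace_def mult_add_distrib_mat_vec[of _ d e] mult_mat_vec[of _ d e])
qed

lemma vec_subspace_zero: "vec_subspace d {0\<^sub>v d}"
  by (auto simp: vec_subspace_def)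

lemma vec_subspace_image:
  assumes M: "M \<in> carrier_mat d e"
  shows "vec_subspace d ((\<lambda>v. M *\<^sub>v v) ` carrier_vec e)"
  unfolding vec_subspace_def
proof (intro conjI ballI allI)
  show "0\<^sub>v d \<in> (\<lambda>v. M *\<^sub>v v) ` carrier_vec e"
    using M by (intro image_eqI[of _ _ "0\<^sub>v e"] eq_vecI) auto
next
  fix v w assume "v \<in> (\<lambda>v. M *\<^sub>v v) ` carrier_vec e" "w \<in> (\<lambda>v. M *\<^sub>v v) ` carrier_vec e"
  thus "v + w \<in> (\<lambda>v. M *\<^sub>v v) ` carrier_vec e"
    using M by (auto simp: mult_add_distrib_mat_vec[symmetric, of _ d e])
next
  fix a v assume "v \<in> (\<lambda>v. M *\<^sub>v v) ` carrier_vec e"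
  thus "a \<cdot>\<^sub>v v \<in> (\<lambda>v. M *\<^sub>v v) ` carrier_vec e"
    using M by (auto simp: mult_mat_vec[symmetric, of _ d e])
qed (use M in auto)

definition intertwines :: "'g monoid \<Rightarrow> nat \<Rightarrow> nat \<Rightarrow> ('g \<Rightarrow> complex mat) \<Rightarrow> ('g \<Rightarrow> complex mat) \<Rightarrow> complex mat \<Rightarrow> bool" where
  "intertwines G e d \<pi> \<rho> M \<longleftrightarrow> M \<in> carrier_mat d e \<and> (\<forall>g\<in>carrier G. M * \<pi> g = \<rho> g * M)"

lemma intertwiners_eq:
  "is_rep G e \<pi> \<Longrightarrow> is_rep G d \<rho> \<Longrightarrow> M \<in> intertwiners G \<pi> \<rho> \<longleftrightarrow> intertwines G e d \<pi> \<rho> M"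
  by (auto simp: intertwiners_def intertwines_def is_rep_degree)

lemma intertwines_vec:
  assumes "is_rep G e \<pi>" "is_rep G d \<rho>" "intertwines G e d \<pi> \<rho> M" "g \<in> carrier G" "v \<in> carrier_vec e"
  shows "M *\<^sub>v (\<pi> g *\<^sub>v v) = \<rho> g *\<^sub>v (M *\<^sub>v v)"
proof -
  have "\<pi> g \<in> carrier_mat e e" "\<rho> g \<in> carrier_mat d d" "M \<in> carrier_mat d e" "M * \<pi> g = \<rho> g * M"
    using assms by (auto simp: is_rep_def intertwines_def)
  thus ?thesis using assms(5) by (metis assoc_mult_mat_vec)
qed

lemma intertwinesI:
  assumes \<pi>: "is_rep G e \<pi>" and \<rho>: "is_rep G d \<rho>" and M: "M \<in> carrier_mat d e"
    and "\<And>g v. g \<in> carrier G \<Longrightarrow> v \<in> carrier_vec e \<Longrightarrow> M *\<^sub>v (\<pi> g *\<^sub>v v) = \<rho> g *\<^sub>v (M *\<^sub>v v)"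
  shows "intertwines G e d \<pi> \<rho> M"
  unfolding intertwines_def
proof (intro conjI ballI M)
  fix g assume g: "g \<in> carrier G"
  show "M * \<pi> g = \<rho> g * M"
    by (rule eq_mat_vecI[of _ d e])
      (use assms is_repD(1)[OF \<pi> g] is_repD(1)[OF \<rho> g] g in \<open>auto simp: assoc_mult_mat_vec[of _ d e _ e] assoc_mult_mat_vec[of _ d d _ e]\<close>)
qed

text \<open>The preimage of an invariant subspace under an intertwiner is invariant, so it is zero
  or everything. Hence a single non-zero vector landing in \<open>K\<close> drags the whole image
  into \<open>K\<close>.\<close>

lemma irreducible_vimage:
  assumes G: "group G" and irr: "irreducible_rep G \<pi>" and \<pi>: "is_rep G e \<pi>" and \<rho>: "is_rep G d \<rho>"
    and M: "intertwines G e d \<pi> \<rho> M" and K: "vec_subspace d K" "invariant G \<rho> K"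
    and v: "v \<in> carrier_vec e" "v \<noteq> 0\<^sub>v e" "M *\<^sub>v v \<in> K" and w: "w \<in> carrier_vec e"
  shows "M *\<^sub>v w \<in> K"
proof -
  let ?P = "{v \<in> carrier_vec e. M *\<^sub>v v \<in> K}"
  have Mc: "M \<in> carrier_mat d e" using M by (simp add: intertwines_def)
  have "vec_subspace e ?P" by (rule vec_subspace_vimage[OF Mc K(1)])
  moreover have "invariant G \<pi> ?P" unfolding invariant_def
    using K(2) intertwines_vec[OF \<pi> \<rho> M] is_rep_vec[OF \<pi>] by (auto simp: invariant_def)
  ultimately have "?P = {0\<^sub>v e} \<or> ?P = carrier_vec e" by (rule irreducible_repD(2)[OF G irr \<pi>])
  thus ?thesis using v w by blast
qed

lemma irreducible_intertwiner_inj: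
  assumes G: "group G" and irr: "irreducible_rep G \<pi>" and \<pi>: "is_rep G e \<pi>" and \<rho>: "is_rep G d \<rho>"
    and M: "intertwines G e d \<pi> \<rho> M" and nz: "M \<noteq> 0\<^sub>m d e"
    and v: "v \<in> carrier_vec e" "M *\<^sub>v v = 0\<^sub>v d"
  shows "v = 0\<^sub>v e"
proof (rule ccontr)
  assume vn: "v \<noteq> 0\<^sub>v e"
  have Mc: "M \<in> carrier_mat d e" using M by (simp add: intertwines_def)
  have "\<rho> g *\<^sub>v 0\<^sub>v d = 0\<^sub>v d" if "g \<in> carrier G" for g
    using is_repD(1)[OF \<rho> that] by (intro eq_vecI) auto
  hence "invariant G \<rho> {0\<^sub>v d}" by (simp add: invariant_def)
  hence "M *\<^sub>v w \<in> {0\<^sub>v d}" if "w \<in> carrier_vec e" for w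
    using irreducible_vimage[OF G irr \<pi> \<rho> M vec_subspace_zero _ v(1) vn _ that] v(2) by simp
  hence "M = 0\<^sub>m d e" using Mc by (intro eq_mat_vecI[OF Mc]) (auto intro!: eq_vecI)
  with nz show False ..
qed

lemma invariant_image:
  assumes \<pi>: "is_rep G e \<pi>" and \<rho>: "is_rep G d \<rho>" and M: "intertwines G e d \<pi> \<rho> M"
  shows "invariant G \<rho> ((\<lambda>v. M *\<^sub>v v) ` carrier_vec e)"
  unfolding invariant_def
  using intertwines_vec[OF \<pi> \<rho> M, symmetric] is_rep_vec[OF \<pi>] by auto

lemma irreducible_intertwiner_surj:
  assumes G: "group G" and irr: "irreducible_rep G \<rho>" and \<pi>: "is_rep G e \<pi>" and \<rho>: "is_rep G d \<rho>"
    and M: "intertwines G e d \<pi> \<rho> M" and nz: "M \<noteq> 0\<^sub>m d e"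
  shows "(\<lambda>v. M *\<^sub>v v) ` carrier_vec e = carrier_vec d"
proof -
  have Mc: "M \<in> carrier_mat d e" using M by (simp add: intertwines_def)
  have "(\<lambda>v. M *\<^sub>v v) ` carrier_vec e \<noteq> {0\<^sub>v d}"
  proof
    assume *: "(\<lambda>v. M *\<^sub>v v) ` carrier_vec e = {0\<^sub>v d}"
    have "M *\<^sub>v v = 0\<^sub>m d e *\<^sub>v v" if "v \<in> carrier_vec e" for v
    proof -
      have "M *\<^sub>v v = 0\<^sub>v d" using * that by blast
      also have "\<dots> = 0\<^sub>m d e *\<^sub>v v" using that by (intro eq_vecI) auto
      finally show ?thesis .
    qed
    hence "M = 0\<^sub>m d e" by (intro eq_mat_vecI[OF Mc]) auto
    with nz show False ..
  qed
  thus ?thesis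
    using irreducible_repD(2)[OF G irr \<rho> vec_subspace_image[OF Mc] invariant_image[OF \<pi> \<rho> M]] by blast
qed

lemma equivalent_repI:
  assumes \<pi>: "is_rep G e \<pi>" and \<rho>: "is_rep G d \<rho>" and M: "intertwines G e d \<pi> \<rho> M"
    and inj: "\<And>v. v \<in> carrier_vec e \<Longrightarrow> M *\<^sub>v v = 0\<^sub>v d \<Longrightarrow> v = 0\<^sub>v e"
    and surj: "(\<lambda>v. M *\<^sub>v v) ` carrier_vec e = carrier_vec d"
  shows "equivalent_rep G \<pi> \<rho>"
proof -
  have Mc: "M \<in> carrier_mat d e" using M by (simp add: intertwines_def)
  have s: "\<And>w. w \<in> carrier_vec d \<Longrightarrow> \<exists>v\<in>carrier_vec e. M *\<^sub>v v = w" using surj by (metis imageE)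
  note b = bij_mat_inverse[OF Mc inj s]
  then obtain R where "R \<in> carrier_mat e d" "M * R = 1\<^sub>m d" "R * M = 1\<^sub>m e" by blast
  hence "invertible_mat M" using b(1) Mc by (auto simp: invertible_mat_def inverts_mat_def)
  thus ?thesis using M intertwiners_eq[OF \<pi> \<rho>] by (auto simp: equivalent_rep_def)
qed

lemma schur_equivalent:
  assumes "group G" "irreducible_rep G \<pi>" "irreducible_rep G \<rho>" "is_rep G e \<pi>" "is_rep G d \<rho>"
    "intertwines G e d \<pi> \<rho> M" "M \<noteq> 0\<^sub>m d e"
  shows "equivalent_rep G \<pi> \<rho>"
  using equivalent_repI[OF assms(4-6)] irreducible_intertwiner_inj[OF assms(1,2,4-7)]
    irreducible_intertwiner_surj[OF assms(1,3-7)] by blast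

lemma equivalent_repE:
  assumes \<pi>: "is_rep G e \<pi>" and \<rho>: "is_rep G d \<rho>" and eq: "equivalent_rep G \<pi> \<rho>"
  obtains M R where "d = e" "intertwines G e d \<pi> \<rho> M" "intertwines G d e \<rho> \<pi> R" "M * R = 1\<^sub>m d" "R * M = 1\<^sub>m e"
proof -
  obtain M where M: "intertwines G e d \<pi> \<rho> M" and inv: "invertible_mat M"
    using eq intertwiners_eq[OF \<pi> \<rho>] by (auto simp: equivalent_rep_def)
  have Mc: "M \<in> carrier_mat d e" using M by (simp add: intertwines_def)
  have de: "d = e" using inv Mc by (auto simp: invertible_mat_def)
  obtain R where MR: "M * R = 1\<^sub>m d" and RM: "R * M = 1\<^sub>m (dim_row R)"
    using inv Mc by (auto simp: invertible_mat_def inverts_mat_def)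
  have "dim_col R = d" using MR by (metis index_mult_mat(3) index_one_mat(3))
  moreover have "dim_row R = e" using RM Mc by (metis carrier_matD(2) index_mult_mat(3) index_one_mat(3))
  ultimately have R: "R \<in> carrier_mat e d" and RM: "R * M = 1\<^sub>m e" using RM by auto
  have "intertwines G d e \<rho> \<pi> R"
  proof (rule intertwinesI[OF \<rho> \<pi> R])
    fix g :: 'a and v :: "complex vec" assume g: "g \<in> carrier G" and v: "v \<in> carrier_vec d"
    have c: "\<rho> g \<in> carrier_mat d d" "\<pi> g \<in> carrier_mat e e" using is_repD(1)[OF \<rho> g] is_repD(1)[OF \<pi> g] .
    have Rv: "R *\<^sub>v v \<in> carrier_vec e" using R v by simp
    have "v = M *\<^sub>v (R *\<^sub>v v)" using MR Mc R v by (metis assoc_mult_mat_vec one_mult_mat_vec)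
    hence "R *\<^sub>v (\<rho> g *\<^sub>v v) = R *\<^sub>v (M *\<^sub>v (\<pi> g *\<^sub>v (R *\<^sub>v v)))"
      using intertwines_vec[OF \<pi> \<rho> M g Rv] by simp
    also have "\<dots> = (R * M) *\<^sub>v (\<pi> g *\<^sub>v (R *\<^sub>v v))" using R Mc c Rv by simp
    also have "\<dots> = \<pi> g *\<^sub>v (R *\<^sub>v v)" using RM c Rv by simp
    finally show "R *\<^sub>v (\<rho> g *\<^sub>v v) = \<pi> g *\<^sub>v (R *\<^sub>v v)" .
  qed
  from that[OF de M this MR RM] show thesis .
qed

lemma equivalent_rep_refl: "is_rep G d \<rho> \<Longrightarrow> equivalent_rep G \<rho> \<rho>"
proof (rule equivalent_repI[of G d \<rho> d \<rho> "1\<^sub>m d"])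
  assume r: "is_rep G d \<rho>"
  show "intertwines G d d \<rho> \<rho> (1\<^sub>m d)" using is_rep_vec[OF r] by (intro intertwinesI[OF r r]) auto
  show "(\<lambda>v. 1\<^sub>m d *\<^sub>v v) ` carrier_vec d = (carrier_vec d :: complex vec set)" by simp
qed auto

lemma equivalent_rep_sym:
  assumes \<pi>: "is_rep G e \<pi>" and \<rho>: "is_rep G d \<rho>" and eq: "equivalent_rep G \<pi> \<rho>"
  shows "equivalent_rep G \<rho> \<pi>"
proof -
  obtain M R where a: "d = e" "intertwines G d e \<rho> \<pi> R" "M * R = 1\<^sub>m d" "R * M = 1\<^sub>m e" "intertwines G e d \<pi> \<rho> M"
    using equivalent_repE[OF assms] by metis
  hence "invertible_mat R" unfolding invertible_mat_def inverts_mat_def intertwines_def by auto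
  thus ?thesis using a(2) intertwiners_eq[OF \<rho> \<pi>] by (auto simp: equivalent_rep_def)
qed

lemma intertwines_comp:
  assumes \<pi>: "is_rep G a \<pi>" and \<rho>: "is_rep G b \<rho>" and \<sigma>: "is_rep G c \<sigma>"
    and M: "intertwines G a b \<pi> \<rho> M" and N: "intertwines G b c \<rho> \<sigma> N"
  shows "intertwines G a c \<pi> \<sigma> (N * M)"
proof -
  have Mc: "M \<in> carrier_mat b a" and Nc: "N \<in> carrier_mat c b" using M N by (auto simp: intertwines_def)
  show ?thesis
  proof (rule intertwinesI[OF \<pi> \<sigma>])
    fix g :: 'a and v :: "complex vec" assume g: "g \<in> carrier G" and v: "v \<in> carrier_vec a"
    have Mv: "M *\<^sub>v v \<in> carrier_vec b" "\<pi> g *\<^sub>v v \<in> carrier_vec a" using Mc v is_repD(1)[OF \<pi> g] by auto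
    show "N * M *\<^sub>v (\<pi> g *\<^sub>v v) = \<sigma> g *\<^sub>v (N * M *\<^sub>v v)"
      using intertwines_vec[OF \<pi> \<rho> M g v] intertwines_vec[OF \<rho> \<sigma> N g Mv(1)] Mc Nc v Mv
      by simp
  qed (use Mc Nc in auto)
qed

lemma equivalent_rep_trans:
  assumes \<pi>: "is_rep G a \<pi>" and \<rho>: "is_rep G b \<rho>" and \<sigma>: "is_rep G c \<sigma>"
    and e1: "equivalent_rep G \<pi> \<rho>" and e2: "equivalent_rep G \<rho> \<sigma>"
  shows "equivalent_rep G \<pi> \<sigma>"
proof -
  obtain M R where 1: "b = a" "intertwines G a b \<pi> \<rho> M" "intertwines G b a \<rho> \<pi> R" "M * R = 1\<^sub>m b" "R * M = 1\<^sub>m a"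
    using equivalent_repE[OF \<pi> \<rho> e1] by metis
  obtain N S where 2: "c = b" "intertwines G b c \<rho> \<sigma> N" "intertwines G c b \<sigma> \<rho> S" "N * S = 1\<^sub>m c" "S * N = 1\<^sub>m b"
    using equivalent_repE[OF \<rho> \<sigma> e2] by metis
  have c: "M \<in> carrier_mat b a" "R \<in> carrier_mat a b" "N \<in> carrier_mat c b" "S \<in> carrier_mat b c"
    using 1 2 by (auto simp: intertwines_def)
  have "(N * M) * (R * S) = N * (M * (R * S))" using c by (intro assoc_mult_mat) auto
  also have "M * (R * S) = M * R * S" using c by (intro assoc_mult_mat[symmetric]) auto
  also have "N * (M * R * S) = 1\<^sub>m c" using 1 2 c by simp
  finally have l: "(N * M) * (R * S) = 1\<^sub>m c" .
  have "(R * S) * (N * M) = R * (S * (N * M))" using c by (intro assoc_mult_mat) auto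
  also have "S * (N * M) = S * N * M" using c by (intro assoc_mult_mat[symmetric]) auto
  also have "R * (S * N * M) = 1\<^sub>m a" using 1 2 c by simp
  finally have r: "(R * S) * (N * M) = 1\<^sub>m a" .
  have "invertible_mat (N * M)" unfolding invertible_mat_def inverts_mat_def
    using l r 1(1) 2(1) c by auto
  thus ?thesis using intertwines_comp[OF \<pi> \<rho> \<sigma> 1(2) 2(2)] intertwiners_eq[OF \<pi> \<sigma>]
    by (auto simp: equivalent_rep_def)
qed

text \<open>Over the complex numbers \<open>M\<close> has an eigenvalue \<open>c\<close>; the
  intertwiner \<open>M - c\<close> kills an eigenvector, and a non-zero intertwiner out of an
  irreducible representation is injective.\<close>

lemma schur_scalar:
  assumes G: "group G" and irr: "irreducible_rep G \<pi>" and \<pi>: "is_rep G e \<pi>" and M: "intertwines G e e \<pi> \<pi> M"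
  obtains c where "M = c \<cdot>\<^sub>m 1\<^sub>m e"
proof -
  have Mc: "M \<in> carrier_mat e e" using M by (simp add: intertwines_def)
  have "spectrum M \<noteq> {}" using irreducible_repD(1)[OF G irr \<pi>] by (rule spectrum_non_empty[OF Mc])
  then obtain c v where v: "v \<in> carrier_vec e" "v \<noteq> 0\<^sub>v e" "M *\<^sub>v v = c \<cdot>\<^sub>v v"
    using Mc by (auto simp: spectrum_def eigenvalue_def eigenvector_def)
  define N where "N = M - c \<cdot>\<^sub>m 1\<^sub>m e"
  have Nc: "N \<in> carrier_mat e e" by (auto simp: N_def)
  have Nv: "N *\<^sub>v w = M *\<^sub>v w - c \<cdot>\<^sub>v w" if "w \<in> carrier_vec e" for w
    using that Mc by (auto simp: N_def minus_mult_distrib_mat_vec[of _ e e] intro!: eq_vecI)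
  have "intertwines G e e \<pi> \<pi> N"
  proof (rule intertwinesI[OF \<pi> \<pi> Nc])
    fix g :: 'a and w :: "complex vec" assume g: "g \<in> carrier G" and w: "w \<in> carrier_vec e"
    have c: "\<pi> g \<in> carrier_mat e e" using is_repD(1)[OF \<pi> g] .
    have "M *\<^sub>v w \<in> carrier_vec e" using Mc w by simp
    thus "N *\<^sub>v (\<pi> g *\<^sub>v w) = \<pi> g *\<^sub>v (N *\<^sub>v w)"
      using w c intertwines_vec[OF \<pi> \<pi> M g w]
      by (simp add: Nv mult_minus_distrib_mat_vec[of _ e e] mult_mat_vec[of _ e e])
  qed
  moreover have "N *\<^sub>v v = 0\<^sub>v e" using v by (simp add: Nv)
  ultimately have N0: "N = 0\<^sub>m e e" using irreducible_intertwiner_inj[OF G irr \<pi> \<pi> _ _ v(1)] v(2) by blast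
  have "M = c \<cdot>\<^sub>m 1\<^sub>m e"
  proof (rule eq_matI)
    fix i j assume "i < dim_row (c \<cdot>\<^sub>m 1\<^sub>m e)" "j < dim_col (c \<cdot>\<^sub>m 1\<^sub>m e)"
    hence ij: "i < e" "j < e" by auto
    have "N $$ (i,j) = 0" using N0 ij by simp
    thus "M $$ (i,j) = (c \<cdot>\<^sub>m 1\<^sub>m e) $$ (i,j)" using ij Mc by (simp add: N_def)
  qed (use Mc in auto)
  thus thesis by (rule that)
qed

text \<open>Turns an invariant subspace into a matrix representation with inclusion
  \<open>J\<close>. Multiplicativity holds because \<open>J L\<close> is the identity on
  \<open>K\<close>, which every \<open>\<rho> g\<close> preserves.\<close>

lemma subrep_frame:
  assumes \<rho>: "is_rep G d \<rho>" and K: "invariant G \<rho> K" "K = (\<lambda>v. J *\<^sub>v v) ` carrier_vec e"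
    and J: "J \<in> carrier_mat d e" and L: "L \<in> carrier_mat e d" and LJ: "L * J = 1\<^sub>m e"
    and G: "group G"
  shows "is_rep G e (\<lambda>g. L * \<rho> g * J)" "intertwines G e d (\<lambda>g. L * \<rho> g * J) \<rho> J"
proof -
  interpret group G by (rule G)
  have LJv: "L *\<^sub>v (J *\<^sub>v u) = u" if "u \<in> carrier_vec e" for u
    using that J L LJ by (metis assoc_mult_mat_vec one_mult_mat_vec)
  have JL: "J *\<^sub>v (L *\<^sub>v x) = x" if "x \<in> K" for x
    using that K(2) LJv by auto
  have c: "\<rho> g \<in> carrier_mat d d" if "g \<in> carrier G" for g using is_repD(1)[OF \<rho> that] .
  have pv: "(L * \<rho> g * J) *\<^sub>v u = L *\<^sub>v (\<rho> g *\<^sub>v (J *\<^sub>v u))" if "g \<in> carrier G" "u \<in> carrier_vec e" for g u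
  proof -
    have Lg: "L * \<rho> g \<in> carrier_mat e d" and Ju: "J *\<^sub>v u \<in> carrier_vec d" using c[OF that(1)] that L J by auto
    have "(L * \<rho> g * J) *\<^sub>v u = (L * \<rho> g) *\<^sub>v (J *\<^sub>v u)" by (rule assoc_mult_mat_vec[OF Lg J that(2)])
    thus ?thesis using assoc_mult_mat_vec[OF L c[OF that(1)] Ju] by simp
  qed
  have Jp: "J *\<^sub>v ((L * \<rho> g * J) *\<^sub>v u) = \<rho> g *\<^sub>v (J *\<^sub>v u)" if "g \<in> carrier G" "u \<in> carrier_vec e" for g u
  proof -
    have "J *\<^sub>v u \<in> K" using that K(2) by blast
    hence "\<rho> g *\<^sub>v (J *\<^sub>v u) \<in> K" using K(1) that by (auto simp: invariant_def)
    thus ?thesis using that by (simp add: pv JL)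
  qed
  have pc: "L * \<rho> g * J \<in> carrier_mat e e" if "g \<in> carrier G" for g using c[OF that] L J by simp
  show r: "is_rep G e (\<lambda>g. L * \<rho> g * J)" unfolding is_rep_def
  proof (intro conjI ballI pc)
    show "L * \<rho> \<one>\<^bsub>G\<^esub> * J = 1\<^sub>m e" using is_repD(2)[OF \<rho>] L LJ by simp
    fix g h assume g: "g \<in> carrier G" and h: "h \<in> carrier G"
    show "L * \<rho> (g \<otimes>\<^bsub>G\<^esub> h) * J = (L * \<rho> g * J) * (L * \<rho> h * J)"
    proof (rule eq_mat_vecI[of _ e e])
      fix u :: "complex vec" assume u: "u \<in> carrier_vec e"
      have hu: "(L * \<rho> h * J) *\<^sub>v u \<in> carrier_vec e" using pc[OF h] u by simp
      have "((L * \<rho> g * J) * (L * \<rho> h * J)) *\<^sub>v u = (L * \<rho> g * J) *\<^sub>v ((L * \<rho> h * J) *\<^sub>v u)"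
        using pc[OF g] pc[OF h] u by (rule assoc_mult_mat_vec)
      also have "\<dots> = L *\<^sub>v (\<rho> g *\<^sub>v (\<rho> h *\<^sub>v (J *\<^sub>v u)))" by (simp add: pv[OF g hu] Jp[OF h u])
      also have "\<dots> = L *\<^sub>v (\<rho> (g \<otimes>\<^bsub>G\<^esub> h) *\<^sub>v (J *\<^sub>v u))"
        using is_rep_mult_vec[OF \<rho> g h, of "J *\<^sub>v u"] J u by simp
      finally show "L * \<rho> (g \<otimes>\<^bsub>G\<^esub> h) * J *\<^sub>v u = ((L * \<rho> g * J) * (L * \<rho> h * J)) *\<^sub>v u"
        using pv[of "g \<otimes>\<^bsub>G\<^esub> h" u] g h u by simp
    qed (use pc[of "g \<otimes>\<^bsub>G\<^esub> h"] mult_carrier_mat[OF pc[OF g] pc[OF h]] g h in auto)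
  qed
  show "intertwines G e d (\<lambda>g. L * \<rho> g * J) \<rho> J"
    by (rule intertwinesI[OF r \<rho> J]) (use Jp in auto)
qed

text \<open>Irreducibility of the dual, phrased with transposes in place of inverse transposes. The
  annihilator of \<open>K\<close> under the bilinear dot product is invariant for \<rho>, so it is
  everything or zero.\<close>

lemma irreducible_transpose:
  assumes G: "group G" and irr: "irreducible_rep G \<rho>" and \<rho>: "is_rep G d \<rho>"
    and K: "vec_subspace d K" and inv: "\<And>g v. g \<in> carrier G \<Longrightarrow> v \<in> K \<Longrightarrow> transpose_mat (\<rho> g) *\<^sub>v v \<in> K"
  shows "K = {0\<^sub>v d} \<or> K = carrier_vec d"
proof -
  define P where "P = {w \<in> carrier_vec d. \<forall>k\<in>K. w \<bullet> k = 0}"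
  have Kc: "k \<in> carrier_vec d" if "k \<in> K" for k using that K by (auto simp: vec_subspace_def)
  have "vec_subspace d P" unfolding vec_subspace_def P_def using Kc
    by (auto simp: add_scalar_prod_distrib[of _ d])
  moreover have "invariant G \<rho> P" unfolding invariant_def
  proof (intro ballI)
    fix g w assume g: "g \<in> carrier G" and w: "w \<in> P"
    have c: "\<rho> g \<in> carrier_mat d d" by (rule is_repD(1)[OF \<rho> g])
    have "(\<rho> g *\<^sub>v w) \<bullet> k = 0" if k: "k \<in> K" for k
    proof -
      have "(transpose_mat (\<rho> g) *\<^sub>v k) \<bullet> w = k \<bullet> (\<rho> g *\<^sub>v w)"
        using c w k Kc by (intro transpose_vec_mult_scalar) (auto simp: P_def)
      moreover have "w \<bullet> (transpose_mat (\<rho> g) *\<^sub>v k) = 0" using w inv[OF g k] by (auto simp: P_def)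
      moreover have "w \<in> carrier_vec d" using w by (simp add: P_def)
      moreover note Kc[OF k] c
      ultimately show ?thesis
        by (metis mult_mat_vec_carrier comm_scalar_prod transpose_carrier_mat)
    qed
    thus "\<rho> g *\<^sub>v w \<in> P" using c w by (auto simp: P_def)
  qed
  ultimately have "P = {0\<^sub>v d} \<or> P = carrier_vec d" by (rule irreducible_repD(2)[OF G irr \<rho>])
  thus ?thesis
  proof
    assume P: "P = carrier_vec d"
    have "k = 0\<^sub>v d" if k: "k \<in> K" for k
    proof (rule eq_vecI)
      fix i assume i: "i < dim_vec (0\<^sub>v d)"
      have "unit_vec d i \<in> P" using P by simp
      hence "unit_vec d i \<bullet> k = 0" using k by (auto simp: P_def)
      thus "k $ i = 0\<^sub>v d $ i" using i Kc[OF k] by simp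
    qed (use Kc[OF k] in simp)
    moreover have "0\<^sub>v d \<in> K" using K by (simp add: vec_subspace_def)
    ultimately show ?thesis by blast
  next
    assume P: "P = {0\<^sub>v d}"
    obtain e J L where J: "J \<in> carrier_mat d e" and L: "L \<in> carrier_mat e d" and LJ: "L * J = 1\<^sub>m e"
      and KJ: "K = (\<lambda>v. J *\<^sub>v v) ` carrier_vec e" using vec_subspace_frame[OF K] .
    \<comment> \<open>\<open>Q\<close> vanishes on \<open>K\<close>, so its rows lie in the
      annihilator \<open>P\<close>, which is zero. Hence \<open>J L\<close> is the identity and
      \<open>K\<close> is the full space.\<close>
    define Q where "Q = 1\<^sub>m d - J * L"
    have Q: "Q \<in> carrier_mat d d" using J L by (auto simp: Q_def)
    have Qv: "Q *\<^sub>v v = v - J *\<^sub>v (L *\<^sub>v v)" if "v \<in> carrier_vec d" for v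
      using that J L by (simp add: Q_def minus_mult_distrib_mat_vec[of _ d d])
    have LJv: "L *\<^sub>v (J *\<^sub>v u) = u" if "u \<in> carrier_vec e" for u
      using that J L LJ by (metis assoc_mult_mat_vec one_mult_mat_vec)
    have QK: "Q *\<^sub>v k = 0\<^sub>v d" if k: "k \<in> K" for k
    proof -
      obtain u where u: "u \<in> carrier_vec e" "k = J *\<^sub>v u" using k KJ by blast
      thus ?thesis using Qv[OF Kc[OF k]] LJv J by simp
    qed
    have row0: "row Q i = 0\<^sub>v d" if i: "i < d" for i
    proof -
      have "row Q i \<bullet> k = 0" if "k \<in> K" for k
        using QK[OF that] i Q by (metis carrier_matD(1) index_mult_mat_vec index_zero_vec(1))
      hence "row Q i \<in> P" using Q by (auto simp: P_def)
      thus ?thesis using P by simp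
    qed
    have "v \<in> K" if v: "v \<in> carrier_vec d" for v
    proof -
      have "J *\<^sub>v (L *\<^sub>v v) = v"
      proof (rule eq_vecI)
        fix i assume i: "i < dim_vec v"
        have "(Q *\<^sub>v v) $ i = 0" using i v Q row0[of i] by simp
        thus "(J *\<^sub>v (L *\<^sub>v v)) $ i = v $ i" using Qv[OF v] i v J by simp
      qed (use v J in auto)
      thus ?thesis using KJ L v by (metis imageI mult_mat_vec_carrier)
    qed
    thus ?thesis using Kc by blast
  qed
qed

section \<open>Weight spaces of an abelian subgroup\<close>

text \<open>The matrix of a group algebra element. The index set is a parameter: it is
  \<open>N\<close> for weight projections and the carrier of \<open>H\<close> for matrix
  coefficients, and inductions run over its finite subsets.\<close>

definition rep_alg :: "'g set \<Rightarrow> nat \<Rightarrow> ('g \<Rightarrow> complex mat) \<Rightarrow> ('g \<Rightarrow> complex) \<Rightarrow> complex mat" where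
  "rep_alg S d \<rho> a = mat d d (\<lambda>(i,j). \<Sum>g\<in>S. a g * \<rho> g $$ (i,j))"

lemma rep_alg_carrier [simp]: "rep_alg S d \<rho> a \<in> carrier_mat d d"
  by (simp add: rep_alg_def)

lemma rep_alg_empty: "rep_alg {} d \<rho> a = 0\<^sub>m d d"
  by (auto simp: rep_alg_def)

lemma rep_alg_insert:
  assumes "finite S" "g \<notin> S" "\<rho> g \<in> carrier_mat d d"
  shows "rep_alg (insert g S) d \<rho> a = a g \<cdot>\<^sub>m \<rho> g + rep_alg S d \<rho> a"
  using assms by (intro eq_matI) (auto simp: rep_alg_def)

text \<open>Serves for three kinds of functional: a coordinate, pairing with a fixed vector under
  \<open>hform\<close>, and evaluation at a point of the function attached to a vector.\<close>

lemma linear_functional_rep_alg: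
  fixes l :: "complex vec \<Rightarrow> complex"
  assumes S: "finite S" "\<And>g. g \<in> S \<Longrightarrow> \<rho> g \<in> carrier_mat d d" and v: "v \<in> carrier_vec d"
    and add: "\<And>v w. v \<in> carrier_vec d \<Longrightarrow> w \<in> carrier_vec d \<Longrightarrow> l (v + w) = l v + l w"
    and smult: "\<And>c v. v \<in> carrier_vec d \<Longrightarrow> l (c \<cdot>\<^sub>v v) = c * l v"
  shows "l (rep_alg S d \<rho> a *\<^sub>v v) = (\<Sum>g\<in>S. a g * l (\<rho> g *\<^sub>v v))"
  using S
proof (induction S)
  case empty
  have "rep_alg {} d \<rho> a *\<^sub>v v = 0 \<cdot>\<^sub>v v" using v by (intro eq_vecI) (auto simp: rep_alg_empty)
  thus ?case using smult[OF v, of 0] by simp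
next
  case (insert g S)
  have c: "\<rho> g \<in> carrier_mat d d" "\<rho> g *\<^sub>v v \<in> carrier_vec d" "rep_alg S d \<rho> a *\<^sub>v v \<in> carrier_vec d"
    using insert.prems v mult_mat_vec_carrier[OF rep_alg_carrier v] by (auto intro: mult_mat_vec_carrier)
  have "(a g \<cdot>\<^sub>m \<rho> g) *\<^sub>v v = a g \<cdot>\<^sub>v (\<rho> g *\<^sub>v v)" using c v by (intro eq_vecI) auto
  hence "rep_alg (insert g S) d \<rho> a *\<^sub>v v = a g \<cdot>\<^sub>v (\<rho> g *\<^sub>v v) + rep_alg S d \<rho> a *\<^sub>v v"
    using rep_alg_insert[of S g \<rho> d a, OF insert.hyps c(1)] add_mult_distrib_mat_vec[of "a g \<cdot>\<^sub>m \<rho> g" d d "rep_alg S d \<rho> a" v] c v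
    by simp
  thus ?case using insert c add smult by simp
qed

lemma (in group) subgroup_sum_translate:
  assumes N: "subgroup N G" and b: "b \<in> N"
  shows "(\<Sum>a\<in>N. f (b \<otimes> a)) = (\<Sum>a\<in>N. f a)"
proof (rule sum.reindex_bij_betw)
  interpret N: group "G\<lparr>carrier := N\<rparr>" by (rule subgroup.subgroup_is_group[OF N is_group])
  show "bij_betw ((\<otimes>) b) N N"
    using N.inj_on_cmult[of b] N.surj_const_mult[of b] b by (simp add: bij_betw_def)
qed

text \<open>Absolute value one is expressed by saying that conjugation inverts the value, the form
  in which it is used in sums over \<open>N\<close>.\<close>

definition unitary_char :: "'g monoid \<Rightarrow> 'g set \<Rightarrow> ('g \<Rightarrow> complex) \<Rightarrow> bool" where
  "unitary_char G N \<chi> \<longleftrightarrow> (\<forall>a\<in>N. \<forall>b\<in>N. \<chi> (a \<otimes>\<^bsub>G\<^esub> b) = \<chi> a * \<chi> b) \<and> (\<forall>a\<in>N. \<chi> a * cnj (\<chi> a) = 1)"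

definition weight_space :: "'g set \<Rightarrow> nat \<Rightarrow> ('g \<Rightarrow> complex mat) \<Rightarrow> ('g \<Rightarrow> complex) \<Rightarrow> complex vec set" where
  "weight_space N d \<rho> \<chi> = {v \<in> carrier_vec d. \<forall>a\<in>N. \<rho> a *\<^sub>v v = \<chi> a \<cdot>\<^sub>v v}"

lemma vec_subspace_weight_space:
  assumes "\<And>a. a \<in> N \<Longrightarrow> \<rho> a \<in> carrier_mat d d"
  shows "vec_subspace d (weight_space N d \<rho> \<chi>)"
proof -
  have "\<rho> a *\<^sub>v 0\<^sub>v d = \<chi> a \<cdot>\<^sub>v 0\<^sub>v d" if "a \<in> N" for a
    using assms[OF that] by (intro eq_vecI) auto
  thus ?thesis using assms
    by (auto simp: vec_subspace_def weight_space_def mult_add_distrib_mat_vec[of _ d d]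
        mult_mat_vec[of _ d d] smult_add_distrib_vec smult_smult_assoc mult.commute)
qed

text \<open>The group algebra element is \<open>card N\<close> times the usual projection onto a
  weight space; translating the summation variable by \<open>b\<close> pulls out the factor
  \<open>\<chi> b\<close>.\<close>

lemma rep_alg_weight_space:
  assumes G: "group G" and \<rho>: "is_rep G d \<rho>" and N: "subgroup N G" "finite N" and \<chi>: "unitary_char G N \<chi>"
    and v: "v \<in> carrier_vec d"
  shows "rep_alg N d \<rho> (\<lambda>a. cnj (\<chi> a)) *\<^sub>v v \<in> weight_space N d \<rho> \<chi>"
  unfolding weight_space_def
proof (intro CollectI conjI ballI)
  interpret group G by (rule G)
  let ?P = "rep_alg N d \<rho> (\<lambda>a. cnj (\<chi> a))"
  have NG: "a \<in> carrier G" if "a \<in> N" for a using that N(1) subgroup.subset by blast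
  have c: "\<rho> a \<in> carrier_mat d d" if "a \<in> N" for a using is_repD(1)[OF \<rho>] NG[OF that] .
  show "?P *\<^sub>v v \<in> carrier_vec d" using v by (metis mult_mat_vec_carrier rep_alg_carrier)
  fix b assume b: "b \<in> N"
  show "\<rho> b *\<^sub>v (?P *\<^sub>v v) = \<chi> b \<cdot>\<^sub>v (?P *\<^sub>v v)"
  proof (rule eq_vecI)
    fix i assume "i < dim_vec (\<chi> b \<cdot>\<^sub>v (?P *\<^sub>v v))"
    hence i: "i < d" by (simp add: rep_alg_def)
    have "(\<rho> b *\<^sub>v (?P *\<^sub>v v)) $ i = (\<Sum>a\<in>N. cnj (\<chi> a) * (\<rho> b *\<^sub>v (\<rho> a *\<^sub>v v)) $ i)"
      using c[OF b] i
      by (intro linear_functional_rep_alg[OF N(2) c v])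
        (auto simp: mult_add_distrib_mat_vec[of _ d d] mult_mat_vec[of _ d d] simp del: index_mult_mat_vec)
    also have "\<dots> = (\<Sum>a\<in>N. \<chi> b * (cnj (\<chi> (b \<otimes>\<^bsub>G\<^esub> a)) * (\<rho> (b \<otimes>\<^bsub>G\<^esub> a) *\<^sub>v v) $ i))"
    proof (rule sum.cong[OF refl])
      fix a assume a: "a \<in> N"
      have 1: "\<chi> b * cnj (\<chi> b) = 1" "\<chi> (b \<otimes>\<^bsub>G\<^esub> a) = \<chi> b * \<chi> a"
        using \<chi> a b by (auto simp: unitary_char_def)
      have "\<chi> b * cnj (\<chi> (b \<otimes>\<^bsub>G\<^esub> a)) = cnj (\<chi> a)"
        unfolding 1(2) complex_cnj_mult using 1(1) by (metis mult.assoc mult_1)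
      moreover have "\<rho> (b \<otimes>\<^bsub>G\<^esub> a) *\<^sub>v v = \<rho> b *\<^sub>v (\<rho> a *\<^sub>v v)"
        using is_rep_mult_vec[OF \<rho> NG[OF b] NG[OF a] v] .
      ultimately show "cnj (\<chi> a) * (\<rho> b *\<^sub>v (\<rho> a *\<^sub>v v)) $ i =
          \<chi> b * (cnj (\<chi> (b \<otimes>\<^bsub>G\<^esub> a)) * (\<rho> (b \<otimes>\<^bsub>G\<^esub> a) *\<^sub>v v) $ i)"
        by (metis mult.assoc)
    qed
    also have "\<dots> = \<chi> b * (\<Sum>a\<in>N. cnj (\<chi> a) * (\<rho> a *\<^sub>v v) $ i)"
      unfolding sum_distrib_left[symmetric]
      by (subst subgroup_sum_translate[OF N(1) b]) simp
    also have "(\<Sum>a\<in>N. cnj (\<chi> a) * (\<rho> a *\<^sub>v v) $ i) = (?P *\<^sub>v v) $ i"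
      using i by (intro linear_functional_rep_alg[OF N(2) c v, symmetric]) auto
    finally show "(\<rho> b *\<^sub>v (?P *\<^sub>v v)) $ i = (\<chi> b \<cdot>\<^sub>v (?P *\<^sub>v v)) $ i"
      using i by (simp add: rep_alg_def)
  qed (use c[OF b] in \<open>simp add: rep_alg_def\<close>)
qed

text \<open>Weyl's unitary trick: the standard Hermitian product averaged over \<open>G\<close>,
  without normalisation.\<close>

definition hform :: "'g monoid \<Rightarrow> ('g \<Rightarrow> complex mat) \<Rightarrow> complex vec \<Rightarrow> complex vec \<Rightarrow> complex" where
  "hform G \<rho> v w = (\<Sum>g\<in>carrier G. (\<rho> g *\<^sub>v v) \<bullet>c (\<rho> g *\<^sub>v w))"

context
  fixes G :: "'g monoid" and \<rho> :: "'g \<Rightarrow> complex mat" and d :: nat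
  assumes G: "group G" and fin: "finite (carrier G)" and \<rho>: "is_rep G d \<rho>"
begin

interpretation group G by (rule G)

lemma hform_invariant:
  assumes a: "a \<in> carrier G" and v: "v \<in> carrier_vec d" "w \<in> carrier_vec d"
  shows "hform G \<rho> (\<rho> a *\<^sub>v v) (\<rho> a *\<^sub>v w) = hform G \<rho> v w"
proof -
  have "hform G \<rho> (\<rho> a *\<^sub>v v) (\<rho> a *\<^sub>v w) = (\<Sum>g\<in>carrier G. (\<rho> (g \<otimes>\<^bsub>G\<^esub> a) *\<^sub>v v) \<bullet>c (\<rho> (g \<otimes>\<^bsub>G\<^esub> a) *\<^sub>v w))"
    unfolding hform_def by (rule sum.cong[OF refl]) (simp add: is_rep_mult_vec[OF \<rho>] a v)
  also have "\<dots> = hform G \<rho> v w" unfolding hform_def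
  proof (rule sum.reindex_bij_betw)
    have "x \<in> (\<lambda>g. g \<otimes>\<^bsub>G\<^esub> a) ` carrier G" if "x \<in> carrier G" for x
      using a that by (intro image_eqI[of _ _ "x \<otimes>\<^bsub>G\<^esub> inv\<^bsub>G\<^esub> a"]) (auto simp: m_assoc)
    thus "bij_betw (\<lambda>g. g \<otimes>\<^bsub>G\<^esub> a) (carrier G) (carrier G)"
      using a by (auto simp: bij_betw_def inj_on_multc)
  qed
  finally show ?thesis .
qed

lemma hform_left:
  assumes "v \<in> carrier_vec d" "v' \<in> carrier_vec d" "w \<in> carrier_vec d"
  shows "hform G \<rho> (v + v') w = hform G \<rho> v w + hform G \<rho> v' w"
    "hform G \<rho> (c \<cdot>\<^sub>v v) w = c * hform G \<rho> v w"
    "hform G \<rho> w (c \<cdot>\<^sub>v v) = cnj c * hform G \<rho> w v"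
proof -
  note [simp] = is_rep_vec[OF \<rho>] is_repD(1)[OF \<rho>]
  show "hform G \<rho> (v + v') w = hform G \<rho> v w + hform G \<rho> v' w"
    unfolding hform_def sum.distrib[symmetric]
    by (rule sum.cong[OF refl])
      (use assms in \<open>simp add: mult_add_distrib_mat_vec[of _ d d] add_scalar_prod_distrib[of _ d]\<close>)
  show "hform G \<rho> (c \<cdot>\<^sub>v v) w = c * hform G \<rho> v w"
    unfolding hform_def sum_distrib_left
    by (rule sum.cong[OF refl])
      (use assms in \<open>simp add: mult_mat_vec[of _ d d] smult_scalar_prod_distrib[of _ d]\<close>)
  show "hform G \<rho> w (c \<cdot>\<^sub>v v) = cnj c * hform G \<rho> w v"
    unfolding hform_def sum_distrib_left
    by (rule sum.cong[OF refl])
      (use assms in \<open>simp add: mult_mat_vec[of _ d d] conjugate_smult_vec scalar_prod_smult_distrib[of _ d]\<close>)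
qed

lemma hform_sym:
  assumes "v \<in> carrier_vec d" "w \<in> carrier_vec d"
  shows "hform G \<rho> w v = cnj (hform G \<rho> v w)"
  unfolding hform_def cnj_sum
proof (rule sum.cong[OF refl])
  fix g assume g: "g \<in> carrier G"
  have c: "\<rho> g *\<^sub>v v \<in> carrier_vec d" "\<rho> g *\<^sub>v w \<in> carrier_vec d" using is_rep_vec[OF \<rho> g] assms by auto
  have "cnj ((\<rho> g *\<^sub>v v) \<bullet>c (\<rho> g *\<^sub>v w)) = conjugate (\<rho> g *\<^sub>v v) \<bullet> (\<rho> g *\<^sub>v w)"
    using conjugate_sprod_vec[of "\<rho> g *\<^sub>v v" d "conjugate (\<rho> g *\<^sub>v w)"] c by simp
  thus "(\<rho> g *\<^sub>v w) \<bullet>c (\<rho> g *\<^sub>v v) = cnj ((\<rho> g *\<^sub>v v) \<bullet>c (\<rho> g *\<^sub>v w))"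
    using c by (simp add: conjugate_vec_sprod_comm[of _ d])
qed

lemma hform_definite:
  assumes v: "v \<in> carrier_vec d" and 0: "hform G \<rho> v v = 0"
  shows "v = 0\<^sub>v d"
proof -
  have "\<forall>g\<in>carrier G. (\<rho> g *\<^sub>v v) \<bullet>c (\<rho> g *\<^sub>v v) = 0"
    using 0 unfolding hform_def
    by (subst (asm) sum_nonneg_eq_0_iff[OF fin]) (use v is_rep_vec[OF \<rho>] in auto)
  hence "(\<rho> \<one>\<^bsub>G\<^esub> *\<^sub>v v) \<bullet>c (\<rho> \<one>\<^bsub>G\<^esub> *\<^sub>v v) = 0" by blast
  thus ?thesis using v is_repD(2)[OF \<rho>] conjugate_square_eq_0_vec[OF v] by simp
qed

text \<open>Project \<open>m\<close> to the weight: the result lies in \<open>K\<close> and in the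
  weight space, so it is zero. Moving the projection to the other side of the invariant form, where
  \<open>N\<close> acts on \<open>v\<close> by \<chi>, yields \<open>card N\<close> times the
  product of \<open>m\<close> and \<open>v\<close>.\<close>

lemma hform_weight_space:
  assumes N: "subgroup N G" and \<chi>: "unitary_char G N \<chi>"
    and K: "vec_subspace d K" "invariant G \<rho> K" "K \<inter> weight_space N d \<rho> \<chi> = {0\<^sub>v d}"
    and m: "m \<in> K" and v: "v \<in> weight_space N d \<rho> \<chi>"
  shows "hform G \<rho> m v = 0"
proof -
  let ?P = "rep_alg N d \<rho> (\<lambda>a. cnj (\<chi> a))"
  have NG: "a \<in> carrier G" if "a \<in> N" for a using that N(1) subgroup.subset by blast
  have finN: "finite N" using fin NG by (meson finite_subset subsetI)
  have c: "\<rho> a \<in> carrier_mat d d" if "a \<in> N" for a using is_repD(1)[OF \<rho>] NG[OF that] .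
  have mc: "m \<in> carrier_vec d" using m K(1) by (auto simp: vec_subspace_def)
  have vc: "v \<in> carrier_vec d" using v by (simp add: weight_space_def)
  have PK: "rep_alg S d \<rho> a *\<^sub>v m \<in> K" if "finite S" "S \<subseteq> carrier G" for S a
    using that
  proof (induction S)
    case empty
    have "rep_alg {} d \<rho> a *\<^sub>v m = 0\<^sub>v d" using mc by (intro eq_vecI) (auto simp: rep_alg_empty)
    thus ?case using K(1) by (simp add: vec_subspace_def)
  next
    case (insert g S)
    have g: "\<rho> g \<in> carrier_mat d d" using insert.prems is_repD(1)[OF \<rho>] by simp
    have "(a g \<cdot>\<^sub>m \<rho> g) *\<^sub>v m = a g \<cdot>\<^sub>v (\<rho> g *\<^sub>v m)" using g mc by (intro eq_vecI) auto
    hence "rep_alg (insert g S) d \<rho> a *\<^sub>v m = a g \<cdot>\<^sub>v (\<rho> g *\<^sub>v m) + rep_alg S d \<rho> a *\<^sub>v m"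
      using rep_alg_insert[of S g \<rho> d a, OF insert.hyps(1,2) g] add_mult_distrib_mat_vec[of "a g \<cdot>\<^sub>m \<rho> g" d d "rep_alg S d \<rho> a" m] g mc
      by simp
    thus ?case using insert K(1,2) m by (simp add: vec_subspace_def invariant_def)
  qed
  have "?P *\<^sub>v m \<in> K" using NG by (intro PK[OF finN]) auto
  hence "?P *\<^sub>v m = 0\<^sub>v d" using rep_alg_weight_space[OF G \<rho> N finN \<chi> mc] K(3) by blast
  moreover have "0 \<cdot>\<^sub>v 0\<^sub>v d = (0\<^sub>v d :: complex vec)" by auto
  ultimately have "0 = hform G \<rho> (?P *\<^sub>v m) v"
    using hform_left(2)[of "0\<^sub>v d" "0\<^sub>v d" v 0] vc by simp
  also have "\<dots> = (\<Sum>a\<in>N. cnj (\<chi> a) * hform G \<rho> (\<rho> a *\<^sub>v m) v)"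
    by (rule linear_functional_rep_alg[OF finN c mc]) (auto simp: hform_left vc)
  also have "\<dots> = (\<Sum>a\<in>N. hform G \<rho> m v)"
  proof (rule sum.cong[OF refl])
    fix a assume a: "a \<in> N"
    have 1: "\<chi> a * cnj (\<chi> a) = 1" using \<chi> a by (simp add: unitary_char_def)
    have "hform G \<rho> m v = hform G \<rho> (\<rho> a *\<^sub>v m) (\<rho> a *\<^sub>v v)"
      using hform_invariant[OF NG[OF a] mc vc] by simp
    also have "\<dots> = hform G \<rho> (\<rho> a *\<^sub>v m) (\<chi> a \<cdot>\<^sub>v v)" using v a by (simp add: weight_space_def)
    also have "\<dots> = cnj (\<chi> a) * hform G \<rho> (\<rho> a *\<^sub>v m) v"
      using hform_left(3)[OF vc vc, of "\<rho> a *\<^sub>v m" "\<chi> a"] is_rep_vec[OF \<rho> NG[OF a] mc] by simp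
    finally show "cnj (\<chi> a) * hform G \<rho> (\<rho> a *\<^sub>v m) v = hform G \<rho> m v" by simp
  qed
  also have "\<dots> = of_nat (card N) * hform G \<rho> m v" by simp
  finally show ?thesis using finN subgroup.one_closed[OF N] by auto
qed

text \<open>An invariant subspace meeting \<open>W\<close> trivially is orthogonal to \<open>W\<close> for an invariant Hermitian
  form, hence to the submodule generated by \<open>W\<close>.\<close>

lemma minimal_invariant_subspace:
  assumes N: "subgroup N G" and \<chi>: "unitary_char G N \<chi>"
    and W: "W = weight_space N d \<rho> \<chi>"
    and dich: "\<And>K. vec_subspace d K \<Longrightarrow> invariant G \<rho> K \<Longrightarrow> K \<inter> W \<noteq> {0\<^sub>v d} \<Longrightarrow> W \<subseteq> K"
  obtains M where "vec_subspace d M" "invariant G \<rho> M" "W \<subseteq> M"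
    "\<And>K. vec_subspace d K \<Longrightarrow> invariant G \<rho> K \<Longrightarrow> W \<subseteq> K \<Longrightarrow> M \<subseteq> K"
    "\<And>K. vec_subspace d K \<Longrightarrow> invariant G \<rho> K \<Longrightarrow> K \<subseteq> M \<Longrightarrow> K = {0\<^sub>v d} \<or> K = M"
proof -
  define F where "F = {K. vec_subspace d K \<and> invariant G \<rho> K \<and> W \<subseteq> K}"
  define M where "M = \<Inter>F"
  have "carrier_vec d \<in> F"
    using is_rep_vec[OF \<rho>] by (auto simp: F_def vec_subspace_def invariant_def W weight_space_def)
  hence Msub: "M \<subseteq> carrier_vec d" by (auto simp: M_def)
  have M1: "vec_subspace d M" using Msub unfolding M_def F_def vec_subspace_def by auto
  have M2: "invariant G \<rho> M" by (auto simp: M_def F_def invariant_def)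
  have M3: "W \<subseteq> M" by (auto simp: M_def F_def)
  have M4: "M \<subseteq> K" if "vec_subspace d K" "invariant G \<rho> K" "W \<subseteq> K" for K
    using that by (auto simp: M_def F_def)
  have M5: "K = {0\<^sub>v d} \<or> K = M" if K: "vec_subspace d K" "invariant G \<rho> K" and KM: "K \<subseteq> M" for K
  proof (cases "K \<inter> W = {0\<^sub>v d}")
    case False
    thus ?thesis using dich[OF K False] M4[OF K] KM by blast
  next
    case True
    have Kc: "k \<in> carrier_vec d" if "k \<in> K" for k using that K(1) by (auto simp: vec_subspace_def)
    have Wc: "k \<in> carrier_vec d" if "k \<in> W" for k using that by (simp add: W weight_space_def)
    define P where "P = {w \<in> carrier_vec d. \<forall>k\<in>K. hform G \<rho> w k = 0}"
    have "vec_subspace d P" unfolding vec_subspace_def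
    proof (intro conjI ballI allI)
      have "0 \<cdot>\<^sub>v 0\<^sub>v d = (0\<^sub>v d :: complex vec)" by auto
      thus "0\<^sub>v d \<in> P" using hform_left(2)[of "0\<^sub>v d" "0\<^sub>v d" _ 0] Kc by (auto simp: P_def)
    qed (auto simp: P_def hform_left Kc)
    moreover have "invariant G \<rho> P" unfolding invariant_def
    proof (intro ballI)
      fix g w assume g: "g \<in> carrier G" and w: "w \<in> P"
      have wc: "w \<in> carrier_vec d" using w by (simp add: P_def)
      have "hform G \<rho> (\<rho> g *\<^sub>v w) k = 0" if k: "k \<in> K" for k
      proof -
        define k' where "k' = \<rho> (inv\<^bsub>G\<^esub> g) *\<^sub>v k"
        have k': "k' \<in> K" using K(2) k g by (auto simp: invariant_def k'_def)
        have "\<rho> g *\<^sub>v k' = \<rho> (g \<otimes>\<^bsub>G\<^esub> inv\<^bsub>G\<^esub> g) *\<^sub>v k"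
          unfolding k'_def using is_rep_mult_vec[OF \<rho> g _ Kc[OF k], of "inv\<^bsub>G\<^esub> g"] g by simp
        also have "\<dots> = k" using g is_repD(2)[OF \<rho>] Kc[OF k] by simp
        finally have "hform G \<rho> (\<rho> g *\<^sub>v w) k = hform G \<rho> (\<rho> g *\<^sub>v w) (\<rho> g *\<^sub>v k')" by simp
        also have "\<dots> = hform G \<rho> w k'" by (rule hform_invariant[OF g wc Kc[OF k']])
        also have "\<dots> = 0" using w k' by (simp add: P_def)
        finally show ?thesis .
      qed
      thus "\<rho> g *\<^sub>v w \<in> P" using is_rep_vec[OF \<rho> g wc] by (simp add: P_def)
    qed
    moreover have "W \<subseteq> P"
    proof
      fix v assume v: "v \<in> W"
      have "hform G \<rho> v k = 0" if k: "k \<in> K" for k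
        using hform_weight_space[OF N \<chi> K True[unfolded W] k v[unfolded W]] hform_sym[OF Kc[OF k] Wc[OF v]] by simp
      thus "v \<in> P" using Wc[OF v] by (simp add: P_def)
    qed
    \<comment> \<open>The orthogonal complement \<open>P\<close> of \<open>K\<close> is invariant
      and contains \<open>W\<close>, so minimality puts \<open>M\<close> inside it. As
      \<open>K\<close> lies in \<open>M\<close>, its vectors are orthogonal to themselves.\<close>
    ultimately have "M \<subseteq> P" by (rule M4)
    hence "k = 0\<^sub>v d" if "k \<in> K" for k
      using that KM hform_definite[OF Kc[OF that]] by (auto simp: P_def)
    moreover have "0\<^sub>v d \<in> K" using K(1) by (simp add: vec_subspace_def)
    ultimately show ?thesis by blast
  qed
  show thesis by (rule that[OF M1 M2 M3 M4 M5])
qed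

end

text \<open>Compare \<open>J\<close> with a frame \<open>J0\<close> of its image:
  \<open>L0 * J\<close> is a bijection between coordinate spaces, and undoing it after
  \<open>L0\<close> inverts \<open>J\<close>.\<close>

lemma inj_mat_left_inverse:
  fixes J :: "complex mat"
  assumes J: "J \<in> carrier_mat d e" and inj: "\<And>v. v \<in> carrier_vec e \<Longrightarrow> J *\<^sub>v v = 0\<^sub>v d \<Longrightarrow> v = 0\<^sub>v e"
  obtains L where "L \<in> carrier_mat e d" "L * J = 1\<^sub>m e" "\<And>v. v \<in> carrier_vec e \<Longrightarrow> L *\<^sub>v (J *\<^sub>v v) = v"
proof -
  obtain e0 J0 L0 where J0: "J0 \<in> carrier_mat d e0" and L0: "L0 \<in> carrier_mat e0 d"
    and LJ0: "L0 * J0 = 1\<^sub>m e0" and im: "(\<lambda>v. J *\<^sub>v v) ` carrier_vec e = (\<lambda>v. J0 *\<^sub>v v) ` carrier_vec e0"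
    using vec_subspace_frame[OF vec_subspace_image[OF J]] by metis
  have L0J0: "L0 *\<^sub>v (J0 *\<^sub>v u) = u" if "u \<in> carrier_vec e0" for u
    using that J0 L0 LJ0 by (metis assoc_mult_mat_vec one_mult_mat_vec)
  have N: "L0 * J \<in> carrier_mat e0 e" using L0 J by simp
  have Nv: "(L0 * J) *\<^sub>v v = L0 *\<^sub>v (J *\<^sub>v v)" if "v \<in> carrier_vec e" for v
    using L0 J that by simp
  have injN: "v = 0\<^sub>v e" if v: "v \<in> carrier_vec e" and 0: "(L0 * J) *\<^sub>v v = 0\<^sub>v e0" for v
  proof -
    obtain u where u: "u \<in> carrier_vec e0" "J *\<^sub>v v = J0 *\<^sub>v u" using im v by blast
    hence "u = 0\<^sub>v e0" using 0 Nv[OF v] L0J0 by simp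
    hence "J *\<^sub>v v = 0\<^sub>v d" using u J0 by (auto intro!: eq_vecI)
    thus ?thesis by (rule inj[OF v])
  qed
  have surjN: "\<exists>v\<in>carrier_vec e. (L0 * J) *\<^sub>v v = w" if w: "w \<in> carrier_vec e0" for w
  proof -
    obtain v where "v \<in> carrier_vec e" "J0 *\<^sub>v w = J *\<^sub>v v" using im w by blast
    thus ?thesis using Nv L0J0[OF w] by metis
  qed
  obtain R where R: "R \<in> carrier_mat e e0" "R * (L0 * J) = 1\<^sub>m e"
    using bij_mat_inverse(2)[OF N injN surjN] by blast
  have RL: "R * L0 \<in> carrier_mat e d" using R L0 by simp
  have 1: "(R * L0) * J = 1\<^sub>m e" using R L0 J by simp
  show thesis
  proof (rule that[OF RL 1])
    fix v :: "complex vec" assume v: "v \<in> carrier_vec e"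
    have "(R * L0) *\<^sub>v (J *\<^sub>v v) = ((R * L0) * J) *\<^sub>v v" by (rule assoc_mult_mat_vec[OF RL J v, symmetric])
    thus "(R * L0) *\<^sub>v (J *\<^sub>v v) = v" using 1 v by simp
  qed
qed

lemma inj_mat_cancel:
  fixes J :: "complex mat"
  assumes J: "J \<in> carrier_mat d e" and inj: "\<And>v. v \<in> carrier_vec e \<Longrightarrow> J *\<^sub>v v = 0\<^sub>v d \<Longrightarrow> v = 0\<^sub>v e"
    and v: "v \<in> carrier_vec e" "w \<in> carrier_vec e" "J *\<^sub>v v = J *\<^sub>v w"
  shows "v = w"
  using inj_mat_left_inverse[OF J inj] v by metis

text \<open>The left inverse \<open>L\<close> of \<open>J\<close> need not commute with the group.
  Its composite with \<open>\<phi>\<close> does, since applying the injective \<open>J\<close> turns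
  it back into \<open>\<phi>\<close>.\<close>

lemma factor_through:
  assumes \<pi>: "is_rep G a \<pi>" and \<sigma>: "is_rep G b \<sigma>" and \<rho>: "is_rep G d \<rho>"
    and \<phi>: "intertwines G a d \<pi> \<rho> \<phi>" and J: "intertwines G b d \<sigma> \<rho> J"
    and inj: "\<And>v. v \<in> carrier_vec b \<Longrightarrow> J *\<^sub>v v = 0\<^sub>v d \<Longrightarrow> v = 0\<^sub>v b"
    and sub: "\<And>v. v \<in> carrier_vec a \<Longrightarrow> \<phi> *\<^sub>v v \<in> (\<lambda>v. J *\<^sub>v v) ` carrier_vec b"
  obtains \<xi> where "intertwines G a b \<pi> \<sigma> \<xi>" "\<phi> = J * \<xi>"
    "\<And>v. v \<in> carrier_vec a \<Longrightarrow> J *\<^sub>v (\<xi> *\<^sub>v v) = \<phi> *\<^sub>v v"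
proof -
  have Jc: "J \<in> carrier_mat d b" and \<phi>c: "\<phi> \<in> carrier_mat d a" using \<phi> J by (auto simp: intertwines_def)
  obtain L where L: "L \<in> carrier_mat b d" "\<And>v. v \<in> carrier_vec b \<Longrightarrow> L *\<^sub>v (J *\<^sub>v v) = v"
    using inj_mat_left_inverse[OF Jc inj] by metis
  define \<xi> where "\<xi> = L * \<phi>"
  have c: "\<xi> \<in> carrier_mat b a" using L \<phi>c by (simp add: \<xi>_def)
  have J\<xi>: "J *\<^sub>v (\<xi> *\<^sub>v v) = \<phi> *\<^sub>v v" if v: "v \<in> carrier_vec a" for v
  proof -
    obtain u where u: "u \<in> carrier_vec b" "\<phi> *\<^sub>v v = J *\<^sub>v u" using sub[OF v] by blast
    have "\<xi> *\<^sub>v v = L *\<^sub>v (\<phi> *\<^sub>v v)" unfolding \<xi>_def by (rule assoc_mult_mat_vec[OF L(1) \<phi>c v])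
    thus ?thesis using u L by simp
  qed
  have "intertwines G a b \<pi> \<sigma> \<xi>"
  proof (rule intertwinesI[OF \<pi> \<sigma> c])
    fix g :: 'a and v :: "complex vec" assume g: "g \<in> carrier G" and v: "v \<in> carrier_vec a"
    have \<pi>v: "\<pi> g *\<^sub>v v \<in> carrier_vec a" using is_rep_vec[OF \<pi> g v] .
    have \<xi>v: "\<xi> *\<^sub>v v \<in> carrier_vec b" using c v by simp
    have "J *\<^sub>v (\<xi> *\<^sub>v (\<pi> g *\<^sub>v v)) = \<rho> g *\<^sub>v (J *\<^sub>v (\<xi> *\<^sub>v v))"
      using J\<xi>[OF \<pi>v] J\<xi>[OF v] intertwines_vec[OF \<pi> \<rho> \<phi> g v] by simp
    also have "\<dots> = J *\<^sub>v (\<sigma> g *\<^sub>v (\<xi> *\<^sub>v v))" using intertwines_vec[OF \<sigma> \<rho> J g \<xi>v] by simp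
    finally show "\<xi> *\<^sub>v (\<pi> g *\<^sub>v v) = \<sigma> g *\<^sub>v (\<xi> *\<^sub>v v)"
      using inj_mat_cancel[OF Jc inj] mult_mat_vec_carrier[OF c \<pi>v] is_rep_vec[OF \<sigma> g \<xi>v] by blast
  qed
  moreover have "\<phi> = J * \<xi>"
  proof (rule eq_mat_vecI[OF \<phi>c])
    fix v :: "complex vec" assume v: "v \<in> carrier_vec a"
    show "\<phi> *\<^sub>v v = (J * \<xi>) *\<^sub>v v" using J\<xi>[OF v] assoc_mult_mat_vec[OF Jc c v] by simp
  qed (use Jc c in auto)
  ultimately show thesis using that J\<xi> by blast
qed

lemma factor_through_image:
  assumes \<pi>: "is_rep G a \<pi>" and \<sigma>: "is_rep G b \<sigma>" and \<rho>: "is_rep G d \<rho>"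
    and \<phi>: "intertwines G a d \<pi> \<rho> \<phi>" and J: "intertwines G b d \<sigma> \<rho> J"
    and inj: "\<forall>v\<in>carrier_vec b. J *\<^sub>v v = 0\<^sub>v d \<longrightarrow> v = 0\<^sub>v b"
    and sub: "(\<lambda>v. \<phi> *\<^sub>v v) ` carrier_vec a \<subseteq> (\<lambda>v. J *\<^sub>v v) ` carrier_vec b"
  shows "\<exists>\<xi>. intertwines G a b \<pi> \<sigma> \<xi> \<and> \<phi> = J * \<xi>"
proof (rule factor_through[OF \<pi> \<sigma> \<rho> \<phi> J])
  show "v = 0\<^sub>v b" if "v \<in> carrier_vec b" "J *\<^sub>v v = 0\<^sub>v d" for v using inj that by blast
  show "\<phi> *\<^sub>v v \<in> (\<lambda>v. J *\<^sub>v v) ` carrier_vec b" if "v \<in> carrier_vec a" for v using sub that by blast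
  fix \<xi> assume "intertwines G a b \<pi> \<sigma> \<xi>" "\<phi> = J * \<xi>"
  thus "\<exists>\<xi>. intertwines G a b \<pi> \<sigma> \<xi> \<and> \<phi> = J * \<xi>" by blast
qed

section \<open>Isomorphism classes of irreducible representations and Schur orthogonality\<close>

definition irr_rel :: "'g monoid \<Rightarrow> (('g \<Rightarrow> complex mat) \<times> ('g \<Rightarrow> complex mat)) set" where
  "irr_rel G = {(\<pi>, \<rho>). irreducible_rep G \<pi> \<and> irreducible_rep G \<rho> \<and> equivalent_rep G \<pi> \<rho>}"

lemma Irr_eq: "Irr G = {\<rho>. irreducible_rep G \<rho>} // irr_rel G"
  by (simp add: Irr_def irr_rel_def)

lemma equiv_irr_rel:
  assumes G: "group G"
  shows "equiv {\<rho>. irreducible_rep G \<rho>} (irr_rel G)"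
proof (rule equivI)
  note r = irreducible_is_rep[OF G]
  show "irr_rel G \<subseteq> {\<rho>. irreducible_rep G \<rho>} \<times> {\<rho>. irreducible_rep G \<rho>}" by (auto simp: irr_rel_def)
  show "refl_on {\<rho>. irreducible_rep G \<rho>} (irr_rel G)"
    using equivalent_rep_refl[OF r] by (auto simp: refl_on_def irr_rel_def)
  show "sym (irr_rel G)" using equivalent_rep_sym[OF r r] by (auto simp: sym_def irr_rel_def)
  show "trans (irr_rel G)" unfolding trans_def irr_rel_def
    using equivalent_rep_trans[OF r r r] by blast
qed

lemma class_rep_in:
  assumes G: "group G" and c: "c \<in> Irr G"
  shows "class_rep c \<in> c"
  using in_quotient_imp_non_empty[OF equiv_irr_rel[OF G] c[unfolded Irr_eq]]
  unfolding class_rep_def by (simp add: some_in_eq)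

lemma Irr_memD:
  assumes G: "group G" and c: "c \<in> Irr G" and \<tau>: "\<tau> \<in> c"
  shows "irreducible_rep G \<tau>" "is_rep G (rep_degree G \<tau>) \<tau>"
proof -
  show "irreducible_rep G \<tau>"
    using in_quotient_imp_subset[OF equiv_irr_rel[OF G] c[unfolded Irr_eq]] \<tau> by blast
  thus "is_rep G (rep_degree G \<tau>) \<tau>" by (rule irreducible_is_rep[OF G])
qed

lemma Irr_mem_degree:
  assumes G: "group G" and c: "c \<in> Irr G" and \<tau>: "\<tau> \<in> c" "\<tau>' \<in> c"
  shows "rep_degree G \<tau> = rep_degree G \<tau>'"
proof -
  have "(\<tau>, \<tau>') \<in> irr_rel G"
    using in_quotient_imp_in_rel[OF equiv_irr_rel[OF G] c[unfolded Irr_eq]] \<tau> by simp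
  hence "equivalent_rep G \<tau> \<tau>'" by (simp add: irr_rel_def)
  thus ?thesis using equivalent_repE[OF Irr_memD(2)[OF G c \<tau>(1)] Irr_memD(2)[OF G c \<tau>(2)]] by metis
qed

lemma Irr_equivalent_eq:
  assumes G: "group G" and c: "c \<in> Irr G" "c' \<in> Irr G" and \<tau>: "\<tau> \<in> c" "\<tau>' \<in> c'"
    and eq: "equivalent_rep G \<tau> \<tau>'"
  shows "c = c'"
  using quotient_eqI[OF equiv_irr_rel[OF G] c[unfolded Irr_eq] \<tau>]
    Irr_memD(1)[OF G c(1) \<tau>(1)] Irr_memD(1)[OF G c(2) \<tau>(2)] eq by (simp add: irr_rel_def)

text \<open>Schur orthogonality without normalisation: a matrix coefficient of \<tau>0, used as a
  group algebra element, acts as zero in every inequivalent irreducible \<tau>.\<close>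

lemma rep_alg_matrix_coeff_zero:
  assumes H: "group H" and fin: "finite (carrier H)"
    and irr: "irreducible_rep H \<tau>0" "irreducible_rep H \<tau>" and ne: "\<not> equivalent_rep H \<tau>0 \<tau>"
    and \<tau>0: "is_rep H e0 \<tau>0" and \<tau>: "is_rep H e \<tau>"
  shows "rep_alg (carrier H) e \<tau> (\<lambda>h. \<tau>0 (inv\<^bsub>H\<^esub> h) $$ (0,0)) = 0\<^sub>m e e"
proof (rule eq_matI)
  interpret group H by (rule H)
  fix i j assume "i < dim_row (0\<^sub>m e e :: complex mat)" "j < dim_col (0\<^sub>m e e :: complex mat)"
  hence i: "i < e" and j: "j < e" by auto
  have e0: "e0 > 0" by (rule irreducible_repD(1)[OF H irr(1) \<tau>0])
  \<comment> \<open>\<open>Q\<close> is the sum over \<open>h\<close> of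
    \<open>\<tau> h * M * \<tau>0 (inv h)\<close>, where \<open>M\<close> is the matrix unit in row
    \<open>j\<close> and column 0. Averaging makes it an intertwiner from \<tau>0 to \<tau>, and its
    entry \<open>(i, 0)\<close> is the wanted coefficient.\<close>
  define Q where "Q = mat e e0 (\<lambda>(i,l). \<Sum>h\<in>carrier H. \<tau> h $$ (i,j) * \<tau>0 (inv\<^bsub>H\<^esub> h) $$ (0,l))"
  have "intertwines H e0 e \<tau>0 \<tau> Q" unfolding intertwines_def
  proof (intro conjI ballI)
    show "Q \<in> carrier_mat e e0" by (simp add: Q_def)
    fix g assume g: "g \<in> carrier H"
    have g0: "\<tau>0 g \<in> carrier_mat e0 e0" and g1: "\<tau> g \<in> carrier_mat e e"
      using is_repD(1)[OF \<tau>0 g] is_repD(1)[OF \<tau> g] .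
    show "Q * \<tau>0 g = \<tau> g * Q"
    proof (rule eq_matI)
      fix a l assume "a < dim_row (\<tau> g * Q)" "l < dim_col (\<tau> g * Q)"
      hence a: "a < e" and l: "l < e0" using g1 by (auto simp: Q_def)
      have "(Q * \<tau>0 g) $$ (a,l) = (\<Sum>m<e0. (\<Sum>h\<in>carrier H. \<tau> h $$ (a,j) * \<tau>0 (inv\<^bsub>H\<^esub> h) $$ (0,m)) * \<tau>0 g $$ (m,l))"
        using a l g0 by (auto simp: Q_def scalar_prod_def atLeast0LessThan intro!: sum.cong)
      also have "\<dots> = (\<Sum>h\<in>carrier H. \<tau> h $$ (a,j) * (\<Sum>m<e0. \<tau>0 (inv\<^bsub>H\<^esub> h) $$ (0,m) * \<tau>0 g $$ (m,l)))"
        unfolding sum_distrib_right sum_distrib_left by (subst sum.swap) (simp add: mult.assoc)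
      also have "\<dots> = (\<Sum>h\<in>carrier H. \<tau> h $$ (a,j) * \<tau>0 (inv\<^bsub>H\<^esub> h \<otimes>\<^bsub>H\<^esub> g) $$ (0,l))"
      proof (rule sum.cong[OF refl])
        fix h assume h: "h \<in> carrier H"
        have "\<tau>0 (inv\<^bsub>H\<^esub> h) \<in> carrier_mat e0 e0" using is_repD(1)[OF \<tau>0, of "inv\<^bsub>H\<^esub> h"] h by simp
        hence "\<tau>0 (inv\<^bsub>H\<^esub> h \<otimes>\<^bsub>H\<^esub> g) $$ (0,l) = (\<Sum>m<e0. \<tau>0 (inv\<^bsub>H\<^esub> h) $$ (0,m) * \<tau>0 g $$ (m,l))"
          using is_repD(3)[OF \<tau>0, of "inv\<^bsub>H\<^esub> h" g] h g g0 l e0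
          by (auto simp: scalar_prod_def atLeast0LessThan intro!: sum.cong)
        thus "\<tau> h $$ (a,j) * (\<Sum>m<e0. \<tau>0 (inv\<^bsub>H\<^esub> h) $$ (0,m) * \<tau>0 g $$ (m,l)) =
            \<tau> h $$ (a,j) * \<tau>0 (inv\<^bsub>H\<^esub> h \<otimes>\<^bsub>H\<^esub> g) $$ (0,l)" by simp
      qed
      also have "\<dots> = (\<Sum>h\<in>carrier H. \<tau> (g \<otimes>\<^bsub>H\<^esub> h) $$ (a,j) * \<tau>0 (inv\<^bsub>H\<^esub> (g \<otimes>\<^bsub>H\<^esub> h) \<otimes>\<^bsub>H\<^esub> g) $$ (0,l))"
        using subgroup_sum_translate[OF subgroup_self g,
            of "\<lambda>h. \<tau> h $$ (a,j) * \<tau>0 (inv\<^bsub>H\<^esub> h \<otimes>\<^bsub>H\<^esub> g) $$ (0,l)"] by simp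
      also have "\<dots> = (\<Sum>h\<in>carrier H. (\<Sum>m<e. \<tau> g $$ (a,m) * \<tau> h $$ (m,j)) * \<tau>0 (inv\<^bsub>H\<^esub> h) $$ (0,l))"
      proof (rule sum.cong[OF refl])
        fix h assume h: "h \<in> carrier H"
        have "inv\<^bsub>H\<^esub> (g \<otimes>\<^bsub>H\<^esub> h) \<otimes>\<^bsub>H\<^esub> g = inv\<^bsub>H\<^esub> h" using g h by (simp add: inv_mult_group m_assoc)
        moreover have "\<tau> (g \<otimes>\<^bsub>H\<^esub> h) $$ (a,j) = (\<Sum>m<e. \<tau> g $$ (a,m) * \<tau> h $$ (m,j))"
          using is_repD(3)[OF \<tau> g h] is_repD(1)[OF \<tau> h] g1 a j
          by (auto simp: scalar_prod_def atLeast0LessThan intro!: sum.cong)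
        ultimately show "\<tau> (g \<otimes>\<^bsub>H\<^esub> h) $$ (a,j) * \<tau>0 (inv\<^bsub>H\<^esub> (g \<otimes>\<^bsub>H\<^esub> h) \<otimes>\<^bsub>H\<^esub> g) $$ (0,l) =
            (\<Sum>m<e. \<tau> g $$ (a,m) * \<tau> h $$ (m,j)) * \<tau>0 (inv\<^bsub>H\<^esub> h) $$ (0,l)" by simp
      qed
      also have "\<dots> = (\<Sum>m<e. \<tau> g $$ (a,m) * (\<Sum>h\<in>carrier H. \<tau> h $$ (m,j) * \<tau>0 (inv\<^bsub>H\<^esub> h) $$ (0,l)))"
        unfolding sum_distrib_right sum_distrib_left by (subst sum.swap) (simp add: mult.assoc)
      also have "\<dots> = (\<tau> g * Q) $$ (a,l)"
        using a l g1 by (auto simp: Q_def scalar_prod_def atLeast0LessThan intro!: sum.cong)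
      finally show "(Q * \<tau>0 g) $$ (a,l) = (\<tau> g * Q) $$ (a,l)" .
    qed (use g0 g1 in \<open>auto simp: Q_def\<close>)
  qed
  hence "Q = 0\<^sub>m e e0" using schur_equivalent[OF H irr \<tau>0 \<tau>] ne by blast
  hence "Q $$ (i,0) = 0" using i e0 by simp
  thus "rep_alg (carrier H) e \<tau> (\<lambda>h. \<tau>0 (inv\<^bsub>H\<^esub> h) $$ (0,0)) $$ (i,j) = 0\<^sub>m e e $$ (i,j)"
    using i j e0 by (simp add: Q_def rep_alg_def mult.commute)
qed (auto simp: rep_alg_def)

section \<open>The abstract correspondence\<close>

lemma restrict_eqD: "(\<lambda>x\<in>A. f x) = (\<lambda>x\<in>A. g x) \<Longrightarrow> x \<in> A \<Longrightarrow> f x = g x"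
  by (drule fun_cong[of _ _ x]) simp

definition delta :: "'t \<Rightarrow> 't \<Rightarrow> complex" where
  "delta t s = (if s = t then 1 else 0)"

text \<open>\<open>outer e v\<close> is the tensor of \<open>v\<close> with the first unit vector.\<close>

definition outer :: "nat \<Rightarrow> complex vec \<Rightarrow> complex mat" where
  "outer e v = mat (dim_vec v) e (\<lambda>(i,j). if j = 0 then v $ i else 0)"

lemma smult_mat_vec:
  fixes M :: "complex mat"
  assumes "M \<in> carrier_mat d e" "v \<in> carrier_vec e"
  shows "(c \<cdot>\<^sub>m M) *\<^sub>v v = c \<cdot>\<^sub>v (M *\<^sub>v v)"
  using assms by (intro eq_vecI) auto

lemma outer_carrier: "v \<in> carrier_vec d \<Longrightarrow> outer e v \<in> carrier_mat d e"
  by (auto simp: outer_def)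

lemma outer_add: "v \<in> carrier_vec d \<Longrightarrow> w \<in> carrier_vec d \<Longrightarrow> outer e (v + w) = outer e v + outer e w"
  by (intro eq_matI) (auto simp: outer_def)

lemma outer_smult: "v \<in> carrier_vec d \<Longrightarrow> outer e (c \<cdot>\<^sub>v v) = c \<cdot>\<^sub>m outer e v"
  by (intro eq_matI) (auto simp: outer_def)

lemma mult_outer:
  "M \<in> carrier_mat d d' \<Longrightarrow> v \<in> carrier_vec d' \<Longrightarrow> M * outer e v = outer e (M *\<^sub>v v)"
  by (intro eq_matI) (auto simp: outer_def scalar_prod_def)

lemma outer_unit_vec: "e > 0 \<Longrightarrow> v \<in> carrier_vec d \<Longrightarrow> outer e v *\<^sub>v unit_vec e 0 = v"
  by (intro eq_vecI) (auto simp: outer_def)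

text \<open>In the application \<open>'t\<close> is \<open>Y \<otimes> U\<close>, read as
  \<open>Hom(X, U)\<close>; \<open>S\<close> is the set of surjective maps, \<open>\<chi> T\<close>
  the character of the form pulled back along \<open>T\<close>, and \<open>act\<close> is
  composition with an isometry. The scalars \<open>\<epsilon>\<close> are values of the quadratic
  character. In \<open>fibre\<close> the point \<open>t'\<close> ranges over all of
  \<open>'t\<close>, so no point outside \<open>S\<close> shares a character with a point of
  \<open>S\<close>; together with \<open>act_inj\<close> this makes each such fibre a torsor under
  \<open>H\<close>.\<close>

locale theta_correspondence =
  fixes G :: "'g monoid" and H :: "'h monoid"
    and \<omega> :: "'g \<Rightarrow> 'h \<Rightarrow> ('t::finite \<Rightarrow> complex) \<Rightarrow> ('t \<Rightarrow> complex)"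
    and \<Theta> :: "('h \<Rightarrow> complex mat) set \<Rightarrow> 'g \<Rightarrow> complex mat"
    and N :: "'g set" and \<chi> :: "'t \<Rightarrow> 'g \<Rightarrow> complex" and S :: "'t set" and act :: "'h \<Rightarrow> 't \<Rightarrow> 't"
  assumes G: "group G" and H: "group H" and finG: "finite (carrier G)" and finH: "finite (carrier H)"
    and N: "subgroup N G" and decomposition: "is_theta_decomposition G H \<omega> \<Theta>"
    and char: "\<And>t. unitary_char G N (\<chi> t)"
    and \<omega>_N: "\<And>a f t. a \<in> N \<Longrightarrow> \<omega> a \<one>\<^bsub>H\<^esub> f t = \<chi> t a * f t"
    and \<omega>_H: "\<And>h t. h \<in> carrier H \<Longrightarrow> t \<in> S \<Longrightarrow>
        \<exists>\<epsilon>. \<epsilon> \<noteq> 0 \<and> \<omega> \<one>\<^bsub>G\<^esub> h (delta t) = (\<lambda>s. \<epsilon> * delta (act h t) s)"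
    and act_S: "\<And>h t. h \<in> carrier H \<Longrightarrow> t \<in> S \<Longrightarrow> act h t \<in> S"
    and act_inj: "\<And>h h' t. h \<in> carrier H \<Longrightarrow> h' \<in> carrier H \<Longrightarrow> t \<in> S \<Longrightarrow> act h t = act h' t \<Longrightarrow> h = h'"
    and act_one: "\<And>t. t \<in> S \<Longrightarrow> act \<one>\<^bsub>H\<^esub> t = t"
    and fibre: "\<And>t t'. t \<in> S \<Longrightarrow> (\<And>a. a \<in> N \<Longrightarrow> \<chi> t' a = \<chi> t a) \<Longrightarrow> \<exists>h\<in>carrier H. t' = act h t"
    and transitive: "\<And>t t'. t \<in> S \<Longrightarrow> t' \<in> S \<Longrightarrow>
        \<exists>g\<in>carrier G. \<exists>\<epsilon>. \<epsilon> \<noteq> 0 \<and> \<omega> g \<one>\<^bsub>H\<^esub> (delta t) = (\<lambda>s. \<epsilon> * delta t' s)"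
    and S_nonempty: "S \<noteq> {}"
begin

abbreviation "I \<equiv> Irr H"
abbreviation "dg c \<equiv> rep_degree G (\<Theta> c)"
abbreviation "\<tau> c \<equiv> class_rep c"
abbreviation "dh c \<equiv> rep_degree H (\<tau> c)"
abbreviation "E \<equiv> (\<Pi>\<^sub>E c\<in>I. carrier_mat (dg c) (dh c))"

lemma \<Theta>_rep: "c \<in> I \<Longrightarrow> is_rep G (dg c) (\<Theta> c)"
  using decomposition representation_iff[OF G] by (auto simp: is_theta_decomposition_def)

lemma \<tau>_irr: "c \<in> I \<Longrightarrow> irreducible_rep H (\<tau> c)"
  using Irr_memD(1)[OF H _ class_rep_in[OF H]] .

lemma \<tau>_rep: "c \<in> I \<Longrightarrow> is_rep H (dh c) (\<tau> c)"
  using Irr_memD(2)[OF H _ class_rep_in[OF H]] .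

lemma dh_pos: "c \<in> I \<Longrightarrow> dh c > 0"
  using irreducible_repD(1)[OF H \<tau>_irr \<tau>_rep] .

lemma \<tau>_transpose_carrier: "c \<in> I \<Longrightarrow> h \<in> carrier H \<Longrightarrow> transpose_mat (\<tau> c h) \<in> carrier_mat (dh c) (dh c)"
  using is_repD(1)[OF \<tau>_rep] by simp

section \<open>Transport of delta functions through the decomposition\<close>

definition \<Phi> :: "(('h \<Rightarrow> complex mat) set \<Rightarrow> complex mat) \<Rightarrow> 't \<Rightarrow> complex" where
  "\<Phi> = (SOME \<Phi>. bij_betw \<Phi> E UNIV \<and>
           (\<forall>m\<in>E. \<forall>m'\<in>E. \<Phi> (\<lambda>c\<in>I. m c + m' c) = (\<lambda>y. \<Phi> m y + \<Phi> m' y)) \<and>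
           (\<forall>a. \<forall>m\<in>E. \<Phi> (\<lambda>c\<in>I. a \<cdot>\<^sub>m m c) = (\<lambda>y. a * \<Phi> m y)) \<and>
           (\<forall>g\<in>carrier G. \<forall>h\<in>carrier H. \<forall>m\<in>E.
              \<Phi> (\<lambda>c\<in>I. \<Theta> c g * m c * transpose_mat (\<tau> c h)) = \<omega> g h (\<Phi> m)))"

lemma \<Phi>_properties:
  shows \<Phi>_bij: "bij_betw \<Phi> E UNIV"
    and \<Phi>_add: "\<And>m m'. m \<in> E \<Longrightarrow> m' \<in> E \<Longrightarrow> \<Phi> (\<lambda>c\<in>I. m c + m' c) = (\<lambda>y. \<Phi> m y + \<Phi> m' y)"
    and \<Phi>_smult: "\<And>a m. m \<in> E \<Longrightarrow> \<Phi> (\<lambda>c\<in>I. a \<cdot>\<^sub>m m c) = (\<lambda>y. a * \<Phi> m y)"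
    and \<Phi>_equivariant: "\<And>g h m. g \<in> carrier G \<Longrightarrow> h \<in> carrier H \<Longrightarrow> m \<in> E \<Longrightarrow>
        \<Phi> (\<lambda>c\<in>I. \<Theta> c g * m c * transpose_mat (\<tau> c h)) = \<omega> g h (\<Phi> m)"
proof -
  have "\<exists>\<Phi>. bij_betw \<Phi> E UNIV \<and>
           (\<forall>m\<in>E. \<forall>m'\<in>E. \<Phi> (\<lambda>c\<in>I. m c + m' c) = (\<lambda>y. \<Phi> m y + \<Phi> m' y)) \<and>
           (\<forall>a. \<forall>m\<in>E. \<Phi> (\<lambda>c\<in>I. a \<cdot>\<^sub>m m c) = (\<lambda>y. a * \<Phi> m y)) \<and>
           (\<forall>g\<in>carrier G. \<forall>h\<in>carrier H. \<forall>m\<in>E.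
              \<Phi> (\<lambda>c\<in>I. \<Theta> c g * m c * transpose_mat (\<tau> c h)) = \<omega> g h (\<Phi> m))"
    using decomposition by (simp add: is_theta_decomposition_def Let_def)
  from someI_ex[OF this, folded \<Phi>_def]
  show "bij_betw \<Phi> E UNIV"
    and "\<And>m m'. m \<in> E \<Longrightarrow> m' \<in> E \<Longrightarrow> \<Phi> (\<lambda>c\<in>I. m c + m' c) = (\<lambda>y. \<Phi> m y + \<Phi> m' y)"
    and "\<And>a m. m \<in> E \<Longrightarrow> \<Phi> (\<lambda>c\<in>I. a \<cdot>\<^sub>m m c) = (\<lambda>y. a * \<Phi> m y)"
    and "\<And>g h m. g \<in> carrier G \<Longrightarrow> h \<in> carrier H \<Longrightarrow> m \<in> E \<Longrightarrow>
        \<Phi> (\<lambda>c\<in>I. \<Theta> c g * m c * transpose_mat (\<tau> c h)) = \<omega> g h (\<Phi> m)"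
    by blast+
qed

lemma \<Phi>_cancel: "m \<in> E \<Longrightarrow> m' \<in> E \<Longrightarrow> \<Phi> m = \<Phi> m' \<Longrightarrow> m = m'"
  using \<Phi>_bij by (auto simp: bij_betw_def inj_on_def)

lemma \<Phi>_zero: "\<Phi> (\<lambda>c\<in>I. 0\<^sub>m (dg c) (dh c)) = (\<lambda>y. 0)"
proof -
  let ?z = "\<lambda>c\<in>I. 0\<^sub>m (dg c) (dh c) :: complex mat"
  have "?z \<in> E" by auto
  from \<Phi>_smult[OF this, of 0] have "\<Phi> (\<lambda>c\<in>I. 0 \<cdot>\<^sub>m ?z c) = (\<lambda>y. 0)" by simp
  moreover have "(\<lambda>c\<in>I. 0 \<cdot>\<^sub>m ?z c) = ?z" by (intro restrict_ext) auto
  ultimately show ?thesis by simp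
qed

text \<open>The component at \<open>c\<close> lies in \<open>\<Theta> c \<otimes> \<tau>\<close> and
  is used as a linear map into \<open>\<Theta> c\<close>. Its source carries the transposes of
  \<tau>, since \<open>H\<close> acts by right multiplication with them.\<close>

definition delta_mat :: "'t \<Rightarrow> ('h \<Rightarrow> complex mat) set \<Rightarrow> complex mat" where
  "delta_mat t = inv_into E \<Phi> (delta t)"

lemma delta_mat_E: "delta_mat t \<in> E"
  unfolding delta_mat_def using \<Phi>_bij by (intro inv_into_into) (auto simp: bij_betw_def)

lemma \<Phi>_delta_mat: "\<Phi> (delta_mat t) = delta t"
  unfolding delta_mat_def using \<Phi>_bij by (intro f_inv_into_f[of _ _ E]) (auto simp: bij_betw_def)

lemma delta_mat_carrier: "c \<in> I \<Longrightarrow> delta_mat t c \<in> carrier_mat (dg c) (dh c)"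
  using delta_mat_E[of t] by auto

lemma smult_delta_mat_E: "(\<lambda>c\<in>I. \<epsilon> \<cdot>\<^sub>m delta_mat t c) \<in> E"
  using delta_mat_carrier by auto

lemma \<Theta>_mult_E: "g \<in> carrier G \<Longrightarrow> m \<in> E \<Longrightarrow> (\<lambda>c\<in>I. \<Theta> c g * m c) \<in> E"
  using is_repD(1)[OF \<Theta>_rep] by (auto intro!: mult_carrier_mat)

lemma mult_\<tau>_E: "h \<in> carrier H \<Longrightarrow> m \<in> E \<Longrightarrow> (\<lambda>c\<in>I. m c * transpose_mat (\<tau> c h)) \<in> E"
  using \<tau>_transpose_carrier by (auto intro!: mult_carrier_mat)

lemma one_H: "\<one>\<^bsub>H\<^esub> \<in> carrier H" and one_G: "\<one>\<^bsub>G\<^esub> \<in> carrier G"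
  using H G by (auto simp: group.is_monoid monoid.one_closed)

lemma \<Phi>_G: "g \<in> carrier G \<Longrightarrow> m \<in> E \<Longrightarrow> \<Phi> (\<lambda>c\<in>I. \<Theta> c g * m c) = \<omega> g \<one>\<^bsub>H\<^esub> (\<Phi> m)"
proof -
  assume g: "g \<in> carrier G" and m: "m \<in> E"
  have "(\<lambda>c\<in>I. \<Theta> c g * m c * transpose_mat (\<tau> c \<one>\<^bsub>H\<^esub>)) = (\<lambda>c\<in>I. \<Theta> c g * m c)"
  proof (rule restrict_ext)
    fix c assume c: "c \<in> I"
    have "\<Theta> c g * m c \<in> carrier_mat (dg c) (dh c)" using \<Theta>_mult_E[OF g m] c by auto
    thus "\<Theta> c g * m c * transpose_mat (\<tau> c \<one>\<^bsub>H\<^esub>) = \<Theta> c g * m c" using is_repD(2)[OF \<tau>_rep[OF c]] right_mult_one_mat by simp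
  qed
  thus ?thesis using \<Phi>_equivariant[OF g one_H m] by simp
qed

lemma \<Phi>_H: "h \<in> carrier H \<Longrightarrow> m \<in> E \<Longrightarrow> \<Phi> (\<lambda>c\<in>I. m c * transpose_mat (\<tau> c h)) = \<omega> \<one>\<^bsub>G\<^esub> h (\<Phi> m)"
proof -
  assume h: "h \<in> carrier H" and m: "m \<in> E"
  have "(\<lambda>c\<in>I. \<Theta> c \<one>\<^bsub>G\<^esub> * m c * transpose_mat (\<tau> c h)) = (\<lambda>c\<in>I. m c * transpose_mat (\<tau> c h))"
  proof (rule restrict_ext)
    fix c assume c: "c \<in> I"
    have "m c \<in> carrier_mat (dg c) (dh c)" using m c by auto
    thus "\<Theta> c \<one>\<^bsub>G\<^esub> * m c * transpose_mat (\<tau> c h) = m c * transpose_mat (\<tau> c h)"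
      using is_repD(2)[OF \<Theta>_rep[OF c]] by simp
  qed
  thus ?thesis using \<Phi>_equivariant[OF one_G h m] by simp
qed

text \<open>One \<open>g\<close> and one scalar serve all \<open>c\<close>, because the identity is
  established in the space of functions before components are taken.\<close>

lemma delta_mat_transitive:
  assumes t: "t \<in> S" "t' \<in> S"
  obtains g \<epsilon> where "g \<in> carrier G" "\<epsilon> \<noteq> 0" "\<And>c. c \<in> I \<Longrightarrow> \<Theta> c g * delta_mat t c = \<epsilon> \<cdot>\<^sub>m delta_mat t' c"
proof -
  obtain g \<epsilon> where g: "g \<in> carrier G" "\<epsilon> \<noteq> 0" "\<omega> g \<one>\<^bsub>H\<^esub> (delta t) = (\<lambda>s. \<epsilon> * delta t' s)"
    using transitive[OF t] by blast
  have "\<Phi> (\<lambda>c\<in>I. \<Theta> c g * delta_mat t c) = \<Phi> (\<lambda>c\<in>I. \<epsilon> \<cdot>\<^sub>m delta_mat t' c)"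
    using \<Phi>_G[OF g(1) delta_mat_E] \<Phi>_smult[OF delta_mat_E] g(3) by (simp add: \<Phi>_delta_mat)
  hence "(\<lambda>c\<in>I. \<Theta> c g * delta_mat t c) = (\<lambda>c\<in>I. \<epsilon> \<cdot>\<^sub>m delta_mat t' c)"
    by (rule \<Phi>_cancel[OF \<Theta>_mult_E[OF g(1) delta_mat_E] smult_delta_mat_E])
  hence "\<Theta> c g * delta_mat t c = \<epsilon> \<cdot>\<^sub>m delta_mat t' c" if "c \<in> I" for c using that by (rule restrict_eqD)
  with g that show thesis by blast
qed

lemma delta_mat_H:
  assumes t: "t \<in> S" and h: "h \<in> carrier H"
  obtains \<epsilon> where "\<epsilon> \<noteq> 0" "\<And>c. c \<in> I \<Longrightarrow> delta_mat t c * transpose_mat (\<tau> c h) = \<epsilon> \<cdot>\<^sub>m delta_mat (act h t) c"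
    "\<omega> \<one>\<^bsub>G\<^esub> h (delta t) = (\<lambda>s. \<epsilon> * delta (act h t) s)"
proof -
  obtain \<epsilon> where \<epsilon>: "\<epsilon> \<noteq> 0" "\<omega> \<one>\<^bsub>G\<^esub> h (delta t) = (\<lambda>s. \<epsilon> * delta (act h t) s)"
    using \<omega>_H[OF h t] by blast
  have "\<Phi> (\<lambda>c\<in>I. delta_mat t c * transpose_mat (\<tau> c h)) = \<Phi> (\<lambda>c\<in>I. \<epsilon> \<cdot>\<^sub>m delta_mat (act h t) c)"
    using \<Phi>_H[OF h delta_mat_E] \<Phi>_smult[OF delta_mat_E] \<epsilon>(2) by (simp add: \<Phi>_delta_mat)
  hence "(\<lambda>c\<in>I. delta_mat t c * transpose_mat (\<tau> c h)) = (\<lambda>c\<in>I. \<epsilon> \<cdot>\<^sub>m delta_mat (act h t) c)"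
    by (rule \<Phi>_cancel[OF mult_\<tau>_E[OF h delta_mat_E] smult_delta_mat_E])
  hence "delta_mat t c * transpose_mat (\<tau> c h) = \<epsilon> \<cdot>\<^sub>m delta_mat (act h t) c" if "c \<in> I" for c using that by (rule restrict_eqD)
  with \<epsilon> that show thesis by blast
qed

text \<open>On the delta function of \<open>t\<close> the action of \<open>h\<close> agrees, up to a scalar, with that of some \<open>g\<close>,
  which does not depend on \<open>c\<close>.  Transported through \<open>\<Phi>\<close> this makes each component of that delta
  function intertwine the dual of \<open>\<tau> c\<close> with a projective action of these \<open>g\<close> on \<open>\<Theta> c\<close>.\<close>

lemma delta_mat_swap:
  assumes t: "t \<in> S" and h: "h \<in> carrier H"
  obtains g \<epsilon> where "g \<in> carrier G" "\<epsilon> \<noteq> 0"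
    "\<And>c v. c \<in> I \<Longrightarrow> v \<in> carrier_vec (dh c) \<Longrightarrow>
       \<Theta> c g *\<^sub>v (delta_mat t c *\<^sub>v v) = \<epsilon> \<cdot>\<^sub>v (delta_mat t c *\<^sub>v (transpose_mat (\<tau> c h) *\<^sub>v v))"
proof -
  obtain \<epsilon>1 where 1: "\<epsilon>1 \<noteq> 0" "\<And>c. c \<in> I \<Longrightarrow> delta_mat t c * transpose_mat (\<tau> c h) = \<epsilon>1 \<cdot>\<^sub>m delta_mat (act h t) c"
    using delta_mat_H[OF t h] by metis
  obtain g \<epsilon>2 where 2: "g \<in> carrier G" "\<epsilon>2 \<noteq> 0" "\<And>c. c \<in> I \<Longrightarrow> \<Theta> c g * delta_mat t c = \<epsilon>2 \<cdot>\<^sub>m delta_mat (act h t) c"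
    using delta_mat_transitive[OF t act_S[OF h t]] by metis
  have "\<Theta> c g *\<^sub>v (delta_mat t c *\<^sub>v v) = (\<epsilon>2 / \<epsilon>1) \<cdot>\<^sub>v (delta_mat t c *\<^sub>v (transpose_mat (\<tau> c h) *\<^sub>v v))"
    if c: "c \<in> I" and v: "v \<in> carrier_vec (dh c)" for c v
  proof -
    note cc = delta_mat_carrier[OF c] is_repD(1)[OF \<Theta>_rep[OF c] 2(1)] \<tau>_transpose_carrier[OF c h]
    have "\<Theta> c g *\<^sub>v (delta_mat t c *\<^sub>v v) = (\<Theta> c g * delta_mat t c) *\<^sub>v v"
      by (rule assoc_mult_mat_vec[OF cc(2,1) v, symmetric])
    also have "\<dots> = \<epsilon>2 \<cdot>\<^sub>v (delta_mat (act h t) c *\<^sub>v v)"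
      unfolding 2(3)[OF c] using delta_mat_carrier[OF c, of "act h t"] v by (intro eq_vecI) auto
    finally have a: "\<Theta> c g *\<^sub>v (delta_mat t c *\<^sub>v v) = \<epsilon>2 \<cdot>\<^sub>v (delta_mat (act h t) c *\<^sub>v v)" .
    have "delta_mat t c *\<^sub>v (transpose_mat (\<tau> c h) *\<^sub>v v) = (delta_mat t c * transpose_mat (\<tau> c h)) *\<^sub>v v"
      by (rule assoc_mult_mat_vec[OF cc(1,3) v, symmetric])
    also have "\<dots> = \<epsilon>1 \<cdot>\<^sub>v (delta_mat (act h t) c *\<^sub>v v)"
      unfolding 1(2)[OF c] using delta_mat_carrier[OF c, of "act h t"] v by (intro eq_vecI) auto
    finally show ?thesis unfolding a using 1(1) by (simp add: smult_smult_assoc)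
  qed
  moreover have "\<epsilon>2 / \<epsilon>1 \<noteq> 0" using 1 2 by simp
  ultimately show thesis using that[OF 2(1)] by blast
qed

lemma N_carrier: "a \<in> N \<Longrightarrow> a \<in> carrier G"
  using N subgroup.subset by blast

lemma finN: "finite N"
  using finG N_carrier by (meson finite_subset subsetI)

text \<open>Extends equivariance under \<open>H\<close> linearly to the group algebra, one summand
  at a time.\<close>

lemma \<Phi>_rep_alg:
  assumes m: "m \<in> E" and K: "finite K" "K \<subseteq> carrier H"
  shows "\<Phi> (\<lambda>c\<in>I. m c * transpose_mat (rep_alg K (dh c) (\<tau> c) a)) = (\<lambda>y. \<Sum>h\<in>K. a h * \<omega> \<one>\<^bsub>G\<^esub> h (\<Phi> m) y)"
  using K
proof (induction K)
  case empty
  have "(\<lambda>c\<in>I. m c * transpose_mat (rep_alg {} (dh c) (\<tau> c) a)) = (\<lambda>c\<in>I. 0\<^sub>m (dg c) (dh c))"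
    using m by (intro restrict_ext) (auto simp: rep_alg_empty intro!: right_mult_zero_mat)
  thus ?case by (simp only: \<Phi>_zero sum.empty)
next
  case (insert h K)
  have h: "h \<in> carrier H" using insert.prems by simp
  define p where "p = (\<lambda>c\<in>I. m c * transpose_mat (\<tau> c h))"
  define r where "r = (\<lambda>c\<in>I. m c * transpose_mat (rep_alg K (dh c) (\<tau> c) a))"
  have pE: "p \<in> E" unfolding p_def by (rule mult_\<tau>_E[OF h m])
  have apE: "(\<lambda>c\<in>I. a h \<cdot>\<^sub>m p c) \<in> E" using PiE_mem[OF pE] by (auto intro!: smult_carrier_mat)
  have rE: "r \<in> E" unfolding r_def using m by (auto intro!: mult_carrier_mat)
  have eq: "(\<lambda>c\<in>I. m c * transpose_mat (rep_alg (insert h K) (dh c) (\<tau> c) a)) = (\<lambda>c\<in>I. (\<lambda>c\<in>I. a h \<cdot>\<^sub>m p c) c + r c)"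
  proof (rule restrict_ext)
    fix c assume c: "c \<in> I"
    have mc: "m c \<in> carrier_mat (dg c) (dh c)" using m c by auto
    have \<tau>c: "\<tau> c h \<in> carrier_mat (dh c) (dh c)" using is_repD(1)[OF \<tau>_rep[OF c] h] .
    let ?R = "rep_alg K (dh c) (\<tau> c) a"
    have "transpose_mat (rep_alg (insert h K) (dh c) (\<tau> c) a) = a h \<cdot>\<^sub>m transpose_mat (\<tau> c h) + transpose_mat ?R"
      unfolding rep_alg_insert[of K h "\<tau> c" "dh c" a, OF insert.hyps \<tau>c]
      using \<tau>c by (intro eq_matI) (auto simp: rep_alg_def)
    moreover have "m c * (a h \<cdot>\<^sub>m transpose_mat (\<tau> c h) + transpose_mat ?R) =
        m c * (a h \<cdot>\<^sub>m transpose_mat (\<tau> c h)) + m c * transpose_mat ?R"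
      using mc \<tau>c by (intro mult_add_distrib_mat) auto
    moreover have "m c * (a h \<cdot>\<^sub>m transpose_mat (\<tau> c h)) = a h \<cdot>\<^sub>m (m c * transpose_mat (\<tau> c h))"
      using mc \<tau>c by (intro mult_smult_distrib) auto
    ultimately show "m c * transpose_mat (rep_alg (insert h K) (dh c) (\<tau> c) a) = (\<lambda>c\<in>I. a h \<cdot>\<^sub>m p c) c + r c"
      using c by (simp add: p_def r_def)
  qed
  have "\<Phi> (\<lambda>c\<in>I. (\<lambda>c\<in>I. a h \<cdot>\<^sub>m p c) c + r c) = (\<lambda>y. a h * \<omega> \<one>\<^bsub>G\<^esub> h (\<Phi> m) y + (\<Sum>h\<in>K. a h * \<omega> \<one>\<^bsub>G\<^esub> h (\<Phi> m) y))"
    using \<Phi>_add[OF apE rE] \<Phi>_smult[OF pE] \<Phi>_H[OF h m] insert.IH insert.prems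
    by (simp add: p_def[symmetric] r_def[symmetric])
  thus ?case unfolding eq by (simp only: sum.insert[OF insert.hyps])
qed

text \<open>The group algebra element with coefficients \<open>a\<close> kills all components other than \<open>c0\<close>, but
  not the delta function of \<open>t\<close>, whose translates under \<open>H\<close> are linearly independent.\<close>

lemma delta_mat_nonzero:
  assumes t: "t \<in> S" and c0: "c0 \<in> I"
  shows "delta_mat t c0 \<noteq> 0\<^sub>m (dg c0) (dh c0)"
proof
  interpret H: group H by (rule H)
  assume z: "delta_mat t c0 = 0\<^sub>m (dg c0) (dh c0)"
  \<comment> \<open>A diagonal matrix coefficient of the representation at \<open>c0\<close>, with
    inverse argument as in Schur orthogonality; its value at the unit is 1.\<close>
  define a where "a h = \<tau> c0 (inv\<^bsub>H\<^esub> h) $$ (0,0)" for h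
  have "(\<lambda>c\<in>I. delta_mat t c * transpose_mat (rep_alg (carrier H) (dh c) (\<tau> c) a)) = (\<lambda>c\<in>I. 0\<^sub>m (dg c) (dh c))"
  proof (rule restrict_ext)
    fix c assume c: "c \<in> I"
    show "delta_mat t c * transpose_mat (rep_alg (carrier H) (dh c) (\<tau> c) a) = 0\<^sub>m (dg c) (dh c)"
    proof (cases "c = c0")
      case True
      thus ?thesis using z by (auto intro!: left_mult_zero_mat)
    next
      case False
      hence "\<not> equivalent_rep H (\<tau> c0) (\<tau> c)"
        using Irr_equivalent_eq[OF H c0 c class_rep_in[OF H c0] class_rep_in[OF H c]] by blast
      from rep_alg_matrix_coeff_zero[OF H finH \<tau>_irr[OF c0] \<tau>_irr[OF c] this \<tau>_rep[OF c0] \<tau>_rep[OF c]]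
      have "rep_alg (carrier H) (dh c) (\<tau> c) a = 0\<^sub>m (dh c) (dh c)" by (simp add: a_def[abs_def])
      hence "transpose_mat (rep_alg (carrier H) (dh c) (\<tau> c) a) = 0\<^sub>m (dh c) (dh c)"
        by (metis transpose_mat_def zero_transpose_mat)
      thus ?thesis using delta_mat_carrier[OF c, of t] by simp
    qed
  qed
  hence "\<Phi> (\<lambda>c\<in>I. delta_mat t c * transpose_mat (rep_alg (carrier H) (dh c) (\<tau> c) a)) = (\<lambda>y. 0)"
    by (simp add: \<Phi>_zero)
  hence 0: "(\<Sum>h\<in>carrier H. a h * \<omega> \<one>\<^bsub>G\<^esub> h (delta t) t) = 0"
    using \<Phi>_rep_alg[OF delta_mat_E finH order_refl, of t a] by (simp add: \<Phi>_delta_mat fun_eq_iff)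
  obtain \<epsilon> where \<epsilon>: "\<epsilon> \<noteq> 0" "\<omega> \<one>\<^bsub>G\<^esub> \<one>\<^bsub>H\<^esub> (delta t) = (\<lambda>s. \<epsilon> * delta (act \<one>\<^bsub>H\<^esub> t) s)"
    using delta_mat_H[OF t one_H] by metis
  \<comment> \<open>Evaluation at \<open>t\<close> isolates the unit of \<open>H\<close>: any other
    \<open>h\<close> moves the delta function to a point different from \<open>t\<close>.\<close>
  have "a h * \<omega> \<one>\<^bsub>G\<^esub> h (delta t) t = 0" if h: "h \<in> carrier H - {\<one>\<^bsub>H\<^esub>}" for h
  proof -
    have "act h t \<noteq> t" using act_inj[OF _ one_H t, of h] act_one[OF t] h by auto
    thus ?thesis using \<omega>_H[of h t] h t by (auto simp: delta_def)
  qed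
  hence "(\<Sum>h\<in>carrier H. a h * \<omega> \<one>\<^bsub>G\<^esub> h (delta t) t) = a \<one>\<^bsub>H\<^esub> * \<omega> \<one>\<^bsub>G\<^esub> \<one>\<^bsub>H\<^esub> (delta t) t"
    using finH one_H by (simp add: sum.remove[of _ "\<one>\<^bsub>H\<^esub>"] sum.neutral)
  also have "\<dots> = \<epsilon>"
    using \<epsilon>(2) act_one[OF t] is_repD(2)[OF \<tau>_rep[OF c0]] dh_pos[OF c0] by (simp add: a_def delta_def)
  finally show False using 0 \<epsilon>(1) by simp
qed

text \<open>Dually, the transpose is surjective: replacing the action of \<open>h\<close> by that of
  a group element \<open>g\<close> makes its image invariant under \<open>\<tau> c\<close>, and this
  image is non-zero because the matrix is. Irreducibility of \<open>\<tau> c\<close> then leaves the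
  full space.\<close>

lemma delta_mat_inj:
  assumes t: "t \<in> S" and c: "c \<in> I" and v: "v \<in> carrier_vec (dh c)" and 0: "delta_mat t c *\<^sub>v v = 0\<^sub>v (dg c)"
  shows "v = 0\<^sub>v (dh c)"
proof -
  let ?m = "delta_mat t c"
  note m = delta_mat_carrier[OF c, of t]
  have mT: "transpose_mat ?m \<in> carrier_mat (dh c) (dg c)" using m by simp
  define K where "K = (\<lambda>w. transpose_mat ?m *\<^sub>v w) ` carrier_vec (dg c)"
  have sub: "vec_subspace (dh c) K" unfolding K_def by (rule vec_subspace_image[OF mT])
  have inv: "invariant H (\<tau> c) K" unfolding invariant_def
  proof (intro ballI)
    fix h x assume h: "h \<in> carrier H" and x: "x \<in> K"
    obtain w where w: "w \<in> carrier_vec (dg c)" "x = transpose_mat ?m *\<^sub>v w" using x by (auto simp: K_def)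
    obtain \<epsilon>1 where 1: "\<epsilon>1 \<noteq> 0" "?m * transpose_mat (\<tau> c h) = \<epsilon>1 \<cdot>\<^sub>m delta_mat (act h t) c"
      using delta_mat_H[OF t h] c by metis
    obtain g \<epsilon>2 where 2: "g \<in> carrier G" "\<epsilon>2 \<noteq> 0" "\<Theta> c g * ?m = \<epsilon>2 \<cdot>\<^sub>m delta_mat (act h t) c"
      using delta_mat_transitive[OF t act_S[OF h t]] c by metis
    have \<tau>c: "\<tau> c h \<in> carrier_mat (dh c) (dh c)" using is_repD(1)[OF \<tau>_rep[OF c] h] .
    have \<Theta>c: "\<Theta> c g \<in> carrier_mat (dg c) (dg c)" using is_repD(1)[OF \<Theta>_rep[OF c] 2(1)] .
    have "?m * transpose_mat (\<tau> c h) = (\<epsilon>1 / \<epsilon>2) \<cdot>\<^sub>m (\<Theta> c g * ?m)"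
      unfolding 1(2) 2(3) using 2(2) by (intro eq_matI) auto
    hence "transpose_mat (?m * transpose_mat (\<tau> c h)) = transpose_mat ((\<epsilon>1 / \<epsilon>2) \<cdot>\<^sub>m (\<Theta> c g * ?m))" by simp
    moreover have "transpose_mat (?m * transpose_mat (\<tau> c h)) = \<tau> c h * transpose_mat ?m"
      using m \<tau>c by (subst transpose_mult) auto
    moreover have "transpose_mat ((\<epsilon>1 / \<epsilon>2) \<cdot>\<^sub>m (\<Theta> c g * ?m)) = (\<epsilon>1 / \<epsilon>2) \<cdot>\<^sub>m (transpose_mat ?m * transpose_mat (\<Theta> c g))"
      using m \<Theta>c by (subst transpose_mult[symmetric]) (auto intro!: eq_matI)
    ultimately have eq: "\<tau> c h * transpose_mat ?m = (\<epsilon>1 / \<epsilon>2) \<cdot>\<^sub>m (transpose_mat ?m * transpose_mat (\<Theta> c g))" by simp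
    have "\<tau> c h *\<^sub>v x = (\<tau> c h * transpose_mat ?m) *\<^sub>v w" unfolding w(2)
      by (rule assoc_mult_mat_vec[OF \<tau>c mT w(1), symmetric])
    also have "\<dots> = (\<epsilon>1 / \<epsilon>2) \<cdot>\<^sub>v ((transpose_mat ?m * transpose_mat (\<Theta> c g)) *\<^sub>v w)"
      unfolding eq using mT \<Theta>c w by (intro smult_mat_vec) auto
    also have "(transpose_mat ?m * transpose_mat (\<Theta> c g)) *\<^sub>v w = transpose_mat ?m *\<^sub>v (transpose_mat (\<Theta> c g) *\<^sub>v w)"
      using mT \<Theta>c w by (intro assoc_mult_mat_vec) auto
    also have "(\<epsilon>1 / \<epsilon>2) \<cdot>\<^sub>v \<dots> \<in> K"
    proof -
      have "transpose_mat (\<Theta> c g) *\<^sub>v w \<in> carrier_vec (dg c)" using \<Theta>c w by (metis mult_mat_vec_carrier transpose_carrier_mat)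
      thus ?thesis using sub unfolding vec_subspace_def K_def by blast
    qed
    finally show "\<tau> c h *\<^sub>v x \<in> K" .
  qed
  have "K \<noteq> {0\<^sub>v (dh c)}"
  proof
    assume K0: "K = {0\<^sub>v (dh c)}"
    have "transpose_mat ?m = 0\<^sub>m (dh c) (dg c)"
    proof (rule eq_mat_vecI[OF mT])
      fix w :: "complex vec" assume w: "w \<in> carrier_vec (dg c)"
      hence "transpose_mat ?m *\<^sub>v w = 0\<^sub>v (dh c)" using K0 by (auto simp: K_def)
      also have "\<dots> = 0\<^sub>m (dh c) (dg c) *\<^sub>v w" using w by (intro eq_vecI) auto
      finally show "transpose_mat ?m *\<^sub>v w = 0\<^sub>m (dh c) (dg c) *\<^sub>v w" .
    qed auto
    hence "?m = 0\<^sub>m (dg c) (dh c)" by (metis transpose_transpose zero_transpose_mat)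
    with delta_mat_nonzero[OF t c] show False ..
  qed
  hence K: "K = carrier_vec (dh c)"
    using irreducible_repD(2)[OF H \<tau>_irr[OF c] \<tau>_rep[OF c] sub inv] by blast
  show ?thesis
  proof (rule eq_vecI)
    fix i assume i: "i < dim_vec (0\<^sub>v (dh c))"
    have "unit_vec (dh c) i \<in> K" using K by simp
    then obtain w where w: "w \<in> carrier_vec (dg c)" "unit_vec (dh c) i = transpose_mat ?m *\<^sub>v w"
      by (auto simp: K_def)
    have "(transpose_mat ?m *\<^sub>v w) \<bullet> v = w \<bullet> (?m *\<^sub>v v)" by (rule transpose_vec_mult_scalar[OF m v w(1)])
    also have "\<dots> = 0" using 0 w by simp
    finally show "v $ i = 0\<^sub>v (dh c) $ i" unfolding w(2)[symmetric] using i v by simp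
  qed (use v in simp)
qed

section \<open>Weight spaces of \<open>\<Theta> c\<close> at the points of \<open>S\<close>\<close>

abbreviation "weights c t \<equiv> weight_space N (dg c) (\<Theta> c) (\<chi> t)"

lemma N_delta_mat:
  assumes a: "a \<in> N" and c: "c \<in> I"
  shows "\<Theta> c a * delta_mat t c = \<chi> t a \<cdot>\<^sub>m delta_mat t c"
proof -
  have "\<omega> a \<one>\<^bsub>H\<^esub> (delta t) = (\<lambda>y. \<chi> t a * delta t y)"
    using \<omega>_N[OF a] by (auto simp: delta_def fun_eq_iff)
  hence "\<Phi> (\<lambda>c\<in>I. \<Theta> c a * delta_mat t c) = \<Phi> (\<lambda>c\<in>I. \<chi> t a \<cdot>\<^sub>m delta_mat t c)"
    using \<Phi>_G[OF N_carrier[OF a] delta_mat_E] \<Phi>_smult[OF delta_mat_E] by (simp add: \<Phi>_delta_mat)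
  hence "(\<lambda>c\<in>I. \<Theta> c a * delta_mat t c) = (\<lambda>c\<in>I. \<chi> t a \<cdot>\<^sub>m delta_mat t c)"
    by (rule \<Phi>_cancel[OF \<Theta>_mult_E[OF N_carrier[OF a] delta_mat_E] smult_delta_mat_E])
  thus ?thesis using c by (rule restrict_eqD)
qed

text \<open>Embeds \<open>\<Theta> c\<close> equivariantly under \<open>G\<close> into the space of
  functions, as the tensors with the first unit vector of \<tau>. Vectors of
  \<open>\<Theta> c\<close> thereby acquire a support.\<close>

definition vec_fun :: "('h \<Rightarrow> complex mat) set \<Rightarrow> complex vec \<Rightarrow> 't \<Rightarrow> complex" where
  "vec_fun c v = \<Phi> (\<lambda>c'\<in>I. if c' = c then outer (dh c) v else 0\<^sub>m (dg c') (dh c'))"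

lemma vec_fun_E:
  "v \<in> carrier_vec (dg c) \<Longrightarrow> (\<lambda>c'\<in>I. if c' = c then outer (dh c) v else 0\<^sub>m (dg c') (dh c')) \<in> E"
  by (auto simp: outer_carrier)

lemma vec_fun_add:
  assumes "v \<in> carrier_vec (dg c)" "w \<in> carrier_vec (dg c)"
  shows "vec_fun c (v + w) = (\<lambda>y. vec_fun c v y + vec_fun c w y)"
  unfolding vec_fun_def \<Phi>_add[OF vec_fun_E[OF assms(1)] vec_fun_E[OF assms(2)], symmetric]
  by (rule arg_cong[of _ _ \<Phi>], rule restrict_ext) (use assms in \<open>auto simp: outer_add\<close>)

lemma vec_fun_smult:
  assumes "v \<in> carrier_vec (dg c)"
  shows "vec_fun c (a \<cdot>\<^sub>v v) = (\<lambda>y. a * vec_fun c v y)"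
  unfolding vec_fun_def \<Phi>_smult[OF vec_fun_E[OF assms(1)], symmetric]
  by (rule arg_cong[of _ _ \<Phi>], rule restrict_ext) (use assms in \<open>auto simp: outer_smult\<close>)

lemma vec_fun_equivariant:
  assumes c: "c \<in> I" and v: "v \<in> carrier_vec (dg c)" and g: "g \<in> carrier G"
  shows "vec_fun c (\<Theta> c g *\<^sub>v v) = \<omega> g \<one>\<^bsub>H\<^esub> (vec_fun c v)"
  unfolding vec_fun_def \<Phi>_G[OF g vec_fun_E[OF v], symmetric]
proof (rule arg_cong[of _ _ \<Phi>], rule restrict_ext)
  fix c' assume c': "c' \<in> I"
  show "(if c' = c then outer (dh c) (\<Theta> c g *\<^sub>v v) else 0\<^sub>m (dg c') (dh c')) =
    \<Theta> c' g * (\<lambda>c'\<in>I. if c' = c then outer (dh c) v else 0\<^sub>m (dg c') (dh c')) c'"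
    using c' is_repD(1)[OF \<Theta>_rep[OF c'] g] v by (auto simp: mult_outer)
qed

lemma vec_fun_eq_zero:
  assumes c: "c \<in> I" and v: "v \<in> carrier_vec (dg c)" and 0: "vec_fun c v = (\<lambda>y. 0)"
  shows "v = 0\<^sub>v (dg c)"
proof -
  have z: "(\<lambda>c\<in>I. 0\<^sub>m (dg c) (dh c)) \<in> E" by auto
  have "(\<lambda>c'\<in>I. if c' = c then outer (dh c) v else 0\<^sub>m (dg c') (dh c')) = (\<lambda>c\<in>I. 0\<^sub>m (dg c) (dh c))"
    by (rule \<Phi>_cancel[OF vec_fun_E[OF v] z trans[OF 0[unfolded vec_fun_def] \<Phi>_zero[symmetric]]])
  hence "outer (dh c) v = 0\<^sub>m (dg c) (dh c)" using restrict_eqD[OF _ c] by fastforce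
  hence "v = 0\<^sub>m (dg c) (dh c) *\<^sub>v unit_vec (dh c) 0" using outer_unit_vec[OF dh_pos[OF c] v] by simp
  also have "\<dots> = 0\<^sub>v (dg c)" by (intro eq_vecI) auto
  finally show ?thesis .
qed

text \<open>The subgroup \<open>N\<close> multiplies the function pointwise by
  \<open>\<chi> s\<close> at \<open>s\<close>, but globally by \<open>\<xi>\<close>; where the
  function is non-zero the two factors agree.\<close>

lemma weight_supported:
  assumes c: "c \<in> I" and v: "v \<in> weight_space N (dg c) (\<Theta> c) \<xi>" and s: "vec_fun c v s \<noteq> 0" and a: "a \<in> N"
  shows "\<chi> s a = \<xi> a"
proof -
  have vc: "v \<in> carrier_vec (dg c)" "\<Theta> c a *\<^sub>v v = \<xi> a \<cdot>\<^sub>v v" using v a by (auto simp: weight_space_def)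
  have "\<chi> s a * vec_fun c v s = \<xi> a * vec_fun c v s"
    using vec_fun_equivariant[OF c vc(1) N_carrier[OF a]] \<omega>_N[OF a] vec_fun_smult[OF vc(1)] vc(2) by metis
  thus ?thesis using s by simp
qed

text \<open>The function of a weight vector is supported on points with the character of
  \<open>t\<close>, which by \<open>fibre\<close> form the \<open>H\<close>-orbit of
  \<open>t\<close>. It is therefore a group algebra element applied to the delta function of
  \<open>t\<close>; comparing components at \<open>c\<close> and taking the first column exhibits
  the vector in the range.\<close>

lemma delta_mat_range:
  assumes t: "t \<in> S" and c: "c \<in> I"
  shows "(\<lambda>v. delta_mat t c *\<^sub>v v) ` carrier_vec (dh c) = weights c t"
proof
  note m = delta_mat_carrier[OF c, of t]
  show "(\<lambda>v. delta_mat t c *\<^sub>v v) ` carrier_vec (dh c) \<subseteq> weights c t"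
  proof (rule image_subsetI)
    fix v :: "complex vec" assume v: "v \<in> carrier_vec (dh c)"
    have "\<Theta> c a *\<^sub>v (delta_mat t c *\<^sub>v v) = \<chi> t a \<cdot>\<^sub>v (delta_mat t c *\<^sub>v v)" if a: "a \<in> N" for a
      using assoc_mult_mat_vec[OF is_repD(1)[OF \<Theta>_rep[OF c] N_carrier[OF a]] m v, symmetric]
        smult_mat_vec[OF m v] N_delta_mat[OF a c] by simp
    thus "delta_mat t c *\<^sub>v v \<in> weights c t" using m v by (simp add: weight_space_def)
  qed
  show "weights c t \<subseteq> (\<lambda>v. delta_mat t c *\<^sub>v v) ` carrier_vec (dh c)"
  proof
    fix v assume v: "v \<in> weights c t"
    have vc: "v \<in> carrier_vec (dg c)" using v by (simp add: weight_space_def)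
    define F where "F = vec_fun c v"
    have "\<forall>h\<in>carrier H. \<exists>\<epsilon>. \<epsilon> \<noteq> 0 \<and> \<omega> \<one>\<^bsub>G\<^esub> h (delta t) = (\<lambda>s. \<epsilon> * delta (act h t) s)"
      using \<omega>_H[OF _ t] by blast
    then obtain \<epsilon> where \<epsilon>: "\<And>h. h \<in> carrier H \<Longrightarrow> \<epsilon> h \<noteq> 0"
      "\<And>h. h \<in> carrier H \<Longrightarrow> \<omega> \<one>\<^bsub>G\<^esub> h (delta t) = (\<lambda>s. \<epsilon> h * delta (act h t) s)" by metis
    \<comment> \<open>The points \<open>act h t\<close> are distinct for distinct \<open>h\<close>,
      so the coefficient of each translate is the value of \<open>F\<close> there, divided by the
      scalar of that translate.\<close>
    define a where "a h = F (act h t) / \<epsilon> h" for h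
    have "F s = (\<Sum>h\<in>carrier H. a h * \<omega> \<one>\<^bsub>G\<^esub> h (delta t) s)" for s
    proof -
      have "(\<Sum>h\<in>carrier H. a h * \<omega> \<one>\<^bsub>G\<^esub> h (delta t) s) = (\<Sum>h\<in>carrier H. F (act h t) * delta (act h t) s)"
        using \<epsilon> by (intro sum.cong) (auto simp: a_def)
      also have "\<dots> = F s"
      proof (cases "F s = 0")
        case True
        thus ?thesis by (intro trans[OF sum.neutral]) (auto simp: delta_def)
      next
        case False
        then obtain h where h: "h \<in> carrier H" "s = act h t"
          using fibre[OF t, of s] weight_supported[OF c v] by (metis F_def)
        have "(\<Sum>h'\<in>carrier H. F (act h' t) * delta (act h' t) s) = (\<Sum>h'\<in>carrier H. if h' = h then F s else 0)"
          using h act_inj[OF _ h(1) t] by (intro sum.cong) (auto simp: delta_def)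
        thus ?thesis using h finH by simp
      qed
      finally show ?thesis by simp
    qed
    hence "F = \<Phi> (\<lambda>c\<in>I. delta_mat t c * transpose_mat (rep_alg (carrier H) (dh c) (\<tau> c) a))"
      using \<Phi>_rep_alg[OF delta_mat_E finH order_refl, of t a] by (simp add: \<Phi>_delta_mat fun_eq_iff)
    moreover have "(\<lambda>c\<in>I. delta_mat t c * transpose_mat (rep_alg (carrier H) (dh c) (\<tau> c) a)) \<in> E"
      using delta_mat_carrier by (auto intro!: mult_carrier_mat)
    ultimately have "(\<lambda>c'\<in>I. if c' = c then outer (dh c) v else 0\<^sub>m (dg c') (dh c')) =
        (\<lambda>c\<in>I. delta_mat t c * transpose_mat (rep_alg (carrier H) (dh c) (\<tau> c) a))"
      using \<Phi>_cancel[OF vec_fun_E[OF vc]] by (simp only: F_def vec_fun_def)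
    hence "outer (dh c) v = delta_mat t c * transpose_mat (rep_alg (carrier H) (dh c) (\<tau> c) a)"
      using restrict_eqD[OF _ c] by fastforce
    hence "v = (delta_mat t c * transpose_mat (rep_alg (carrier H) (dh c) (\<tau> c) a)) *\<^sub>v unit_vec (dh c) 0"
      using outer_unit_vec[OF dh_pos[OF c] vc] by simp
    also have "\<dots> = delta_mat t c *\<^sub>v (transpose_mat (rep_alg (carrier H) (dh c) (\<tau> c) a) *\<^sub>v unit_vec (dh c) 0)"
      by (rule assoc_mult_mat_vec[OF m transpose_carrier_mat[THEN iffD2, OF rep_alg_carrier] unit_vec_carrier])
    finally show "v \<in> (\<lambda>v. delta_mat t c *\<^sub>v v) ` carrier_vec (dh c)"
      by (metis imageI mult_mat_vec_carrier rep_alg_carrier transpose_carrier_mat unit_vec_carrier)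
  qed
qed

lemma weights_nonzero:
  assumes t: "t \<in> S" and c: "c \<in> I"
  obtains v where "v \<in> weights c t" "v \<noteq> 0\<^sub>v (dg c)"
proof (rule that)
  show "delta_mat t c *\<^sub>v unit_vec (dh c) 0 \<in> weights c t" using delta_mat_range[OF t c] by auto
  show "delta_mat t c *\<^sub>v unit_vec (dh c) 0 \<noteq> 0\<^sub>v (dg c)"
    using delta_mat_inj[OF t c, of "unit_vec (dh c) 0"] dh_pos[OF c] by (metis unit_vec_carrier unit_vec_nonzero)
qed

lemma weights_subset_transfer:
  assumes t: "t \<in> S" "t' \<in> S" and c: "c \<in> I" and K: "vec_subspace (dg c) K" "invariant G (\<Theta> c) K"
    and sub: "weights c t \<subseteq> K"
  shows "weights c t' \<subseteq> K"
proof
  fix w assume "w \<in> weights c t'"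
  then obtain v where v: "v \<in> carrier_vec (dh c)" "w = delta_mat t' c *\<^sub>v v" using delta_mat_range[OF t(2) c] by blast
  obtain g \<epsilon> where g: "g \<in> carrier G" "\<epsilon> \<noteq> 0" "\<Theta> c g * delta_mat t c = \<epsilon> \<cdot>\<^sub>m delta_mat t' c"
    using delta_mat_transitive[OF t] c by metis
  have "delta_mat t c *\<^sub>v v \<in> K" using delta_mat_range[OF t(1) c] v sub by blast
  hence "\<Theta> c g *\<^sub>v (delta_mat t c *\<^sub>v v) \<in> K" using K(2) g by (simp add: invariant_def)
  also have "\<Theta> c g *\<^sub>v (delta_mat t c *\<^sub>v v) = \<epsilon> \<cdot>\<^sub>v w"
    using assoc_mult_mat_vec[OF is_repD(1)[OF \<Theta>_rep[OF c] g(1)] delta_mat_carrier[OF c] v(1), symmetric, of t]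
      smult_mat_vec[OF delta_mat_carrier[OF c] v(1)] g(3) v(2) by simp
  finally have "(1 / \<epsilon>) \<cdot>\<^sub>v (\<epsilon> \<cdot>\<^sub>v w) \<in> K" using K(1) unfolding vec_subspace_def by blast
  thus "w \<in> K" using g(2) by (simp add: smult_smult_assoc)
qed

text \<open>Pulled back along the delta matrix, \<open>K\<close> becomes a subspace stable under the
  transposes of \<open>\<tau> c\<close>: \<open>delta_mat_swap\<close> trades each transpose for an
  element of \<open>G\<close>, up to a scalar that a subspace does not see. Irreducibility of the
  dual forces the pull-back to be everything once it is non-zero.\<close>

lemma weights_dichotomy:
  assumes t: "t \<in> S" "t' \<in> S" and c: "c \<in> I" and K: "vec_subspace (dg c) K" "invariant G (\<Theta> c) K"
    and ne: "K \<inter> weights c t \<noteq> {0\<^sub>v (dg c)}"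
  shows "weights c t' \<subseteq> K"
proof (rule weights_subset_transfer[OF t c K])
  note m = delta_mat_carrier[OF c, of t]
  define P where "P = {v \<in> carrier_vec (dh c). delta_mat t c *\<^sub>v v \<in> K}"
  have P: "vec_subspace (dh c) P" unfolding P_def by (rule vec_subspace_vimage[OF m K(1)])
  have inv: "transpose_mat (\<tau> c h) *\<^sub>v v \<in> P" if h: "h \<in> carrier H" and v: "v \<in> P" for h v
  proof -
    have vc: "v \<in> carrier_vec (dh c)" using v by (simp add: P_def)
    have \<tau>v: "transpose_mat (\<tau> c h) *\<^sub>v v \<in> carrier_vec (dh c)"
      using \<tau>_transpose_carrier[OF c h] vc by (rule mult_mat_vec_carrier)
    obtain g \<epsilon> where g: "g \<in> carrier G" "\<epsilon> \<noteq> 0"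
      "\<Theta> c g *\<^sub>v (delta_mat t c *\<^sub>v v) = \<epsilon> \<cdot>\<^sub>v (delta_mat t c *\<^sub>v (transpose_mat (\<tau> c h) *\<^sub>v v))"
      using delta_mat_swap[OF t(1) h] c vc by metis
    have "\<epsilon> \<cdot>\<^sub>v (delta_mat t c *\<^sub>v (transpose_mat (\<tau> c h) *\<^sub>v v)) \<in> K"
      unfolding g(3)[symmetric] using v g(1) K(2) by (simp add: P_def invariant_def)
    hence "(1 / \<epsilon>) \<cdot>\<^sub>v (\<epsilon> \<cdot>\<^sub>v (delta_mat t c *\<^sub>v (transpose_mat (\<tau> c h) *\<^sub>v v))) \<in> K"
      using K(1) unfolding vec_subspace_def by blast
    thus ?thesis using g(2) \<tau>v by (simp add: P_def smult_smult_assoc)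
  qed
  have "0\<^sub>v (dg c) \<in> K \<inter> weights c t"
    using K(1) vec_subspace_weight_space[of N "\<Theta> c" "dg c" "\<chi> t"] is_repD(1)[OF \<Theta>_rep[OF c] N_carrier]
    by (simp add: vec_subspace_def)
  then obtain w where w: "w \<in> K" "w \<in> weights c t" "w \<noteq> 0\<^sub>v (dg c)" using ne by blast
  then obtain v where v: "v \<in> carrier_vec (dh c)" "w = delta_mat t c *\<^sub>v v" using delta_mat_range[OF t(1) c] by blast
  have "v \<noteq> 0\<^sub>v (dh c)" using w(3) v m by (auto intro!: eq_vecI)
  moreover have "v \<in> P" using v w by (simp add: P_def)
  ultimately have "P = carrier_vec (dh c)"
    using irreducible_transpose[OF H \<tau>_irr[OF c] \<tau>_rep[OF c] P inv] by blast
  hence "delta_mat t c *\<^sub>v v \<in> K" if "v \<in> carrier_vec (dh c)" for v using that by (auto simp: P_def)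
  thus "weights c t \<subseteq> K" unfolding delta_mat_range[OF t(1) c, symmetric] by blast
qed

section \<open>The irreducible submodule of \<open>\<Theta> c\<close> generated by a weight
  space\<close>

definition base :: 't where "base = (SOME t. t \<in> S)"

lemma base_S: "base \<in> S"
  unfolding base_def using S_nonempty by (simp add: some_in_eq)

text \<open>Anchored at \<open>base\<close>. Elements of \<open>G\<close> carry the weight space at
  one point of \<open>S\<close> to that at any other, so the submodule contains all of them and is
  generated by any one.\<close>

definition top_space :: "('h \<Rightarrow> complex mat) set \<Rightarrow> complex vec set" where
  "top_space c = (SOME M. vec_subspace (dg c) M \<and> invariant G (\<Theta> c) M \<and> weights c base \<subseteq> M \<and>
    (\<forall>K. vec_subspace (dg c) K \<longrightarrow> invariant G (\<Theta> c) K \<longrightarrow> weights c base \<subseteq> K \<longrightarrow> M \<subseteq> K) \<and>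
    (\<forall>K. vec_subspace (dg c) K \<longrightarrow> invariant G (\<Theta> c) K \<longrightarrow> K \<subseteq> M \<longrightarrow> K = {0\<^sub>v (dg c)} \<or> K = M))"

lemma top_space:
  assumes c: "c \<in> I"
  shows "vec_subspace (dg c) (top_space c)" "invariant G (\<Theta> c) (top_space c)"
    "\<And>t. t \<in> S \<Longrightarrow> weights c t \<subseteq> top_space c"
    "\<And>K t. vec_subspace (dg c) K \<Longrightarrow> invariant G (\<Theta> c) K \<Longrightarrow> t \<in> S \<Longrightarrow>
       K \<inter> weights c t \<noteq> {0\<^sub>v (dg c)} \<Longrightarrow> top_space c \<subseteq> K"
    "\<And>K. vec_subspace (dg c) K \<Longrightarrow> invariant G (\<Theta> c) K \<Longrightarrow> K \<subseteq> top_space c \<Longrightarrow>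
       K = {0\<^sub>v (dg c)} \<or> K = top_space c"
proof -
  have "\<exists>M. vec_subspace (dg c) M \<and> invariant G (\<Theta> c) M \<and> weights c base \<subseteq> M \<and>
    (\<forall>K. vec_subspace (dg c) K \<longrightarrow> invariant G (\<Theta> c) K \<longrightarrow> weights c base \<subseteq> K \<longrightarrow> M \<subseteq> K) \<and>
    (\<forall>K. vec_subspace (dg c) K \<longrightarrow> invariant G (\<Theta> c) K \<longrightarrow> K \<subseteq> M \<longrightarrow> K = {0\<^sub>v (dg c)} \<or> K = M)" (is ?Q)
  proof (rule minimal_invariant_subspace[OF G finG \<Theta>_rep[OF c] N char[of base] refl])
    show "weights c base \<subseteq> K" if "vec_subspace (dg c) K" "invariant G (\<Theta> c) K"
      "K \<inter> weights c base \<noteq> {0\<^sub>v (dg c)}" for K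
      by (rule weights_dichotomy[OF base_S base_S c that])
  next
    fix M
    assume "vec_subspace (dg c) M" "invariant G (\<Theta> c) M" "weights c base \<subseteq> M"
      "\<And>K. vec_subspace (dg c) K \<Longrightarrow> invariant G (\<Theta> c) K \<Longrightarrow> weights c base \<subseteq> K \<Longrightarrow> M \<subseteq> K"
      "\<And>K. vec_subspace (dg c) K \<Longrightarrow> invariant G (\<Theta> c) K \<Longrightarrow> K \<subseteq> M \<Longrightarrow> K = {0\<^sub>v (dg c)} \<or> K = M"
    thus "?Q" by (intro exI[of _ M] conjI allI impI)
  qed
  note M = someI_ex[OF this, folded top_space_def]
  show 1: "vec_subspace (dg c) (top_space c)" and 2: "invariant G (\<Theta> c) (top_space c)"
    and "\<And>K. vec_subspace (dg c) K \<Longrightarrow> invariant G (\<Theta> c) K \<Longrightarrow> K \<subseteq> top_space c \<Longrightarrow>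
       K = {0\<^sub>v (dg c)} \<or> K = top_space c"
    using M by blast+
  show "weights c t \<subseteq> top_space c" if "t \<in> S" for t
    using weights_subset_transfer[OF base_S that c 1 2] M by blast
  show "top_space c \<subseteq> K" if "vec_subspace (dg c) K" "invariant G (\<Theta> c) K" "t \<in> S"
    "K \<inter> weights c t \<noteq> {0\<^sub>v (dg c)}" for K t
    using weights_dichotomy[OF that(3) base_S c that(1,2,4)] M that by blast
qed

text \<open>\<open>J\<close> identifies \<pi> with \<open>top_space c\<close>. Quantifying over all
  such \<pi> makes \<open>eta c\<close> a full isomorphism class, hence literally an element of
  \<open>Irr G\<close>.\<close>

definition top_embedding :: "('h \<Rightarrow> complex mat) set \<Rightarrow> ('g \<Rightarrow> complex mat) \<Rightarrow> complex mat \<Rightarrow> bool" where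
  "top_embedding c \<pi> J \<longleftrightarrow> irreducible_rep G \<pi> \<and> intertwines G (rep_degree G \<pi>) (dg c) \<pi> (\<Theta> c) J \<and>
     (\<forall>v\<in>carrier_vec (rep_degree G \<pi>). J *\<^sub>v v = 0\<^sub>v (dg c) \<longrightarrow> v = 0\<^sub>v (rep_degree G \<pi>)) \<and>
     (\<lambda>v. J *\<^sub>v v) ` carrier_vec (rep_degree G \<pi>) = top_space c"

definition eta :: "('h \<Rightarrow> complex mat) set \<Rightarrow> ('g \<Rightarrow> complex mat) set" where
  "eta c = {\<pi>. \<exists>J. top_embedding c \<pi> J}"

lemma top_embeddingD:
  assumes "top_embedding c \<pi> J"
  shows "irreducible_rep G \<pi>" "is_rep G (rep_degree G \<pi>) \<pi>"
    "intertwines G (rep_degree G \<pi>) (dg c) \<pi> (\<Theta> c) J" "J \<in> carrier_mat (dg c) (rep_degree G \<pi>)"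
    "\<And>v. v \<in> carrier_vec (rep_degree G \<pi>) \<Longrightarrow> J *\<^sub>v v = 0\<^sub>v (dg c) \<Longrightarrow> v = 0\<^sub>v (rep_degree G \<pi>)"
    "(\<lambda>v. J *\<^sub>v v) ` carrier_vec (rep_degree G \<pi>) = top_space c"
    "\<forall>v\<in>carrier_vec (rep_degree G \<pi>). J *\<^sub>v v = 0\<^sub>v (dg c) \<longrightarrow> v = 0\<^sub>v (rep_degree G \<pi>)"
  using assms irreducible_is_rep[OF G] by (auto simp: top_embedding_def intertwines_def)

lemma eta_exists:
  assumes c: "c \<in> I"
  obtains \<pi> J where "top_embedding c \<pi> J"
proof -
  obtain e J L where J: "J \<in> carrier_mat (dg c) e" and L: "L \<in> carrier_mat e (dg c)" and LJ: "L * J = 1\<^sub>m e"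
    and KJ: "top_space c = (\<lambda>v. J *\<^sub>v v) ` carrier_vec e" using vec_subspace_frame[OF top_space(1)[OF c]] .
  define \<pi> where "\<pi> = (\<lambda>g. L * \<Theta> c g * J)"
  note sub = subrep_frame[OF \<Theta>_rep[OF c] top_space(2)[OF c] KJ J L LJ G, folded \<pi>_def]
  have deg: "rep_degree G \<pi> = e" by (rule is_rep_degree[OF sub(1)])
  have LJv: "L *\<^sub>v (J *\<^sub>v u) = u" if "u \<in> carrier_vec e" for u
    using that J L LJ by (metis assoc_mult_mat_vec one_mult_mat_vec)
  have L0: "L *\<^sub>v 0\<^sub>v (dg c) = 0\<^sub>v e" using L by (intro eq_vecI) auto
  have inj: "u = 0\<^sub>v e" if "u \<in> carrier_vec e" "J *\<^sub>v u = 0\<^sub>v (dg c)" for u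
    using LJv[OF that(1)] that(2) L0 by simp
  have J0: "J *\<^sub>v 0\<^sub>v e = 0\<^sub>v (dg c)" using J by (intro eq_vecI) auto
  have "irreducible_rep G \<pi>" unfolding irreducible_iff[OF G] deg
  proof (intro conjI allI impI)
    show "is_rep G e \<pi>" by (rule sub(1))
    \<comment> \<open>The submodule contains a non-zero weight space, so it cannot have degree
      0.\<close>
    show "e > 0"
    proof (rule ccontr)
      assume "\<not> e > 0"
      hence e: "e = 0" by simp
      obtain v where v: "v \<in> weights c base" "v \<noteq> 0\<^sub>v (dg c)" using weights_nonzero[OF base_S c] .
      then obtain u where u: "u \<in> carrier_vec e" "v = J *\<^sub>v u" using top_space(3)[OF c base_S] KJ by blast
      have "u = 0\<^sub>v e" using u(1) e by auto
      with u(2) v(2) J0 show False by simp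
    qed
    fix K assume K: "vec_subspace e K \<and> invariant G \<pi> K"
    define K' where "K' = (\<lambda>v. J *\<^sub>v v) ` K"
    have Kc: "K \<subseteq> carrier_vec e" using K by (simp add: vec_subspace_def)
    have 1: "vec_subspace (dg c) K'" unfolding vec_subspace_def
    proof (intro conjI ballI allI)
      show "K' \<subseteq> carrier_vec (dg c)" using Kc J by (auto simp: K'_def)
      show "0\<^sub>v (dg c) \<in> K'" using K J0 unfolding K'_def vec_subspace_def by (metis image_eqI)
    next
      fix v w assume "v \<in> K'" "w \<in> K'"
      then obtain x y where "x \<in> K" "y \<in> K" "v = J *\<^sub>v x" "w = J *\<^sub>v y" by (auto simp: K'_def)
      moreover from this have "v + w = J *\<^sub>v (x + y)" using J Kc by (metis mult_add_distrib_mat_vec subsetD)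
      ultimately show "v + w \<in> K'" using K by (simp add: vec_subspace_def K'_def)
    next
      fix a v assume "v \<in> K'"
      then obtain x where "x \<in> K" "v = J *\<^sub>v x" by (auto simp: K'_def)
      moreover from this have "a \<cdot>\<^sub>v v = J *\<^sub>v (a \<cdot>\<^sub>v x)" using J Kc by (metis mult_mat_vec subsetD)
      ultimately show "a \<cdot>\<^sub>v v \<in> K'" using K by (simp add: vec_subspace_def K'_def)
    qed
    have 2: "invariant G (\<Theta> c) K'" unfolding invariant_def
    proof (intro ballI)
      fix g v assume g: "g \<in> carrier G" and "v \<in> K'"
      then obtain x where x: "x \<in> K" "v = J *\<^sub>v x" by (auto simp: K'_def)
      have "\<Theta> c g *\<^sub>v v = J *\<^sub>v (\<pi> g *\<^sub>v x)"
        using intertwines_vec[OF sub(1) \<Theta>_rep[OF c] sub(2) g, of x] x Kc by auto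
      thus "\<Theta> c g *\<^sub>v v \<in> K'" using K x g by (simp add: K'_def invariant_def)
    qed
    have 3: "K' \<subseteq> top_space c" using Kc KJ by (auto simp: K'_def)
    have "K' = {0\<^sub>v (dg c)} \<or> K' = top_space c" by (rule top_space(5)[OF c 1 2 3])
    thus "K = {0\<^sub>v e} \<or> K = carrier_vec e"
    proof
      assume "K' = {0\<^sub>v (dg c)}"
      hence "K \<subseteq> {0\<^sub>v e}" using inj Kc by (auto simp: K'_def)
      thus ?thesis using K by (auto simp: vec_subspace_def)
    next
      assume eq: "K' = top_space c"
      have "u \<in> K" if u: "u \<in> carrier_vec e" for u
      proof -
        have "J *\<^sub>v u \<in> K'" using eq KJ u by blast
        then obtain x where "x \<in> K" "J *\<^sub>v u = J *\<^sub>v x" by (auto simp: K'_def)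
        thus ?thesis using LJv[OF u] LJv[of x] Kc by (metis subsetD)
      qed
      thus ?thesis using Kc by blast
    qed
  qed
  hence "top_embedding c \<pi> J" unfolding top_embedding_def deg using sub(2) inj KJ by simp
  thus thesis by (rule that)
qed

lemma eta_equivalent:
  assumes c: "c \<in> I" and \<pi>: "\<pi> \<in> eta c" "\<pi>' \<in> eta c"
  shows "equivalent_rep G \<pi> \<pi>'"
proof -
  obtain J J' where J: "top_embedding c \<pi> J" and J': "top_embedding c \<pi>' J'" using \<pi> by (auto simp: eta_def)
  note D = top_embeddingD[OF J] and D' = top_embeddingD[OF J']
  have "(\<lambda>v. J *\<^sub>v v) ` carrier_vec (rep_degree G \<pi>) \<subseteq> (\<lambda>v. J' *\<^sub>v v) ` carrier_vec (rep_degree G \<pi>')"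
    using D(6) D'(6) by simp
  from factor_through_image[OF D(2) D'(2) \<Theta>_rep[OF c] D(3) D'(3) D'(7) this]
  obtain \<xi> where \<xi>: "intertwines G (rep_degree G \<pi>) (rep_degree G \<pi>') \<pi> \<pi>' \<xi>" "J = J' * \<xi>" by blast
  have J'\<xi>: "J' *\<^sub>v (\<xi> *\<^sub>v v) = J *\<^sub>v v" if "v \<in> carrier_vec (rep_degree G \<pi>)" for v
    unfolding \<xi>(2) using assoc_mult_mat_vec[OF D'(4) _ that, of \<xi>] \<xi>(1) by (simp add: intertwines_def)
  have pos: "rep_degree G \<pi> > 0" by (rule irreducible_repD(1)[OF G D(1,2)])
  have "\<xi> \<noteq> 0\<^sub>m (rep_degree G \<pi>') (rep_degree G \<pi>)"
  proof
    assume z: "\<xi> = 0\<^sub>m (rep_degree G \<pi>') (rep_degree G \<pi>)"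
    let ?u = "unit_vec (rep_degree G \<pi>) 0 :: complex vec"
    have "\<xi> *\<^sub>v ?u = 0\<^sub>v (rep_degree G \<pi>')" unfolding z by (intro eq_vecI) auto
    hence "J *\<^sub>v ?u = J' *\<^sub>v 0\<^sub>v (rep_degree G \<pi>')" using J'\<xi>[of ?u] by simp
    also have "\<dots> = 0\<^sub>v (dg c)" using D'(4) by (intro eq_vecI) auto
    finally show False using D(5)[of ?u] pos by simp
  qed
  thus ?thesis using schur_equivalent[OF G D(1) D'(1) D(2) D'(2) \<xi>(1)] by blast
qed

lemma eta_closed:
  assumes c: "c \<in> I" and \<pi>: "\<pi> \<in> eta c" and irr: "irreducible_rep G \<pi>'" and eq: "equivalent_rep G \<pi> \<pi>'"
  shows "\<pi>' \<in> eta c"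
proof -
  obtain J where J: "top_embedding c \<pi> J" using \<pi> by (auto simp: eta_def)
  note D = top_embeddingD[OF J]
  let ?e = "rep_degree G \<pi>" and ?e' = "rep_degree G \<pi>'"
  note \<pi>' = irreducible_is_rep[OF G irr]
  obtain M R where MR: "intertwines G ?e ?e' \<pi> \<pi>' M" "intertwines G ?e' ?e \<pi>' \<pi> R" "M * R = 1\<^sub>m ?e'" "R * M = 1\<^sub>m ?e"
    using equivalent_repE[OF D(2) \<pi>' eq] by metis
  have Mc: "M \<in> carrier_mat ?e' ?e" and Rc: "R \<in> carrier_mat ?e ?e'" using MR by (auto simp: intertwines_def)
  have RM: "R *\<^sub>v (M *\<^sub>v v) = v" if "v \<in> carrier_vec ?e" for v
    using assoc_mult_mat_vec[OF Rc Mc that, symmetric] MR(4) that by simp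
  have MRv: "M *\<^sub>v (R *\<^sub>v v) = v" if "v \<in> carrier_vec ?e'" for v
    using assoc_mult_mat_vec[OF Mc Rc that, symmetric] MR(3) that by simp
  have JR: "(J * R) *\<^sub>v v = J *\<^sub>v (R *\<^sub>v v)" if "v \<in> carrier_vec ?e'" for v
    using assoc_mult_mat_vec[OF D(4) Rc that] .
  have "top_embedding c \<pi>' (J * R)" unfolding top_embedding_def
  proof (intro conjI irr ballI impI)
    show "intertwines G ?e' (dg c) \<pi>' (\<Theta> c) (J * R)"
      by (rule intertwines_comp[OF \<pi>' D(2) \<Theta>_rep[OF c] MR(2) D(3)])
    fix v assume v: "v \<in> carrier_vec ?e'" and 0: "J * R *\<^sub>v v = 0\<^sub>v (dg c)"
    have "R *\<^sub>v v = 0\<^sub>v ?e" using D(5)[of "R *\<^sub>v v"] JR[OF v] 0 Rc v by simp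
    hence "v = M *\<^sub>v 0\<^sub>v ?e" using MRv[OF v] by simp
    also have "\<dots> = 0\<^sub>v ?e'" using Mc by (intro eq_vecI) auto
    finally show "v = 0\<^sub>v ?e'" .
  next
    have "(\<lambda>v. (J * R) *\<^sub>v v) ` carrier_vec ?e' = (\<lambda>v. J *\<^sub>v v) ` carrier_vec ?e"
    proof (intro equalityI image_subsetI)
      fix v :: "complex vec" assume v: "v \<in> carrier_vec ?e'"
      show "(J * R) *\<^sub>v v \<in> (\<lambda>v. J *\<^sub>v v) ` carrier_vec ?e" unfolding JR[OF v] using Rc v by auto
    next
      fix v :: "complex vec" assume v: "v \<in> carrier_vec ?e"
      have "M *\<^sub>v v \<in> carrier_vec ?e'" using Mc v by simp
      moreover from JR[OF this] have "J *\<^sub>v v = (J * R) *\<^sub>v (M *\<^sub>v v)" using RM[OF v] by simp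
      ultimately show "J *\<^sub>v v \<in> (\<lambda>v. (J * R) *\<^sub>v v) ` carrier_vec ?e'" by blast
    qed
    thus "(\<lambda>v. (J * R) *\<^sub>v v) ` carrier_vec ?e' = top_space c" using D(6) by simp
  qed
  thus ?thesis by (auto simp: eta_def)
qed

lemma eta_Irr:
  assumes c: "c \<in> I"
  shows "eta c \<in> Irr G"
proof -
  obtain \<pi> J where J: "top_embedding c \<pi> J" using eta_exists[OF c] .
  hence \<pi>: "\<pi> \<in> eta c" by (auto simp: eta_def)
  have irr: "irreducible_rep G \<pi>" if "\<pi> \<in> eta c" for \<pi> using that by (auto simp: eta_def top_embedding_def)
  have "eta c = irr_rel G `` {\<pi>}"
    using eta_equivalent[OF c \<pi>] eta_closed[OF c \<pi>] irr irr[OF \<pi>] by (auto simp: irr_rel_def)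
  thus ?thesis unfolding Irr_eq using irr[OF \<pi>] by (simp add: quotientI)
qed

text \<open>\<open>A\<close> is the delta matrix with target restricted to \<pi>; it parametrises
  the weight space of \<pi> by vectors of length \<open>dh c\<close>. This is the source of the
  multiplicity formula.\<close>

lemma embedded_weight_space:
  assumes c: "c \<in> I" and t: "t \<in> S" and J: "top_embedding c \<pi> J"
  obtains A where "A \<in> carrier_mat (rep_degree G \<pi>) (dh c)"
    "\<And>u. u \<in> carrier_vec (dh c) \<Longrightarrow> J *\<^sub>v (A *\<^sub>v u) = delta_mat t c *\<^sub>v u"
    "\<And>u. u \<in> carrier_vec (dh c) \<Longrightarrow> A *\<^sub>v u = 0\<^sub>v (rep_degree G \<pi>) \<Longrightarrow> u = 0\<^sub>v (dh c)"
    "(\<lambda>u. A *\<^sub>v u) ` carrier_vec (dh c) = weight_space N (rep_degree G \<pi>) \<pi> (\<chi> t)"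
proof -
  note D = top_embeddingD[OF J]
  let ?e = "rep_degree G \<pi>"
  note m = delta_mat_carrier[OF c, of t]
  obtain L where L: "L \<in> carrier_mat ?e (dg c)" "\<And>v. v \<in> carrier_vec ?e \<Longrightarrow> L *\<^sub>v (J *\<^sub>v v) = v"
    using inj_mat_left_inverse[OF D(4,5)] by metis
  define A where "A = L * delta_mat t c"
  have A: "A \<in> carrier_mat ?e (dh c)" using L m by (simp add: A_def)
  have JA: "J *\<^sub>v (A *\<^sub>v u) = delta_mat t c *\<^sub>v u" if u: "u \<in> carrier_vec (dh c)" for u
  proof -
    have "delta_mat t c *\<^sub>v u \<in> top_space c" using delta_mat_range[OF t c] top_space(3)[OF c t] u by blast
    then obtain v where v: "v \<in> carrier_vec ?e" "delta_mat t c *\<^sub>v u = J *\<^sub>v v" using D(6) by (metis imageE)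
    have "A *\<^sub>v u = L *\<^sub>v (delta_mat t c *\<^sub>v u)" unfolding A_def by (rule assoc_mult_mat_vec[OF L(1) m u])
    thus ?thesis using v L(2) by simp
  qed
  have inj: "u = 0\<^sub>v (dh c)" if u: "u \<in> carrier_vec (dh c)" and 0: "A *\<^sub>v u = 0\<^sub>v ?e" for u
  proof -
    have "delta_mat t c *\<^sub>v u = 0\<^sub>v (dg c)" unfolding JA[OF u, symmetric] 0 using D(4) by (intro eq_vecI) auto
    thus ?thesis by (rule delta_mat_inj[OF t c u])
  qed
  have weight_iff: "v \<in> weight_space N ?e \<pi> (\<chi> t) \<longleftrightarrow> J *\<^sub>v v \<in> weights c t" if v: "v \<in> carrier_vec ?e" for v
  proof -
    have "\<pi> a *\<^sub>v v = \<chi> t a \<cdot>\<^sub>v v \<longleftrightarrow> \<Theta> c a *\<^sub>v (J *\<^sub>v v) = \<chi> t a \<cdot>\<^sub>v (J *\<^sub>v v)" if a: "a \<in> N" for a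
    proof -
      have e1: "\<Theta> c a *\<^sub>v (J *\<^sub>v v) = J *\<^sub>v (\<pi> a *\<^sub>v v)"
        using intertwines_vec[OF D(2) \<Theta>_rep[OF c] D(3) N_carrier[OF a] v] by simp
      have e2: "\<chi> t a \<cdot>\<^sub>v (J *\<^sub>v v) = J *\<^sub>v (\<chi> t a \<cdot>\<^sub>v v)" using mult_mat_vec[OF D(4) v] by simp
      show ?thesis unfolding e1 e2
        using inj_mat_cancel[OF D(4,5), of "\<pi> a *\<^sub>v v" "\<chi> t a \<cdot>\<^sub>v v"] is_rep_vec[OF D(2) N_carrier[OF a] v] v by auto
    qed
    thus ?thesis using v D(4) by (auto simp: weight_space_def)
  qed
  have "(\<lambda>u. A *\<^sub>v u) ` carrier_vec (dh c) = weight_space N ?e \<pi> (\<chi> t)"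
  proof (intro equalityI image_subsetI subsetI)
    fix u :: "complex vec" assume u: "u \<in> carrier_vec (dh c)"
    have "A *\<^sub>v u \<in> carrier_vec ?e" using A u by simp
    thus "A *\<^sub>v u \<in> weight_space N ?e \<pi> (\<chi> t)" using weight_iff JA[OF u] delta_mat_range[OF t c] u by auto
  next
    fix v assume v: "v \<in> weight_space N ?e \<pi> (\<chi> t)"
    hence vc: "v \<in> carrier_vec ?e" by (simp add: weight_space_def)
    hence "J *\<^sub>v v \<in> weights c t" using v weight_iff by blast
    then obtain u where u: "u \<in> carrier_vec (dh c)" "J *\<^sub>v v = delta_mat t c *\<^sub>v u" using delta_mat_range[OF t c] by (metis imageE)
    have "v = A *\<^sub>v u"
      using inj_mat_cancel[OF D(4,5) vc, of "A *\<^sub>v u"] JA[OF u(1)] u A by simp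
    thus "v \<in> (\<lambda>u. A *\<^sub>v u) ` carrier_vec (dh c)" using u by blast
  qed
  from that[OF A JA inj this] show thesis .
qed

section \<open>Constituents of \<open>\<Theta> c\<close> and their weights\<close>

lemma weight_preserved:
  assumes c: "c \<in> I" and \<pi>: "is_rep G e \<pi>" and \<phi>: "intertwines G e (dg c) \<pi> (\<Theta> c) \<phi>"
    and v: "v \<in> weight_space N e \<pi> \<xi>"
  shows "\<phi> *\<^sub>v v \<in> weight_space N (dg c) (\<Theta> c) \<xi>"
proof -
  have vc: "v \<in> carrier_vec e" using v by (simp add: weight_space_def)
  have \<phi>c: "\<phi> \<in> carrier_mat (dg c) e" using \<phi> by (simp add: intertwines_def)
  have "\<Theta> c a *\<^sub>v (\<phi> *\<^sub>v v) = \<xi> a \<cdot>\<^sub>v (\<phi> *\<^sub>v v)" if a: "a \<in> N" for a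
    using intertwines_vec[OF \<pi> \<Theta>_rep[OF c] \<phi> N_carrier[OF a] vc] v a mult_mat_vec[OF \<phi>c vc]
    by (simp add: weight_space_def)
  thus ?thesis using \<phi>c vc by (simp add: weight_space_def)
qed

text \<open>A weight vector of \<pi> must go to a weight vector of \<open>\<Theta> c\<close>, hence
  into \<open>top_space c\<close>, and irreducibility takes the whole image there. So
  \<open>\<phi>\<close> factors through \<open>J\<close> and Schur's lemma leaves a scalar.\<close>

lemma intertwiners_eta:
  assumes c: "c \<in> I" and J: "top_embedding c \<pi> J" and \<phi>: "intertwines G (rep_degree G \<pi>) (dg c) \<pi> (\<Theta> c) \<phi>"
  obtains a where "\<phi> = a \<cdot>\<^sub>m J"
proof -
  note D = top_embeddingD[OF J]
  let ?e = "rep_degree G \<pi>"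
  obtain A where A: "A \<in> carrier_mat ?e (dh c)"
    "\<And>u. u \<in> carrier_vec (dh c) \<Longrightarrow> A *\<^sub>v u = 0\<^sub>v ?e \<Longrightarrow> u = 0\<^sub>v (dh c)"
    "(\<lambda>u. A *\<^sub>v u) ` carrier_vec (dh c) = weight_space N ?e \<pi> (\<chi> base)"
    using embedded_weight_space[OF c base_S J] by metis
  define v where "v = A *\<^sub>v unit_vec (dh c) 0"
  have v: "v \<in> weight_space N ?e \<pi> (\<chi> base)" using A(3) by (auto simp: v_def)
  have vc: "v \<in> carrier_vec ?e" using v by (simp add: weight_space_def)
  have v0: "v \<noteq> 0\<^sub>v ?e" using A(2)[of "unit_vec (dh c) 0"] dh_pos[OF c] unfolding v_def by (metis unit_vec_carrier unit_vec_nonzero)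
  have "\<phi> *\<^sub>v v \<in> top_space c"
    using weight_preserved[OF c D(2) \<phi> v] top_space(3)[OF c base_S] by blast
  hence "\<phi> *\<^sub>v w \<in> top_space c" if "w \<in> carrier_vec ?e" for w
    using irreducible_vimage[OF G D(1,2) \<Theta>_rep[OF c] \<phi> top_space(1,2)[OF c] vc v0 _ that] by blast
  hence "(\<lambda>v. \<phi> *\<^sub>v v) ` carrier_vec ?e \<subseteq> (\<lambda>v. J *\<^sub>v v) ` carrier_vec ?e"
    unfolding D(6) by blast
  from factor_through_image[OF D(2) D(2) \<Theta>_rep[OF c] \<phi> D(3) D(7) this]
  obtain \<xi> where \<xi>: "intertwines G ?e ?e \<pi> \<pi> \<xi>" "\<phi> = J * \<xi>" by blast
  obtain a where "\<xi> = a \<cdot>\<^sub>m 1\<^sub>m ?e" using schur_scalar[OF G D(1,2) \<xi>(1)] .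
  hence "\<phi> = a \<cdot>\<^sub>m J" using \<xi>(2) D(4) mult_smult_distrib[OF D(4) one_carrier_mat, of a] by simp
  thus thesis by (rule that)
qed

text \<open>The image of \<pi> meets a weight space at \<open>S\<close>, so it contains
  \<open>top_space c\<close>; conversely one of its non-zero vectors lies in that submodule, so it
  is contained in it.\<close>

lemma constituent_top_weights:
  assumes c: "c \<in> I" and irr: "irreducible_rep G \<pi>" and \<pi>: "is_rep G e \<pi>"
    and \<phi>: "intertwines G e (dg c) \<pi> (\<Theta> c) \<phi>" "\<phi> \<noteq> 0\<^sub>m (dg c) e"
    and t: "t \<in> S" and v: "v \<in> weight_space N e \<pi> (\<chi> t)" "v \<noteq> 0\<^sub>v e"
  shows "\<pi> \<in> eta c"
proof -
  have \<phi>c: "\<phi> \<in> carrier_mat (dg c) e" using \<phi> by (simp add: intertwines_def)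
  have vc: "v \<in> carrier_vec e" using v by (simp add: weight_space_def)
  note inj = irreducible_intertwiner_inj[OF G irr \<pi> \<Theta>_rep[OF c] \<phi>]
  define K where "K = (\<lambda>v. \<phi> *\<^sub>v v) ` carrier_vec e"
  have K: "vec_subspace (dg c) K" "invariant G (\<Theta> c) K"
    unfolding K_def by (rule vec_subspace_image[OF \<phi>c], rule invariant_image[OF \<pi> \<Theta>_rep[OF c] \<phi>(1)])
  have w: "\<phi> *\<^sub>v v \<in> K" "\<phi> *\<^sub>v v \<in> weights c t" "\<phi> *\<^sub>v v \<noteq> 0\<^sub>v (dg c)"
    using weight_preserved[OF c \<pi> \<phi>(1) v(1)] inj[OF vc] v(2) vc by (auto simp: K_def)
  have "top_space c \<subseteq> K" using top_space(4)[OF c K t] w by blast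
  moreover have "\<phi> *\<^sub>v v \<in> top_space c" using top_space(3)[OF c t] w(2) by blast
  hence "\<phi> *\<^sub>v u \<in> top_space c" if "u \<in> carrier_vec e" for u
    using irreducible_vimage[OF G irr \<pi> \<Theta>_rep[OF c] \<phi>(1) top_space(1,2)[OF c] vc v(2) _ that] by blast
  hence "K \<subseteq> top_space c" by (auto simp: K_def)
  ultimately have "top_embedding c \<pi> \<phi>"
    unfolding top_embedding_def is_rep_degree[OF \<pi>] using irr \<phi>(1) inj by (auto simp: K_def)
  thus ?thesis by (auto simp: eta_def)
qed

text \<open>Guarantees that every constituent has a rank at all. The functional \<open>l\<close>
  evaluates the associated function at a point \<open>t\<close> where it is non-zero;
  \<open>N\<close> acts on \<open>l\<close> by \<open>\<chi> t\<close>, so projecting to that weight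
  multiplies the value by \<open>card N\<close> and cannot give zero.\<close>

lemma constituent_has_weight:
  assumes c: "c \<in> I" and irr: "irreducible_rep G \<pi>" and \<pi>: "is_rep G e \<pi>"
    and \<phi>: "intertwines G e (dg c) \<pi> (\<Theta> c) \<phi>" "\<phi> \<noteq> 0\<^sub>m (dg c) e"
  obtains t v where "v \<in> weight_space N e \<pi> (\<chi> t)" "v \<noteq> 0\<^sub>v e"
proof -
  have \<phi>c: "\<phi> \<in> carrier_mat (dg c) e" using \<phi> by (simp add: intertwines_def)
  note inj = irreducible_intertwiner_inj[OF G irr \<pi> \<Theta>_rep[OF c] \<phi>]
  define v :: "complex vec" where "v = unit_vec e 0"
  have v: "v \<in> carrier_vec e" "v \<noteq> 0\<^sub>v e" using irreducible_repD(1)[OF G irr \<pi>] by (auto simp: v_def)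
  have "vec_fun c (\<phi> *\<^sub>v v) \<noteq> (\<lambda>y. 0)"
    using vec_fun_eq_zero[OF c, of "\<phi> *\<^sub>v v"] inj[OF v(1)] v \<phi>c by auto
  then obtain t where t: "vec_fun c (\<phi> *\<^sub>v v) t \<noteq> 0" by (auto simp: fun_eq_iff)
  define l where "l x = vec_fun c (\<phi> *\<^sub>v x) t" for x
  let ?P = "rep_alg N e \<pi> (\<lambda>a. cnj (\<chi> t a))"
  have "l (?P *\<^sub>v v) = (\<Sum>a\<in>N. cnj (\<chi> t a) * l (\<pi> a *\<^sub>v v))"
    by (rule linear_functional_rep_alg[OF finN is_repD(1)[OF \<pi> N_carrier] v(1)])
      (use \<phi>c in \<open>auto simp: l_def mult_add_distrib_mat_vec[of _ "dg c" e] mult_mat_vec[of _ "dg c" e] vec_fun_add vec_fun_smult\<close>)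
  also have "\<dots> = (\<Sum>a\<in>N. l v)"
  proof (rule sum.cong[OF refl])
    fix a assume a: "a \<in> N"
    have "l (\<pi> a *\<^sub>v v) = \<chi> t a * l v"
      using intertwines_vec[OF \<pi> \<Theta>_rep[OF c] \<phi>(1) N_carrier[OF a] v(1)]
        vec_fun_equivariant[OF c _ N_carrier[OF a], of "\<phi> *\<^sub>v v"] \<omega>_N[OF a] \<phi>c v(1) by (simp add: l_def)
    moreover have "\<chi> t a * cnj (\<chi> t a) = 1" using char[of t] a by (simp add: unitary_char_def)
    ultimately show "cnj (\<chi> t a) * l (\<pi> a *\<^sub>v v) = l v" by (metis mult.assoc mult.commute mult_1)
  qed
  also have "\<dots> = of_nat (card N) * l v" by simp
  also have "\<dots> \<noteq> 0" using t finN subgroup.one_closed[OF N] by (auto simp: l_def)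
  finally have nz: "l (?P *\<^sub>v v) \<noteq> 0" .
  have "?P *\<^sub>v v \<noteq> 0\<^sub>v e"
  proof
    assume z: "?P *\<^sub>v v = 0\<^sub>v e"
    have "\<phi> *\<^sub>v 0\<^sub>v e = 0 \<cdot>\<^sub>v 0\<^sub>v (dg c)" using \<phi>c by (intro eq_vecI) auto
    hence "l (?P *\<^sub>v v) = 0" unfolding z l_def using vec_fun_smult[of "0\<^sub>v (dg c)" c 0] by simp
    with nz show False ..
  qed
  thus thesis using that rep_alg_weight_space[OF G \<pi> N finN char v(1)] by blast
qed

lemma constituent_weight:
  assumes c: "c \<in> I" and irr: "irreducible_rep G \<pi>" and \<pi>: "is_rep G e \<pi>"
    and \<phi>: "intertwines G e (dg c) \<pi> (\<Theta> c) \<phi>" "\<phi> \<noteq> 0\<^sub>m (dg c) e"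
    and v: "v \<in> weight_space N e \<pi> \<xi>" "v \<noteq> 0\<^sub>v e"
  obtains t where "\<And>a. a \<in> N \<Longrightarrow> \<chi> t a = \<xi> a"
proof -
  have \<phi>c: "\<phi> \<in> carrier_mat (dg c) e" using \<phi> by (simp add: intertwines_def)
  have vc: "v \<in> carrier_vec e" using v by (simp add: weight_space_def)
  have "\<phi> *\<^sub>v v \<noteq> 0\<^sub>v (dg c)" using irreducible_intertwiner_inj[OF G irr \<pi> \<Theta>_rep[OF c] \<phi> vc] v(2) by blast
  hence "vec_fun c (\<phi> *\<^sub>v v) \<noteq> (\<lambda>y. 0)" using vec_fun_eq_zero[OF c, of "\<phi> *\<^sub>v v"] \<phi>c vc by auto
  then obtain t where "vec_fun c (\<phi> *\<^sub>v v) t \<noteq> 0" by (auto simp: fun_eq_iff)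
  thus thesis using that weight_supported[OF c weight_preserved[OF c \<pi> \<phi>(1) v(1)]] by blast
qed

text \<open>A common \<pi> has one weight space with two parametrisations, by the dual of
  \<open>\<tau> c\<close> and by the dual of \<open>\<tau> c'\<close>. The transition matrix
  \<open>B\<close> commutes with the transposes, so its transpose is a non-zero intertwiner.\<close>

lemma eta_inj:
  assumes c: "c \<in> I" and c': "c' \<in> I" and eq: "eta c = eta c'"
  shows "c = c'"
proof -
  obtain \<pi> J where J: "top_embedding c \<pi> J" using eta_exists[OF c] .
  then obtain J' where J': "top_embedding c' \<pi> J'" using eq by (auto simp: eta_def)
  note D = top_embeddingD[OF J] and D' = top_embeddingD[OF J']
  let ?e = "rep_degree G \<pi>"
  obtain A where A: "A \<in> carrier_mat ?e (dh c)"
    "\<And>u. u \<in> carrier_vec (dh c) \<Longrightarrow> J *\<^sub>v (A *\<^sub>v u) = delta_mat base c *\<^sub>v u"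
    "\<And>u. u \<in> carrier_vec (dh c) \<Longrightarrow> A *\<^sub>v u = 0\<^sub>v ?e \<Longrightarrow> u = 0\<^sub>v (dh c)"
    "(\<lambda>u. A *\<^sub>v u) ` carrier_vec (dh c) = weight_space N ?e \<pi> (\<chi> base)"
    using embedded_weight_space[OF c base_S J] by metis
  obtain A' where A': "A' \<in> carrier_mat ?e (dh c')"
    "\<And>u. u \<in> carrier_vec (dh c') \<Longrightarrow> J' *\<^sub>v (A' *\<^sub>v u) = delta_mat base c' *\<^sub>v u"
    "\<And>u. u \<in> carrier_vec (dh c') \<Longrightarrow> A' *\<^sub>v u = 0\<^sub>v ?e \<Longrightarrow> u = 0\<^sub>v (dh c')"
    "(\<lambda>u. A' *\<^sub>v u) ` carrier_vec (dh c') = weight_space N ?e \<pi> (\<chi> base)"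
    using embedded_weight_space[OF c' base_S J'] by metis
  obtain L where L: "L \<in> carrier_mat (dh c) ?e" "\<And>v. v \<in> carrier_vec (dh c) \<Longrightarrow> L *\<^sub>v (A *\<^sub>v v) = v"
    using inj_mat_left_inverse[OF A(1,3)] by metis
  define B where "B = L * A'"
  have B: "B \<in> carrier_mat (dh c) (dh c')" using L A' by (simp add: B_def)
  have AB: "A *\<^sub>v (B *\<^sub>v u) = A' *\<^sub>v u" if u: "u \<in> carrier_vec (dh c')" for u
  proof -
    obtain w where w: "w \<in> carrier_vec (dh c)" "A' *\<^sub>v u = A *\<^sub>v w" using A(4) A'(4) u by blast
    have "B *\<^sub>v u = L *\<^sub>v (A' *\<^sub>v u)" unfolding B_def by (rule assoc_mult_mat_vec[OF L(1) A'(1) u])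
    thus ?thesis using w L(2) by simp
  qed
  have comm: "B *\<^sub>v (transpose_mat (\<tau> c' h) *\<^sub>v u) = transpose_mat (\<tau> c h) *\<^sub>v (B *\<^sub>v u)"
    if h: "h \<in> carrier H" and u: "u \<in> carrier_vec (dh c')" for h u
  proof -
    \<comment> \<open>A single pair \<open>g\<close>, \<open>\<epsilon>\<close> is fixed for both
      \<open>c\<close> and \<open>c'\<close>; both parametrisations then acquire the same scalar,
      which can be cancelled.\<close>
    obtain g \<epsilon> where g: "g \<in> carrier G" "\<epsilon> \<noteq> 0"
      "\<And>c v. c \<in> I \<Longrightarrow> v \<in> carrier_vec (dh c) \<Longrightarrow>
       \<Theta> c g *\<^sub>v (delta_mat base c *\<^sub>v v) = \<epsilon> \<cdot>\<^sub>v (delta_mat base c *\<^sub>v (transpose_mat (\<tau> c h) *\<^sub>v v))"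
      using delta_mat_swap[OF base_S h] by metis
    have tw: "\<pi> g *\<^sub>v (A *\<^sub>v v) = \<epsilon> \<cdot>\<^sub>v (A *\<^sub>v (transpose_mat (\<tau> c h) *\<^sub>v v))"
      if c: "c \<in> I" and J: "top_embedding c \<pi> J" and A: "A \<in> carrier_mat ?e (dh c)"
        "\<And>u. u \<in> carrier_vec (dh c) \<Longrightarrow> J *\<^sub>v (A *\<^sub>v u) = delta_mat base c *\<^sub>v u" and v: "v \<in> carrier_vec (dh c)" for c J A v
    proof -
      note D = top_embeddingD[OF J]
      have \<tau>v: "transpose_mat (\<tau> c h) *\<^sub>v v \<in> carrier_vec (dh c)"
        using \<tau>_transpose_carrier[OF c h] v by (rule mult_mat_vec_carrier)
      have Av: "A *\<^sub>v v \<in> carrier_vec ?e" "A *\<^sub>v (transpose_mat (\<tau> c h) *\<^sub>v v) \<in> carrier_vec ?e" using A(1) v \<tau>v by auto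
      have "J *\<^sub>v (\<pi> g *\<^sub>v (A *\<^sub>v v)) = \<Theta> c g *\<^sub>v (delta_mat base c *\<^sub>v v)"
        using intertwines_vec[OF D(2) \<Theta>_rep[OF c] D(3) g(1) Av(1)] A(2)[OF v] by simp
      also have "\<dots> = J *\<^sub>v (\<epsilon> \<cdot>\<^sub>v (A *\<^sub>v (transpose_mat (\<tau> c h) *\<^sub>v v)))"
        using g(3)[OF c v] A(2)[OF \<tau>v] mult_mat_vec[OF D(4) Av(2)] by simp
      finally show ?thesis
        using inj_mat_cancel[OF D(4,5) is_rep_vec[OF D(2) g(1) Av(1)]] Av(2) by simp
    qed
    have \<tau>u: "transpose_mat (\<tau> c' h) *\<^sub>v u \<in> carrier_vec (dh c')"
      using \<tau>_transpose_carrier[OF c' h] u by (rule mult_mat_vec_carrier)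
    have Bu: "B *\<^sub>v u \<in> carrier_vec (dh c)" "B *\<^sub>v (transpose_mat (\<tau> c' h) *\<^sub>v u) \<in> carrier_vec (dh c)" using B u \<tau>u by auto
    have \<tau>Bu: "transpose_mat (\<tau> c h) *\<^sub>v (B *\<^sub>v u) \<in> carrier_vec (dh c)"
      using \<tau>_transpose_carrier[OF c h] Bu(1) by (rule mult_mat_vec_carrier)
    have "\<epsilon> \<cdot>\<^sub>v (A *\<^sub>v (B *\<^sub>v (transpose_mat (\<tau> c' h) *\<^sub>v u))) = \<pi> g *\<^sub>v (A' *\<^sub>v u)"
      using tw[OF c' J' A'(1,2) u] AB[OF \<tau>u] by simp
    also have "\<dots> = \<epsilon> \<cdot>\<^sub>v (A *\<^sub>v (transpose_mat (\<tau> c h) *\<^sub>v (B *\<^sub>v u)))"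
      using tw[OF c J A(1,2) Bu(1)] AB[OF u] by simp
    finally have "(1 / \<epsilon>) \<cdot>\<^sub>v (\<epsilon> \<cdot>\<^sub>v (A *\<^sub>v (B *\<^sub>v (transpose_mat (\<tau> c' h) *\<^sub>v u)))) =
        (1 / \<epsilon>) \<cdot>\<^sub>v (\<epsilon> \<cdot>\<^sub>v (A *\<^sub>v (transpose_mat (\<tau> c h) *\<^sub>v (B *\<^sub>v u))))" by simp
    hence "A *\<^sub>v (B *\<^sub>v (transpose_mat (\<tau> c' h) *\<^sub>v u)) = A *\<^sub>v (transpose_mat (\<tau> c h) *\<^sub>v (B *\<^sub>v u))"
      using g(2) by (simp add: smult_smult_assoc)
    thus ?thesis using inj_mat_cancel[OF A(1,3) Bu(2) \<tau>Bu] by blast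
  qed
  let ?BT = "transpose_mat B"
  have int: "intertwines H (dh c) (dh c') (\<tau> c) (\<tau> c') ?BT" unfolding intertwines_def
  proof (intro conjI ballI)
    show "?BT \<in> carrier_mat (dh c') (dh c)" using B by simp
    fix h assume h: "h \<in> carrier H"
    have \<tau>c: "\<tau> c h \<in> carrier_mat (dh c) (dh c)" "\<tau> c' h \<in> carrier_mat (dh c') (dh c')"
      using is_repD(1)[OF \<tau>_rep[OF c] h] is_repD(1)[OF \<tau>_rep[OF c'] h] .
    have "B * transpose_mat (\<tau> c' h) = transpose_mat (\<tau> c h) * B"
    proof (rule eq_mat_vecI)
      fix u :: "complex vec" assume u: "u \<in> carrier_vec (dh c')"
      show "(B * transpose_mat (\<tau> c' h)) *\<^sub>v u = (transpose_mat (\<tau> c h) * B) *\<^sub>v u"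
        using comm[OF h u] assoc_mult_mat_vec[OF B \<tau>_transpose_carrier[OF c' h] u]
          assoc_mult_mat_vec[OF \<tau>_transpose_carrier[OF c h] B u] by simp
    qed (use B \<tau>c in auto)
    hence "transpose_mat (B * transpose_mat (\<tau> c' h)) = transpose_mat (transpose_mat (\<tau> c h) * B)" by simp
    moreover have "transpose_mat (B * transpose_mat (\<tau> c' h)) = \<tau> c' h * ?BT" using B \<tau>c by (subst transpose_mult) auto
    moreover have "transpose_mat (transpose_mat (\<tau> c h) * B) = ?BT * \<tau> c h" using B \<tau>c by (subst transpose_mult) auto
    ultimately show "?BT * \<tau> c h = \<tau> c' h * ?BT" by simp
  qed
  have "?BT \<noteq> 0\<^sub>m (dh c') (dh c)"
  proof
    assume "?BT = 0\<^sub>m (dh c') (dh c)"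
    hence B0: "B = 0\<^sub>m (dh c) (dh c')" by (metis transpose_transpose zero_transpose_mat)
    let ?u = "unit_vec (dh c') 0 :: complex vec"
    have "A' *\<^sub>v ?u = A *\<^sub>v (B *\<^sub>v ?u)" using AB[of ?u] by simp
    also have "B *\<^sub>v ?u = 0\<^sub>v (dh c)" unfolding B0 by (intro eq_vecI) auto
    also have "A *\<^sub>v 0\<^sub>v (dh c) = 0\<^sub>v ?e" using A(1) by (intro eq_vecI) auto
    finally have "?u = 0\<^sub>v (dh c')" using A'(3)[of ?u] by simp
    thus False using dh_pos[OF c'] by simp
  qed
  from schur_equivalent[OF H \<tau>_irr[OF c] \<tau>_irr[OF c'] \<tau>_rep[OF c] \<tau>_rep[OF c'] int this]
  show ?thesis using Irr_equivalent_eq[OF H c c' class_rep_in[OF H c] class_rep_in[OF H c']] by blast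
qed

end

section \<open>Linear algebra over a finite field\<close>

abbreviation lin where "lin \<equiv> Vector_Spaces.linear"

lemma linD:
  assumes "lin s1 s2 f"
  shows "f (x + y) = f x + f y" "f (s1 c x) = s2 c (f x)" "f 0 = 0" "f (- x) = - f x" "f (x - y) = f x - f y"
    "f (sum g A) = (\<Sum>a\<in>A. f (g a))" "vector_space s1" "vector_space s2"
proof -
  interpret vector_space_pair s1 s2 using assms by (auto simp: Vector_Spaces.linear_iff vector_space_pair_def)
  show "f (x + y) = f x + f y" "f (s1 c x) = s2 c (f x)" "f 0 = 0" "f (- x) = - f x" "f (x - y) = f x - f y"
    "f (sum g A) = (\<Sum>a\<in>A. f (g a))"
    using linear_add[OF assms] linear_scale[OF assms] linear_0[OF assms] linear_neg[OF assms]
      linear_diff[OF assms] linear_sum[OF assms] by auto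
  show "vector_space s1" "vector_space s2" using assms by (auto simp: Vector_Spaces.linear_iff)
qed

lemma linI:
  "vector_space s1 \<Longrightarrow> vector_space s2 \<Longrightarrow> (\<And>x y. f (x + y) = f x + f y) \<Longrightarrow> (\<And>c x. f (s1 c x) = s2 c (f x)) \<Longrightarrow> lin s1 s2 f"
  by (simp add: Vector_Spaces.linear_iff)

lemma lin_comp: "lin s1 s2 f \<Longrightarrow> lin s2 s3 g \<Longrightarrow> lin s1 s3 (\<lambda>x. g (f x))"
  by (auto simp: Vector_Spaces.linear_iff)

lemma lin_id: "vector_space s \<Longrightarrow> lin s s (\<lambda>x. x)"
  by (simp add: Vector_Spaces.linear_iff)

lemma bilinear_mapD:
  assumes "bilinear_map s1 s2 s3 t"
  shows "lin s2 s3 (t v)" "lin s1 s3 (\<lambda>v. t v u)"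
  using assms by (auto simp: bilinear_map_def)

lemma bilinear_mapI: "(\<And>v. lin s2 s3 (t v)) \<Longrightarrow> (\<And>u. lin s1 s3 (\<lambda>v. t v u)) \<Longrightarrow> bilinear_map s1 s2 s3 t"
  by (auto simp: bilinear_map_def)

lemma vector_space_finite_basis:
  fixes s :: "'f::field \<Rightarrow> 'a::{ab_group_add, finite} \<Rightarrow> 'a"
  assumes "vector_space s"
  obtains B where "finite_dimensional_vector_space s B"
proof -
  interpret vector_space s by fact
  obtain B where "independent B" "UNIV \<subseteq> span B" using maximal_independent_subset[of UNIV] by blast
  hence "finite_dimensional_vector_space s B" by unfold_locales auto
  thus thesis by (rule that)
qed

definition coord :: "('f::field \<Rightarrow> 'a::ab_group_add \<Rightarrow> 'a) \<Rightarrow> 'a set \<Rightarrow> 'a \<Rightarrow> 'a \<Rightarrow> 'f" where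
  "coord s B b v = Modules.module.representation s B v b"

lemma coord:
  assumes "finite_dimensional_vector_space s B"
  shows coord_lin: "lin s (*) (coord s B b)"
    and coord_sum: "(\<Sum>b\<in>B. s (coord s B b v) b) = v"
    and coord_basis: "b' \<in> B \<Longrightarrow> coord s B b b' = (if b = b' then 1 else 0)"
    and coord_unique: "b \<in> B \<Longrightarrow> coord s B b (\<Sum>b\<in>B. s (f b) b) = f b"
proof -
  interpret finite_dimensional_vector_space s B by fact
  show l: "lin s (*) (coord s B b)" for b
    using linear_representation[OF independent_Basis span_Basis] by (simp add: coord_def[abs_def])
  show "(\<Sum>b\<in>B. s (coord s B b v) b) = v"
    unfolding coord_def by (rule sum_representation_eq) (auto simp: independent_Basis span_Basis finite_Basis)
  show 1: "coord s B b b' = (if b = b' then 1 else 0)" if "b' \<in> B" for b b'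
    using representation_basis[OF independent_Basis that] by (simp add: coord_def)
  assume b: "b \<in> B"
  have "coord s B b (\<Sum>b\<in>B. s (f b) b) = (\<Sum>b'\<in>B. f b' * coord s B b b')"
    by (simp add: linD(6)[OF l] linD(2)[OF l])
  also have "\<dots> = (\<Sum>b'\<in>B. if b = b' then f b' else 0)" by (intro sum.cong) (auto simp: 1)
  finally show "coord s B b (\<Sum>b\<in>B. s (f b) b) = f b" using b finite_Basis by simp
qed

lemma lin_sum_coord:
  assumes B: "finite_dimensional_vector_space s4 B" and l: "\<And>b. b \<in> B \<Longrightarrow> lin s3 (*) (l b)"
    and v3: "vector_space s3"
  shows "lin s3 s4 (\<lambda>w. \<Sum>b\<in>B. s4 (l b w) b)"
proof -
  interpret finite_dimensional_vector_space s4 B by fact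
  show ?thesis
    by (rule linI[OF v3 vector_space_axioms])
      (simp_all add: linD(1,2)[OF l] scale_left_distrib sum.distrib scale_sum_right)
qed

text \<open>The universal property speaks only of scalar-valued maps, so uniqueness, and likewise
  existence in \<open>tensor_lift\<close>, is obtained coordinate by coordinate in a basis of the
  target.\<close>

lemma tensor_ext:
  fixes s4 :: "'f::field \<Rightarrow> 'd::{ab_group_add, finite} \<Rightarrow> 'd"
  assumes t: "is_tensor_product s1 s2 s3 t" and l: "lin s3 s4 l" "lin s3 s4 l'"
    and eq: "\<And>v u. l (t v u) = l' (t v u)"
  shows "l w = l' w"
proof -
  obtain B where B: "finite_dimensional_vector_space s4 B" using vector_space_finite_basis linD(8)[OF l(1)] by blast
  have bt: "bilinear_map s1 s2 s3 t" using t by (simp add: is_tensor_product_def)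
  have c: "coord s4 B b (l w) = coord s4 B b (l' w)" for b
  proof -
    have 1: "lin s3 (*) (\<lambda>w. coord s4 B b (l w))" "lin s3 (*) (\<lambda>w. coord s4 B b (l' w))"
      by (rule lin_comp[OF l(1) coord_lin[OF B]], rule lin_comp[OF l(2) coord_lin[OF B]])
    have "bilinear_map s1 s2 (*) (\<lambda>v u. coord s4 B b (l (t v u)))"
      by (intro bilinear_mapI lin_comp[OF bilinear_mapD(1)[OF bt] 1(1)] lin_comp[OF bilinear_mapD(2)[OF bt] 1(1)])
    hence "\<exists>!m. lin s3 (*) m \<and> (\<forall>v u. m (t v u) = coord s4 B b (l (t v u)))"
      using t by (simp add: is_tensor_product_def)
    hence "(\<lambda>w. coord s4 B b (l w)) = (\<lambda>w. coord s4 B b (l' w))" using 1 eq by auto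
    thus ?thesis by (rule fun_cong)
  qed
  have "l w = (\<Sum>b\<in>B. s4 (coord s4 B b (l w)) b)" by (rule coord_sum[OF B, symmetric])
  also have "\<dots> = l' w" unfolding c by (rule coord_sum[OF B])
  finally show ?thesis .
qed

lemma tensor_lift:
  fixes s4 :: "'f::field \<Rightarrow> 'd::{ab_group_add, finite} \<Rightarrow> 'd"
  assumes t: "is_tensor_product s1 s2 s3 t" and b: "bilinear_map s1 s2 s4 b"
  obtains l where "lin s3 s4 l" "\<And>v u. l (t v u) = b v u"
proof -
  have v4: "vector_space s4" using linD(8)[OF bilinear_mapD(1)[OF b]] .
  obtain B where B: "finite_dimensional_vector_space s4 B" using vector_space_finite_basis v4 by blast
  have "\<exists>l. lin s3 (*) l \<and> (\<forall>v u. l (t v u) = coord s4 B z (b v u))" for z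
  proof -
    have "bilinear_map s1 s2 (*) (\<lambda>v u. coord s4 B z (b v u))"
      by (intro bilinear_mapI lin_comp[OF bilinear_mapD(1)[OF b] coord_lin[OF B]] lin_comp[OF bilinear_mapD(2)[OF b] coord_lin[OF B]])
    hence "\<exists>!l. lin s3 (*) l \<and> (\<forall>v u. l (t v u) = coord s4 B z (b v u))"
      using t by (simp add: is_tensor_product_def)
    thus ?thesis by (rule ex1_implies_ex)
  qed
  then obtain l where l: "\<And>z. lin s3 (*) (l z)" "\<And>z v u. l z (t v u) = coord s4 B z (b v u)" by metis
  show thesis
  proof (rule that)
    show "lin s3 s4 (\<lambda>w. \<Sum>z\<in>B. s4 (l z w) z)"
      by (rule lin_sum_coord[OF B l(1) linD(7)[OF l(1)]])
    show "(\<Sum>z\<in>B. s4 (l z (t v u)) z) = b v u" for v u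
      unfolding l(2) by (rule coord_sum[OF B])
  qed
qed

lemma perfect_pairing_swap:
  "perfect_pairing sX sY p \<Longrightarrow> perfect_pairing sY sX (\<lambda>y x. p x y)"
  by (auto simp: perfect_pairing_def bilinear_map_def)

text \<open>Collecting the values \<open>p b y\<close> on a basis of \<open>X\<close> gives a linear
  map from \<open>Y\<close> to \<open>X\<close>. Non-degeneracy makes it injective, and equal
  dimensions make it surjective, so any prescribed values on the basis are attained.\<close>

lemma perfect_pairing_represents:
  fixes sX :: "'f::field \<Rightarrow> 'x::{ab_group_add, finite} \<Rightarrow> 'x" and sY :: "'f \<Rightarrow> 'y::{ab_group_add, finite} \<Rightarrow> 'y"
  assumes p: "perfect_pairing sX sY p" and dim: "vector_space.dim sX UNIV = vector_space.dim sY UNIV"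
    and f: "lin sX (*) f"
  obtains y where "\<And>x. f x = p x y"
proof -
  have bp: "bilinear_map sX sY (*) p" using p by (simp add: perfect_pairing_def)
  obtain B where B: "finite_dimensional_vector_space sX B" using vector_space_finite_basis linD(7)[OF f] by blast
  obtain B' where B': "finite_dimensional_vector_space sY B'"
    using vector_space_finite_basis linD(7)[OF bilinear_mapD(1)[OF bp]] by blast
  interpret X: finite_dimensional_vector_space sX B by (rule B)
  interpret Y: finite_dimensional_vector_space sY B' by (rule B')
  interpret YX: finite_dimensional_vector_space_pair sY B' sX B ..
  have expand: "h x = (\<Sum>b\<in>B. coord sX B b x * h b)" if "lin sX (*) h" for h x
    using arg_cong[OF coord_sum[OF B, of x], of h] by (simp add: linD(6)[OF that] linD(2)[OF that])
  define T where "T y = (\<Sum>b\<in>B. sX (p b y) b)" for y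
  have lT: "lin sY sX T" unfolding T_def
    by (rule lin_sum_coord[OF B bilinear_mapD(1)[OF bp] Y.vector_space_axioms])
  have "inj T"
  proof (rule injI)
    fix y y' assume eq: "T y = T y'"
    have "p b y = p b y'" if "b \<in> B" for b
      using coord_unique[OF B that, of "\<lambda>b. p b y"] coord_unique[OF B that, of "\<lambda>b. p b y'"] eq by (simp add: T_def)
    hence "p x y = p x y'" for x
      using expand[OF bilinear_mapD(2)[OF bp], of x y] expand[OF bilinear_mapD(2)[OF bp], of x y'] by simp
    hence "p x (y - y') = 0" for x by (simp add: linD(5)[OF bilinear_mapD(1)[OF bp]])
    hence "y - y' = 0" using p unfolding perfect_pairing_def by blast
    thus "y = y'" by simp
  qed
  hence "surj T"
    using YX.linear_injective_imp_surjective[OF lT] dim Y.dim_UNIV X.dim_UNIV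
    by (simp add: X.dimension_def Y.dimension_def)
  then obtain y where y: "T y = (\<Sum>b\<in>B. sX (f b) b)" by (metis surjD)
  have "f b = p b y" if "b \<in> B" for b
    using coord_unique[OF B that, of "\<lambda>b. p b y"] coord_unique[OF B that, of f] y by (simp add: T_def)
  hence "f x = p x y" for x
    using expand[OF f, of x] expand[OF bilinear_mapD(2)[OF bp], of x y] by simp
  thus thesis by (rule that)
qed

lemma basis_list_props:
  fixes s :: "'f::field \<Rightarrow> 'a::{ab_group_add, finite} \<Rightarrow> 'a"
  assumes "vector_space s"
  shows "distinct (basis_list s)" "finite_dimensional_vector_space s (set (basis_list s))"
proof -
  obtain B where "finite_dimensional_vector_space s B" using vector_space_finite_basis assms by blast
  then interpret finite_dimensional_vector_space s B .
  obtain bs where "set bs = B" "distinct bs" using finite_distinct_list[OF finite_Basis] by blast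
  hence "\<exists>bs. distinct bs \<and> independent (set bs) \<and> span (set bs) = UNIV"
    using independent_Basis span_Basis by blast
  from someI_ex[OF this, folded basis_list_def]
  show "distinct (basis_list s)" "finite_dimensional_vector_space s (set (basis_list s))"
    by (auto simp: finite_dimensional_vector_space_def finite_dimensional_vector_space_axioms_def vector_space_axioms)
qed

lemma lin_trace_eq:
  fixes s :: "'f::field \<Rightarrow> 'a::{ab_group_add, finite} \<Rightarrow> 'a"
  assumes s: "vector_space s"
  shows "lin_trace s L = (\<Sum>c\<in>set (basis_list s). coord s (set (basis_list s)) c (L c))"
proof -
  let ?bs = "basis_list s"
  have "lin_trace s L = (\<Sum>i<length ?bs. coord s (set ?bs) (?bs ! i) (L (?bs ! i)))"
    by (simp add: lin_trace_def lin_matrix_def Let_def diag_mat_def coord_def sum_list_sum_nth atLeast0LessThan)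
  also have "\<dots> = (\<Sum>c\<in>set ?bs. coord s (set ?bs) c (L c))"
    using basis_list_props(1)[OF s] by (intro sum.reindex_bij_betw bij_betw_nth) auto
  finally show ?thesis .
qed

text \<open>Expanding each \<open>w i\<close> in the chosen basis gives a value that mentions no
  basis; this is how all traces below are evaluated.\<close>

lemma lin_trace_finite_rank:
  fixes s :: "'f::field \<Rightarrow> 'a::{ab_group_add, finite} \<Rightarrow> 'a"
  assumes s: "vector_space s" and l: "\<And>i. i \<in> K \<Longrightarrow> lin s (*) (l i)"
  shows "lin_trace s (\<lambda>y. \<Sum>i\<in>K. s (l i y) (w i)) = (\<Sum>i\<in>K. l i (w i))"
proof -
  let ?B = "set (basis_list s)"
  note B = basis_list_props(2)[OF s]
  have "lin_trace s (\<lambda>y. \<Sum>i\<in>K. s (l i y) (w i)) = (\<Sum>c\<in>?B. \<Sum>i\<in>K. l i c * coord s ?B c (w i))"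
    by (simp add: lin_trace_eq[OF s] linD(6)[OF coord_lin[OF B]] linD(2)[OF coord_lin[OF B]])
  also have "\<dots> = (\<Sum>i\<in>K. \<Sum>c\<in>?B. l i c * coord s ?B c (w i))" by (rule sum.swap)
  also have "\<dots> = (\<Sum>i\<in>K. l i (w i))"
  proof (rule sum.cong[OF refl])
    fix i assume i: "i \<in> K"
    have "l i (w i) = l i (\<Sum>c\<in>?B. s (coord s ?B c (w i)) c)" by (simp add: coord_sum[OF B])
    also have "\<dots> = (\<Sum>c\<in>?B. l i c * coord s ?B c (w i))"
      by (simp add: linD(6)[OF l[OF i]] linD(2)[OF l[OF i]] mult.commute)
    finally show "(\<Sum>c\<in>?B. l i c * coord s ?B c (w i)) = l i (w i)" by simp
  qed
  finally show ?thesis .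
qed

text \<open>Composition becomes the matrix product in the chosen basis, so the determinants multiply
  to 1. This keeps the quadratic character of an automorphism away from its value 0.\<close>

lemma lin_det_nonzero:
  fixes s :: "'f::field \<Rightarrow> 'a::{ab_group_add, finite} \<Rightarrow> 'a"
  assumes D: "lin s s D" and D': "lin s s D'" and inv: "\<And>v. D (D' v) = v"
  shows "lin_det s D \<noteq> 0"
proof -
  note s = linD(7)[OF D]
  let ?bs = "basis_list s"
  let ?B = "set ?bs" and ?m = "length ?bs"
  note B = basis_list_props(2)[OF s] and dist = basis_list_props(1)[OF s]
  have lm: "lin_matrix s L = mat ?m ?m (\<lambda>(i,j). coord s ?B (?bs ! i) (L (?bs ! j)))" for L
    by (simp add: lin_matrix_def Let_def coord_def)
  have "lin_matrix s D * lin_matrix s D' = 1\<^sub>m ?m"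
  proof (rule eq_matI)
    fix i j assume "i < dim_row (1\<^sub>m ?m :: 'f mat)" "j < dim_col (1\<^sub>m ?m :: 'f mat)"
    hence i: "i < ?m" and j: "j < ?m" by auto
    have "(lin_matrix s D * lin_matrix s D') $$ (i,j) =
        (\<Sum>l<?m. coord s ?B (?bs ! i) (D (?bs ! l)) * coord s ?B (?bs ! l) (D' (?bs ! j)))"
      using i j by (auto simp: lm scalar_prod_def atLeast0LessThan intro!: sum.cong)
    also have "\<dots> = (\<Sum>c\<in>?B. coord s ?B (?bs ! i) (D c) * coord s ?B c (D' (?bs ! j)))"
      using dist by (intro sum.reindex_bij_betw bij_betw_nth) auto
    also have "\<dots> = coord s ?B (?bs ! i) (D (\<Sum>c\<in>?B. s (coord s ?B c (D' (?bs ! j))) c))"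
      by (simp add: linD(6)[OF D] linD(2)[OF D] linD(6)[OF coord_lin[OF B]] linD(2)[OF coord_lin[OF B]] mult.commute)
    also have "\<dots> = coord s ?B (?bs ! i) (?bs ! j)" by (simp add: coord_sum[OF B] inv)
    also have "\<dots> = 1\<^sub>m ?m $$ (i,j)" using i j dist by (simp add: coord_basis[OF B] nth_eq_iff_index_eq)
    finally show "(lin_matrix s D * lin_matrix s D') $$ (i,j) = 1\<^sub>m ?m $$ (i,j)" .
  qed (auto simp: lm)
  hence "Determinant.det (lin_matrix s D) * Determinant.det (lin_matrix s D') = 1"
    using det_mult[of "lin_matrix s D" ?m "lin_matrix s D'"] by (auto simp: lm)
  thus ?thesis by (auto simp: lin_det_def)
qed

lemma isometry_group_simps:
  "\<one>\<^bsub>isometry_group s b\<^esub> = id" "g \<otimes>\<^bsub>isometry_group s b\<^esub> h = g \<circ> h"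
  "g \<in> carrier (isometry_group s b) \<longleftrightarrow> lin s s g \<and> bij g \<and> (\<forall>v w. b (g v) (g w) = b v w)"
  by (auto simp: isometry_group_def)

lemma lin_inv:
  assumes l: "lin s s' g" and bij: "bij g"
  shows "lin s' s (inv_into UNIV g)"
proof (rule linI[OF linD(8,7)[OF l]])
  have g: "g (inv_into UNIV g x) = x" for x using bij by (simp add: bij_is_surj surj_f_inv_f)
  have i: "inv_into UNIV g (g x) = x" for x using bij by (simp add: bij_is_inj)
  show "inv_into UNIV g (x + y) = inv_into UNIV g x + inv_into UNIV g y" for x y
    using i[of "inv_into UNIV g x + inv_into UNIV g y"] by (simp add: linD(1)[OF l] g)
  show "inv_into UNIV g (s' c x) = s c (inv_into UNIV g x)" for c x
    using i[of "s c (inv_into UNIV g x)"] by (simp add: linD(2)[OF l] g)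
qed

lemma group_isometry_group:
  assumes s: "vector_space s"
  shows "group (isometry_group s b)"
proof (rule groupI)
  let ?G = "isometry_group s b"
  show "g \<otimes>\<^bsub>?G\<^esub> h \<in> carrier ?G" if "g \<in> carrier ?G" "h \<in> carrier ?G" for g h
    using that by (auto simp: isometry_group_simps Vector_Spaces.linear_iff bij_comp)
  show "\<one>\<^bsub>?G\<^esub> \<in> carrier ?G" using s by (auto simp: isometry_group_simps Vector_Spaces.linear_iff)
  show "\<exists>h\<in>carrier ?G. h \<otimes>\<^bsub>?G\<^esub> g = \<one>\<^bsub>?G\<^esub>" if g: "g \<in> carrier ?G" for g
  proof (rule bexI[of _ "inv_into UNIV g"])
    have bij: "bij g" using g by (simp add: isometry_group_simps)
    have gi: "g (inv_into UNIV g x) = x" for x using bij by (simp add: bij_is_surj surj_f_inv_f)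
    show "inv_into UNIV g \<otimes>\<^bsub>?G\<^esub> g = \<one>\<^bsub>?G\<^esub>" using bij by (auto simp: isometry_group_simps bij_is_inj)
    have "b (inv_into UNIV g v) (inv_into UNIV g w) = b v w" for v w
      using g gi by (metis isometry_group_simps(3))
    thus "inv_into UNIV g \<in> carrier ?G"
      using g lin_inv[of s s g] bij by (simp add: isometry_group_simps bij_imp_bij_inv)
  qed
qed (auto simp: isometry_group_simps)

lemma isometry_groupI:
  fixes s :: "'f::field \<Rightarrow> 'a::{ab_group_add, finite} \<Rightarrow> 'a"
  assumes g: "lin s s g" and b: "\<And>v w. b (g v) (g w) = b v w"
    and nd: "\<And>v. (\<And>w. b v w = 0) \<Longrightarrow> v = 0" and b0: "\<And>w. b 0 w = 0"
  shows "g \<in> carrier (isometry_group s b)"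
proof -
  have "inj g"
  proof (rule injI)
    fix x y assume "g x = g y"
    hence "g (x - y) = 0" by (simp add: linD(5)[OF g])
    hence "b (x - y) w = 0" for w using b[of "x - y" w] b0 by simp
    hence "x - y = 0" by (rule nd)
    thus "x = y" by simp
  qed
  hence "bij g" by (simp add: finite_UNIV_inj_surj bij_def)
  thus ?thesis using g b by (simp add: isometry_group_simps)
qed

text \<open>Adding \<open>a\<close> to itself as often as the characteristic gives 0, so
  \<open>\<psi> a\<close> is a root of unity.\<close>

lemma additive_character_norm:
  fixes \<psi> :: "'f::{field, finite} \<Rightarrow> complex"
  assumes \<psi>: "nontrivial_additive_character \<psi>"
  shows "\<psi> a * cnj (\<psi> a) = 1"
proof -
  have 0: "\<psi> 0 = 1" and add: "\<And>a b. \<psi> (a + b) = \<psi> a * \<psi> b" using \<psi> by (auto simp: nontrivial_additive_character_def)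
  have pow: "\<psi> (of_nat m * a) = \<psi> a ^ m" for m by (induction m) (auto simp: 0 add algebra_simps)
  have "CHAR('f) > 0" by (rule finite_imp_CHAR_pos) simp
  have "\<psi> a ^ CHAR('f) = 1" using pow[of "CHAR('f)"] 0 by simp
  hence "norm (\<psi> a) ^ CHAR('f) = 1 ^ CHAR('f)" by (simp flip: norm_power)
  hence "norm (\<psi> a) = 1" by (rule power_eq_imp_eq_base) (use \<open>CHAR('f) > 0\<close> in auto)
  thus ?thesis using complex_norm_square[of "\<psi> a"] by simp
qed

lemma two_nonzero:
  assumes "odd CARD('f::{field, finite})"
  shows "(2 :: 'f) \<noteq> 0"
proof
  assume "(2 :: 'f) = 0"
  hence "of_nat 2 = (0 :: 'f)" by simp
  hence "CHAR('f) dvd 2" by (simp only: of_nat_eq_0_iff_char_dvd)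
  moreover have "CHAR('f) \<noteq> 1" by simp
  ultimately have "CHAR('f) = 2" by (metis prime_nat_iff two_is_prime_nat)
  moreover have "CHAR('f) dvd CARD('f)" by (rule CHAR_dvd_CARD)
  ultimately show False using assms by simp
qed

section \<open>Tensors as linear maps\<close>

lemma lin_addI: "lin s1 s2 f \<Longrightarrow> lin s1 s2 g \<Longrightarrow> lin s1 s2 (\<lambda>x. f x + g x)"
proof -
  assume f: "lin s1 s2 f" and g: "lin s1 s2 g"
  interpret vector_space s2 using linD(8)[OF f] .
  show ?thesis
    by (rule linI[OF linD(7,8)[OF f]]) (simp_all add: linD(1,2)[OF f] linD(1,2)[OF g] scale_right_distrib)
qed

lemma lin_scaleI: "lin s1 s2 f \<Longrightarrow> lin s1 s2 (\<lambda>x. s2 c (f x))"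
proof -
  assume f: "lin s1 s2 f"
  interpret vector_space s2 using linD(8)[OF f] .
  show ?thesis
    by (rule linI[OF linD(7,8)[OF f]]) (simp_all add: linD(1,2)[OF f] scale_right_distrib mult.commute)
qed

lemma lin_scale_leftI: "lin s1 (*) f \<Longrightarrow> vector_space s2 \<Longrightarrow> lin s1 s2 (\<lambda>x. s2 (f x) v)"
proof -
  assume f: "lin s1 (*) f" and "vector_space s2"
  interpret vector_space s2 by fact
  show ?thesis
    by (rule linI[OF linD(7)[OF f] vector_space_axioms]) (simp_all add: linD(1,2)[OF f] scale_left_distrib)
qed

lemma lin_sumI:
  assumes "vector_space s1" "vector_space s2" "\<And>i. i \<in> K \<Longrightarrow> lin s1 s2 (f i)"
  shows "lin s1 s2 (\<lambda>x. \<Sum>i\<in>K. f i x)"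
proof -
  interpret vector_space s2 by fact
  show ?thesis
    by (rule linI[OF assms(1,2)]) (simp_all add: linD(1,2)[OF assms(3)] sum.distrib scale_sum_right)
qed

lemma lin_const_zero: "vector_space s1 \<Longrightarrow> vector_space s2 \<Longrightarrow> lin s1 s2 (\<lambda>x. 0)"
proof -
  assume "vector_space s1" "vector_space s2"
  then interpret vector_space s2 by simp
  show ?thesis by (rule linI) (use \<open>vector_space s1\<close> vector_space_axioms in auto)
qed

text \<open>Instantiated twice in \<open>dual_pair\<close>: for \<open>Y \<otimes> U\<close> as
  \<open>Hom(X, U)\<close>, and under the prefix \<open>R\<close> with \<open>X\<close> and
  \<open>Y\<close> exchanged, for \<open>X \<otimes> U\<close> as \<open>Hom(Y, U)\<close>.\<close>

locale tensor_pairing =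
  fixes sX :: "'f::{field, finite} \<Rightarrow> 'x::{ab_group_add, finite} \<Rightarrow> 'x"
    and sY :: "'f \<Rightarrow> 'y::{ab_group_add, finite} \<Rightarrow> 'y"
    and sU :: "'f \<Rightarrow> 'u::{ab_group_add, finite} \<Rightarrow> 'u"
    and p :: "'x \<Rightarrow> 'y \<Rightarrow> 'f"
    and sYU :: "'f \<Rightarrow> 'yu::{ab_group_add, finite} \<Rightarrow> 'yu"
    and tY :: "'y \<Rightarrow> 'u \<Rightarrow> 'yu"
    and BU :: "'u set"
  assumes vX: "vector_space sX" and vY: "vector_space sY" and vYU: "vector_space sYU"
    and BU: "finite_dimensional_vector_space sU BU"
    and pairing: "perfect_pairing sX sY p"
    and dims: "vector_space.dim sX UNIV = vector_space.dim sY UNIV"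
    and tensor: "is_tensor_product sY sU sYU tY"
begin

lemma vU: "vector_space sU"
  using BU by (simp add: finite_dimensional_vector_space_def)

lemma p_lin: "lin sY (*) (p x)" "lin sX (*) (\<lambda>x. p x y)"
  using pairing by (auto simp: perfect_pairing_def bilinear_map_def)

lemma p_nondegenerate: "(\<And>x. p x y = 0) \<Longrightarrow> y = 0" "(\<And>y. p x y = 0) \<Longrightarrow> x = 0"
  using pairing unfolding perfect_pairing_def by blast+

lemma p_eqI: "(\<And>x. p x y = p x y') \<Longrightarrow> y = y'"
proof -
  assume "\<And>x. p x y = p x y'"
  hence "y - y' = 0" by (intro p_nondegenerate(1)) (simp add: linD(5)[OF p_lin(1)])
  thus ?thesis by simp
qed

lemma p_eqI': "(\<And>y. p x y = p x' y) \<Longrightarrow> x = x'"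
proof -
  assume "\<And>y. p x y = p x' y"
  hence "x - x' = 0" by (intro p_nondegenerate(2)) (simp add: linD(5)[OF p_lin(2)])
  thus ?thesis by simp
qed

lemma represents: "lin sX (*) f \<Longrightarrow> \<exists>y. \<forall>x. f x = p x y"
  using perfect_pairing_represents[OF pairing dims] by metis

lemma t_lin: "lin sU sYU (tY y)" "lin sY sYU (\<lambda>y. tY y u)"
  using tensor by (auto simp: is_tensor_product_def bilinear_map_def)

text \<open>\<open>hat\<close> realises the isomorphism \<open>Y \<otimes> U \<cong> Hom(X, U)\<close>.\<close>

definition hat :: "'yu \<Rightarrow> 'x \<Rightarrow> 'u" where
  "hat T x = (SOME l. lin sYU sU l \<and> (\<forall>y u. l (tY y u) = sU (p x y) u)) T"

lemma hat_props: "lin sYU sU (\<lambda>T. hat T x)" "hat (tY y u) x = sU (p x y) u"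
proof -
  interpret U: vector_space sU by (rule vU)
  have "bilinear_map sY sU sU (\<lambda>y u. sU (p x y) u)"
    by (intro bilinear_mapI lin_scaleI[OF lin_id[OF vU]] lin_scale_leftI[OF p_lin(1) vU])
  then obtain l where "lin sYU sU l" "\<And>y u. l (tY y u) = sU (p x y) u" using tensor_lift[OF tensor] by blast
  hence "\<exists>l. lin sYU sU l \<and> (\<forall>y u. l (tY y u) = sU (p x y) u)" by blast
  from someI_ex[OF this] show "lin sYU sU (\<lambda>T. hat T x)" "hat (tY y u) x = sU (p x y) u"
    unfolding hat_def by blast+
qed

lemma hat_lin: "lin sX sU (hat T)"
proof (rule linI[OF vX vU])
  interpret U: vector_space sU by (rule vU)
  show "hat T (x + x') = hat T x + hat T x'" for x x'
    by (rule tensor_ext[OF tensor hat_props(1) lin_addI[OF hat_props(1) hat_props(1)]])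
      (simp add: hat_props(2) linD(1)[OF p_lin(2)] U.scale_left_distrib)
  show "hat T (sX c x) = sU c (hat T x)" for c x
    by (rule tensor_ext[OF tensor hat_props(1) lin_scaleI[OF hat_props(1)]])
      (simp add: hat_props(2) linD(2)[OF p_lin(2)])
qed

text \<open>The component of a tensor along the basis vector \<open>b\<close> of \<open>U\<close>.
  As a linear form on \<open>X\<close> it is the \<open>b\<close>-coordinate of
  \<open>hat T\<close>.\<close>

definition yc :: "'u \<Rightarrow> 'yu \<Rightarrow> 'y" where
  "yc b = (SOME l. lin sYU sY l \<and> (\<forall>y u. l (tY y u) = sY (coord sU BU b u) y))"

lemma yc_props: "lin sYU sY (yc b)" "yc b (tY y u) = sY (coord sU BU b u) y"
proof -
  have "bilinear_map sY sU sY (\<lambda>y u. sY (coord sU BU b u) y)"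
    by (intro bilinear_mapI lin_scaleI[OF lin_id[OF vY]] lin_scale_leftI[OF coord_lin[OF BU] vY])
  then obtain l where "lin sYU sY l" "\<And>y u. l (tY y u) = sY (coord sU BU b u) y" using tensor_lift[OF tensor] by blast
  hence "\<exists>l. lin sYU sY l \<and> (\<forall>y u. l (tY y u) = sY (coord sU BU b u) y)" by blast
  from someI_ex[OF this] show "lin sYU sY (yc b)" "yc b (tY y u) = sY (coord sU BU b u) y"
    unfolding yc_def by blast+
qed

lemma p_yc: "p x (yc b T) = coord sU BU b (hat T x)"
  by (rule tensor_ext[OF tensor lin_comp[OF yc_props(1) p_lin(1)] lin_comp[OF hat_props(1) coord_lin[OF BU]]])
    (simp add: yc_props(2) hat_props(2) linD(2)[OF p_lin(1)] linD(2)[OF coord_lin[OF BU]])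

lemma decomposition: "(\<Sum>b\<in>BU. tY (yc b T) b) = T"
proof -
  have "lin sYU sYU (\<lambda>T. \<Sum>b\<in>BU. tY (yc b T) b)"
    by (intro lin_sumI vYU lin_comp[OF yc_props(1) t_lin(2)])
  moreover have "(\<Sum>b\<in>BU. tY (yc b (tY y u)) b) = tY y u" for y u
  proof -
    have "(\<Sum>b\<in>BU. tY (yc b (tY y u)) b) = tY y (\<Sum>b\<in>BU. sU (coord sU BU b u) b)"
      by (simp add: yc_props(2) linD(2)[OF t_lin(2)] linD(6)[OF t_lin(1)] linD(2)[OF t_lin(1)])
    thus ?thesis by (simp add: coord_sum[OF BU])
  qed
  ultimately show ?thesis by (rule tensor_ext[OF tensor _ lin_id[OF vYU], where w = T])
qed

lemma hat_inject: "(\<And>x. hat T x = hat T' x) \<Longrightarrow> T = T'"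
proof -
  assume "\<And>x. hat T x = hat T' x"
  hence "yc b T = yc b T'" for b by (intro p_eqI) (simp add: p_yc)
  hence "(\<Sum>b\<in>BU. tY (yc b T) b) = (\<Sum>b\<in>BU. tY (yc b T') b)" by simp
  thus ?thesis unfolding decomposition .
qed

lemma hat_exists:
  assumes g: "lin sX sU g"
  obtains T where "hat T = g"
proof -
  have "\<exists>y. \<forall>x. coord sU BU b (g x) = p x y" for b
    using represents[OF lin_comp[OF g coord_lin[OF BU]]] .
  then obtain y where y: "\<And>b x. coord sU BU b (g x) = p x (y b)" by metis
  have "hat (\<Sum>b\<in>BU. tY (y b) b) x = g x" for x
    by (simp add: linD(6)[OF hat_props(1)] hat_props(2) y[symmetric] coord_sum[OF BU])
  thus thesis using that by blast
qed

text \<open>Surjectivity of \<open>hat T\<close> makes the components of \<open>T\<close> along a basis of \<open>U\<close> linearly independent.\<close>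

lemma components_automorphism:
  assumes T: "surj (hat T)" and T': "surj (hat T')"
  obtains C where "lin sY sY C" "bij C" "\<And>b. b \<in> BU \<Longrightarrow> C (yc b T) = yc b T'"
proof -
  interpret U: finite_dimensional_vector_space sU BU by (rule BU)
  obtain BY where BY: "finite_dimensional_vector_space sY BY" using vector_space_finite_basis vY by blast
  interpret Y: finite_dimensional_vector_space sY BY by (rule BY)
  have inj: "inj_on (\<lambda>b. yc b T) BU" if T: "surj (hat T)" for T
  proof (rule inj_onI)
    fix b b' assume b: "b \<in> BU" "b' \<in> BU" "yc b T = yc b' T"
    obtain x where "hat T x = b" using T by (metis surjD)
    hence "coord sU BU b b = coord sU BU b' b" using b(3) p_yc by metis
    thus "b = b'" using b by (simp add: coord_basis[OF BU] split: if_splits)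
  qed
  have ind: "Y.independent ((\<lambda>b. yc b T) ` BU)" if T: "surj (hat T)" for T
  proof (rule Y.independent_if_scalars_zero)
    show "finite ((\<lambda>b. yc b T) ` BU)" using U.finite_Basis by simp
    fix f y assume 0: "(\<Sum>y\<in>(\<lambda>b. yc b T) ` BU. sY (f y) y) = 0" and "y \<in> (\<lambda>b. yc b T) ` BU"
    then obtain b where b: "b \<in> BU" "y = yc b T" by blast
    \<comment> \<open>Pairing the linear relation with a preimage of \<open>b\<close> under
      \<open>hat T\<close> singles out the coefficient of \<open>yc b T\<close>.\<close>
    obtain x where x: "hat T x = b" using T by (metis surjD)
    have "0 = p x (\<Sum>b\<in>BU. sY (f (yc b T)) (yc b T))"
      using 0 by (simp add: sum.reindex[OF inj[OF T]] linD(3)[OF p_lin(1)])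
    also have "\<dots> = (\<Sum>b'\<in>BU. f (yc b' T) * coord sU BU b' b)"
      by (simp add: linD(6)[OF p_lin(1)] linD(2)[OF p_lin(1)] p_yc x)
    also have "\<dots> = (\<Sum>b'\<in>BU. if b' = b then f (yc b' T) else 0)"
      using b by (intro sum.cong) (auto simp: coord_basis[OF BU])
    also have "\<dots> = f y" using b U.finite_Basis by simp
    finally show "f y = 0" by simp
  qed
  define f where "f y = yc (inv_into BU (\<lambda>b. yc b T) y) T'" for y
  have f: "f (yc b T) = yc b T'" if "b \<in> BU" for b
    using inv_into_f_f[OF inj[OF T] that] by (simp add: f_def)
  have img: "f ` (\<lambda>b. yc b T) ` BU = (\<lambda>b. yc b T') ` BU" using f by (auto simp: image_image)
  have injf: "inj_on f ((\<lambda>b. yc b T) ` BU)"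
    using inj[OF T'] f by (auto simp: inj_on_def)
  obtain C where C: "lin sY sY C" "inj C" "\<forall>y\<in>(\<lambda>b. yc b T) ` BU. C y = f y"
    using Y.linear_independent_extend_inj[OF ind[OF T], of f] img ind[OF T'] injf by auto
  show thesis
  proof (rule that[OF C(1)])
    show "bij C" using C(2) by (simp add: bij_def finite_UNIV_inj_surj)
  qed (use C(3) f in auto)
qed

lemma adjoint_X:
  assumes C: "lin sY sY C"
  shows adjoint_X_p: "p (adjoint_X p C x) y = p x (C y)" and adjoint_X_lin: "lin sX sX (adjoint_X p C)"
proof -
  have ex: "\<exists>x'. \<forall>y. p x' y = p x (C y)" for x
    using perfect_pairing_represents[OF perfect_pairing_swap[OF pairing] dims[symmetric]
        lin_comp[OF C p_lin(1)], of x] by metis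
  have "\<exists>!x'. \<forall>y. p x' y = p x (C y)" for x
    using ex[of x] p_eqI' by metis
  from theI'[OF this] show a: "p (adjoint_X p C x) y = p x (C y)" for x y by (simp add: adjoint_X_def)
  show "lin sX sX (adjoint_X p C)"
    by (rule linI[OF vX vX]; rule p_eqI') (simp_all add: a linD(1,2)[OF p_lin(2)])
qed

lemma adjoint_X_unique:
  assumes "\<And>x y. p (f x) y = p x (C y)"
  shows "adjoint_X p C = f"
proof
  fix x
  show "adjoint_X p C x = f x" unfolding adjoint_X_def
    by (rule the_equality) (use assms in \<open>auto intro: p_eqI'\<close>)
qed

end

section \<open>The dual pair\<close>

text \<open>Unlike \<open>tensor_map\<close>, source and target may be different tensor products, as
  required for \<open>A \<otimes> id\<close> from \<open>Y \<otimes> U\<close> to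
  \<open>X \<otimes> U\<close>.\<close>

definition tens :: "('f::field \<Rightarrow> 'c::ab_group_add \<Rightarrow> 'c) \<Rightarrow> ('a::ab_group_add \<Rightarrow> 'b::ab_group_add \<Rightarrow> 'c)
    \<Rightarrow> ('f \<Rightarrow> 'd::ab_group_add \<Rightarrow> 'd) \<Rightarrow> ('a' \<Rightarrow> 'b' \<Rightarrow> 'd) \<Rightarrow> ('a \<Rightarrow> 'a') \<Rightarrow> ('b \<Rightarrow> 'b') \<Rightarrow> 'c \<Rightarrow> 'd" where
  "tens s t s' t' A r = (SOME l. lin s s' l \<and> (\<forall>v u. l (t v u) = t' (A v) (r u)))"

lemma tens:
  fixes s' :: "'f::field \<Rightarrow> 'd::{ab_group_add, finite} \<Rightarrow> 'd"
  assumes t: "is_tensor_product s1 s2 s t" and t': "bilinear_map s1' s2' s' t'"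
    and A: "lin s1 s1' A" and r: "lin s2 s2' r"
  shows "lin s s' (tens s t s' t' A r)" "tens s t s' t' A r (t v u) = t' (A v) (r u)"
proof -
  have "bilinear_map s1 s2 s' (\<lambda>v u. t' (A v) (r u))"
    by (intro bilinear_mapI lin_comp[OF r bilinear_mapD(1)[OF t']] lin_comp[OF A bilinear_mapD(2)[OF t']])
  then obtain l where "lin s s' l" "\<And>v u. l (t v u) = t' (A v) (r u)" using tensor_lift[OF t] by blast
  hence "\<exists>l. lin s s' l \<and> (\<forall>v u. l (t v u) = t' (A v) (r u))" by blast
  from someI_ex[OF this, folded tens_def]
  show "lin s s' (tens s t s' t' A r)" "tens s t s' t' A r (t v u) = t' (A v) (r u)" by blast+
qed

lemma prod_scale:
  assumes "vector_space s1" "vector_space s2"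
  shows "module_prod.scale s1 s2 c v = (s1 c (fst v), s2 c (snd v))" "vector_space (module_prod.scale s1 s2)"
proof -
  interpret vector_space_prod s1 s2 using assms by (simp add: vector_space_prod_def vector_space_pair_def)
  show "module_prod.scale s1 s2 c v = (s1 c (fst v), s2 c (snd v))" "vector_space (module_prod.scale s1 s2)"
    by (simp_all add: scale_def p.vector_space_axioms)
qed

lemma lin_prodI:
  assumes L: "vector_space s1" "vector_space s2" "vector_space s"
    and f: "lin s s1 f" "lin s s2 g"
  shows "lin s (module_prod.scale s1 s2) (\<lambda>v. (f v, g v))"
  by (rule linI[OF L(3) prod_scale(2)[OF L(1,2)]])
    (simp_all add: prod_scale(1)[OF L(1,2)] linD(1,2)[OF f(1)] linD(1,2)[OF f(2)])

lemma lin_fst_snd: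
  assumes L: "vector_space s1" "vector_space s2"
  shows "lin (module_prod.scale s1 s2) s1 fst" "lin (module_prod.scale s1 s2) s2 snd"
  by (auto intro!: linI prod_scale(2) L simp: prod_scale(1)[OF L])

locale dual_pair = tensor_pairing sX sY sU p sYU tY BU + R: tensor_pairing sY sX sU "\<lambda>y x. p x y" sXU tX BU
  for sX :: "'f::{field, finite} \<Rightarrow> 'x::{ab_group_add, finite} \<Rightarrow> 'x"
    and sY :: "'f \<Rightarrow> 'y::{ab_group_add, finite} \<Rightarrow> 'y"
    and sU :: "'f \<Rightarrow> 'u::{ab_group_add, finite} \<Rightarrow> 'u"
    and p :: "'x \<Rightarrow> 'y \<Rightarrow> 'f"
    and sYU :: "'f \<Rightarrow> 'yu::{ab_group_add, finite} \<Rightarrow> 'yu"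
    and tY :: "'y \<Rightarrow> 'u \<Rightarrow> 'yu"
    and BU :: "'u set"
    and sXU :: "'f \<Rightarrow> 'xu::{ab_group_add, finite} \<Rightarrow> 'xu"
    and tX :: "'x \<Rightarrow> 'u \<Rightarrow> 'xu" +
  fixes \<beta> :: "'u \<Rightarrow> 'u \<Rightarrow> 'f" and pU :: "'xu \<Rightarrow> 'yu \<Rightarrow> 'f"
  assumes form: "nondegenerate_symmetric_form sU \<beta>"
    and pU: "bilinear_map sXU sYU (*) pU"
    and pU_pure: "\<And>x u y u'. pU (tX x u) (tY y u') = p x y * \<beta> u u'"
    and two: "(2 :: 'f) \<noteq> 0"
begin

lemma \<beta>_lin: "lin sU (*) (\<beta> u)" "lin sU (*) (\<lambda>u. \<beta> u v)"
  and \<beta>_sym: "\<beta> u v = \<beta> v u" and \<beta>_nondegenerate: "(\<And>v. \<beta> u v = 0) \<Longrightarrow> u = 0"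
  using form unfolding nondegenerate_symmetric_form_def bilinear_map_def by blast+

lemma \<beta>_eqI: "(\<And>v. \<beta> u v = \<beta> u' v) \<Longrightarrow> u = u'"
proof -
  assume "\<And>v. \<beta> u v = \<beta> u' v"
  hence "u - u' = 0" by (intro \<beta>_nondegenerate) (simp add: linD(5)[OF \<beta>_lin(2)])
  thus ?thesis by simp
qed

lemma pU_lin: "lin sYU (*) (pU a)" "lin sXU (*) (\<lambda>a. pU a T)"
  using bilinear_mapD[OF pU] by auto

lemma pU_hat: "pU (tX x u) T = \<beta> u (hat T x)"
  by (rule tensor_ext[OF tensor pU_lin(1) lin_comp[OF hat_props(1) \<beta>_lin(1)]])
    (simp add: pU_pure hat_props(2) linD(2)[OF \<beta>_lin(1)])

lemma pU_hat': "pU a (tY y u) = \<beta> u (R.hat a y)"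
  by (rule tensor_ext[OF R.tensor pU_lin(2) lin_comp[OF R.hat_props(1) \<beta>_lin(1)]])
    (simp add: pU_pure R.hat_props(2) linD(2)[OF \<beta>_lin(1)] \<beta>_sym)

lemma pU_eqI: "(\<And>T. pU a T = pU a' T) \<Longrightarrow> a = a'"
proof (rule R.hat_inject)
  fix y assume "\<And>T. pU a T = pU a' T"
  hence "\<beta> (R.hat a y) u = \<beta> (R.hat a' y) u" for u using pU_hat'[of _ y u] \<beta>_sym by metis
  thus "R.hat a y = R.hat a' y" by (rule \<beta>_eqI)
qed

lemma tY_bil: "bilinear_map sY sU sYU tY" and tX_bil: "bilinear_map sX sU sXU tX"
  using tensor R.tensor by (auto simp: is_tensor_product_def)

abbreviation "symYX \<equiv> symmetric_YX sX sY p"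
abbreviation "OU \<equiv> isometry_group sU \<beta>"
abbreviation "SP \<equiv> Sp sX sY p"

definition AT :: "('y \<Rightarrow> 'x) \<Rightarrow> 'yu \<Rightarrow> 'xu" where "AT A = tens sYU tY sXU tX A id"
definition CT :: "('y \<Rightarrow> 'y) \<Rightarrow> ('u \<Rightarrow> 'u) \<Rightarrow> 'yu \<Rightarrow> 'yu" where "CT C r = tens sYU tY sYU tY C r"

lemma id_lin: "vector_space s \<Longrightarrow> lin s s id"
  by (simp add: Vector_Spaces.linear_iff)

lemma AT: "lin sY sX A \<Longrightarrow> lin sYU sXU (AT A)" "lin sY sX A \<Longrightarrow> AT A (tY y u) = tX (A y) u"
  using tens[OF tensor tX_bil _ id_lin[OF vU]] by (simp_all add: AT_def)

lemma CT: "lin sY sY C \<Longrightarrow> lin sU sU r \<Longrightarrow> lin sYU sYU (CT C r)"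
    "lin sY sY C \<Longrightarrow> lin sU sU r \<Longrightarrow> CT C r (tY y u) = tY (C y) (r u)"
  using tens[OF tensor tY_bil] by (simp_all add: CT_def)

lemma CT_inverse:
  assumes C: "lin sY sY C" "lin sY sY C'" "\<And>y. C' (C y) = y" and r: "lin sU sU r" "lin sU sU r'" "\<And>u. r' (r u) = u"
  shows "CT C' r' (CT C r T) = T"
  by (rule tensor_ext[OF tensor lin_comp[OF CT(1)[OF C(1) r(1)] CT(1)[OF C(2) r(2)]] lin_id[OF vYU]])
    (simp add: CT(2)[OF C(1) r(1)] CT(2)[OF C(2) r(2)] C(3) r(3))

lemma hat_CT:
  assumes C: "lin sY sY C" and r: "lin sU sU r"
  shows "hat (CT C r T) x = r (hat T (adjoint_X p C x))"
  by (rule tensor_ext[OF tensor lin_comp[OF CT(1)[OF C r] hat_props(1)] lin_comp[OF hat_props(1) r]])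
    (simp add: CT(2)[OF C r] hat_props(2) adjoint_X_p[OF C] linD(2)[OF r])

lemma adjoint_X_id: "adjoint_X p id = id"
  by (rule adjoint_X_unique) simp

lemma OU_D:
  assumes "r \<in> carrier OU"
  shows "lin sU sU r" "bij r" "\<beta> (r u) (r v) = \<beta> u v" "lin sU sU (inv_into UNIV r)"
    "r (inv_into UNIV r u) = u" "inv_into UNIV r (r u) = u" "\<beta> u (inv_into UNIV r v) = \<beta> (r u) v"
proof -
  show 1: "lin sU sU r" "bij r" "\<And>u v. \<beta> (r u) (r v) = \<beta> u v" using assms by (auto simp: isometry_group_simps)
  show "lin sU sU (inv_into UNIV r)" by (rule lin_inv[OF 1(1,2)])
  show 2: "r (inv_into UNIV r u) = u" for u using 1(2) by (simp add: bij_is_surj surj_f_inv_f)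
  show "inv_into UNIV r (r u) = u" using 1(2) by (simp add: bij_is_inj)
  show "\<beta> u (inv_into UNIV r v) = \<beta> (r u) v" using 1(3)[of u "inv_into UNIV r v"] 2 by simp
qed

lemma bij_CT:
  assumes C: "lin sY sY C" "bij C" and r: "r \<in> carrier OU"
  shows "bij (CT C r)" "inv_into UNIV (CT C r) = CT (inv_into UNIV C) (inv_into UNIV r)"
proof -
  note ci = lin_inv[OF C]
  have Ci: "C (inv_into UNIV C y) = y" "inv_into UNIV C (C y) = y" for y
    using C(2) by (simp_all add: bij_is_surj surj_f_inv_f bij_is_inj)
  have 1: "CT (inv_into UNIV C) (inv_into UNIV r) (CT C r T) = T" for T
    by (rule CT_inverse) (use C ci Ci OU_D[OF r] in auto)
  have 2: "CT C r (CT (inv_into UNIV C) (inv_into UNIV r) T) = T" for T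
    by (rule CT_inverse) (use C ci Ci OU_D[OF r] in auto)
  show "bij (CT C r)" by (rule o_bij[of "CT (inv_into UNIV C) (inv_into UNIV r)"]) (auto simp: 1 2)
  show "inv_into UNIV (CT C r) = CT (inv_into UNIV C) (inv_into UNIV r)"
    by (rule inv_equality) (auto simp: 1 2)
qed

abbreviation "sV \<equiv> module_prod.scale sX sY"
abbreviation "sW \<equiv> module_prod.scale sXU sYU"

text \<open>Uniqueness behind the definite description: pure tensors with a zero entry in
  \<open>X\<close> or in \<open>Y\<close> generate the two summands \<open>Y \<otimes> U\<close> and
  \<open>X \<otimes> U\<close> separately, and on each of them \<open>tensor_ext\<close>
  applies.\<close>

lemma tensor_map_eq:
  assumes L: "lin sW sW L" and eq: "\<And>v u. L (sum_tensor tX tY v u) = sum_tensor tX tY (g v) (h u)"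
  shows "tensor_map sW (sum_tensor tX tY) g h = L"
  unfolding tensor_map_def
proof (rule the_equality)
  show "lin sW sW L \<and> (\<forall>v u. L (sum_tensor tX tY v u) = sum_tensor tX tY (g v) (h u))" using L eq by blast
  fix L' assume L': "lin sW sW L' \<and> (\<forall>v u. L' (sum_tensor tX tY v u) = sum_tensor tX tY (g v) (h u))"
  hence l': "lin sW sW L'" by blast
  have same: "L' (sum_tensor tX tY v u) = L (sum_tensor tX tY v u)" for v u using L' eq by metis
  have t0: "tX 0 u = 0" "tY 0 u = 0" for u using linD(3)[OF bilinear_mapD(2)[OF tX_bil]] linD(3)[OF bilinear_mapD(2)[OF tY_bil]] by auto
  have i: "lin sXU sW (\<lambda>a. (a, 0))" "lin sYU sW (\<lambda>b. (0, b))"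
    by (intro lin_prodI R.vYU vYU lin_id lin_const_zero)+
  show "L' = L"
  proof
    fix w :: "'xu \<times> 'yu"
    have 1: "L' (a, 0) = L (a, 0)" for a
      by (rule tensor_ext[OF R.tensor lin_comp[OF i(1) l'] lin_comp[OF i(1) L]])
        (use same[of "(_, 0)"] in \<open>simp add: sum_tensor_def t0\<close>)
    have 2: "L' (0, b) = L (0, b)" for b
      by (rule tensor_ext[OF tensor lin_comp[OF i(2) l'] lin_comp[OF i(2) L]])
        (use same[of "(0, _)"] in \<open>simp add: sum_tensor_def t0\<close>)
    have "w = (fst w, 0) + (0, snd w)" by simp
    thus "L' w = L w" using 1 2 linD(1)[OF l', of "(fst w, 0)" "(0, snd w)"] linD(1)[OF L, of "(fst w, 0)" "(0, snd w)"] by simp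
  qed
qed

lemma symYX_D: "A \<in> symYX \<Longrightarrow> lin sY sX A" "A \<in> symYX \<Longrightarrow> p (A y) y' = p (A y') y"
  by (auto simp: symmetric_YX_def)

lemma AT_symmetric:
  assumes A: "A \<in> symYX"
  shows "AT A \<in> symmetric_YX sXU sYU pU"
proof -
  note l = AT(1)[OF symYX_D(1)[OF A]]
  have 1: "pU (AT A (tY y u)) T' = pU (AT A T') (tY y u)" for y u T'
    by (rule tensor_ext[OF tensor pU_lin(1) lin_comp[OF l pU_lin(2)]])
      (simp add: AT(2)[OF symYX_D(1)[OF A]] pU_pure symYX_D(2)[OF A, of y] \<beta>_sym)
  have "pU (AT A T) T' = pU (AT A T') T" for T T'
    by (rule tensor_ext[OF tensor lin_comp[OF l pU_lin(2)] pU_lin(1)]) (rule 1)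
  thus ?thesis using l by (simp add: symmetric_YX_def)
qed

lemma unipotent_lin:
  assumes "vector_space s1" "vector_space s2" "lin s2 s1 A"
  shows "lin (module_prod.scale s1 s2) (module_prod.scale s1 s2) (unipotent A)"
  unfolding unipotent_def[abs_def]
  by (intro lin_prodI assms(1,2) prod_scale(2) lin_addI lin_fst_snd lin_comp[OF lin_fst_snd(2) assms(3)])

lemma tensor_map_unipotent:
  assumes A: "A \<in> symYX"
  shows "tensor_map sW (sum_tensor tX tY) (unipotent A) id = unipotent (AT A)"
proof (rule tensor_map_eq[OF unipotent_lin[OF R.vYU vYU AT(1)[OF symYX_D(1)[OF A]]]])
  show "unipotent (AT A) (sum_tensor tX tY v u) = sum_tensor tX tY (unipotent A v) (id u)" for v u
    by (simp add: sum_tensor_def unipotent_def AT(2)[OF symYX_D(1)[OF A]] linD(1)[OF bilinear_mapD(2)[OF tX_bil]])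
qed

definition QT :: "('y \<Rightarrow> 'y) \<Rightarrow> ('u \<Rightarrow> 'u) \<Rightarrow> 'xu \<Rightarrow> 'xu" where
  "QT C r = tens sXU tX sXU tX (adjoint_X p (inv_into UNIV C)) r"

text \<open>A Levi element of \<open>Sp(V)\<close> together with an isometry of \<open>U\<close>
  acts on \<open>V \<otimes> U\<close> as a Levi element again. One formula of the oscillator
  representation thus covers both groups, the isometries being the case where \<open>C\<close> is
  the identity.\<close>

lemma tensor_map_levi:
  assumes C: "lin sY sY C" "bij C" and r: "r \<in> carrier OU"
  shows "tensor_map sW (sum_tensor tX tY) (levi p C) r = levi pU (CT C r)"
proof -
  note ci = lin_inv[OF C]
  note D = OU_D[OF r]
  have Q: "lin sXU sXU (QT C r)" "\<And>x u. QT C r (tX x u) = tX (adjoint_X p (inv_into UNIV C) x) (r u)"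
    using tens[OF R.tensor tX_bil adjoint_X_lin[OF ci] D(1)] by (simp_all add: QT_def)
  note c = CT(1)[OF C(1) D(1)] and c' = CT(1)[OF ci D(4)]
  have 1: "pU (QT C r (tX x u)) T = pU (tX x u) (CT (inv_into UNIV C) (inv_into UNIV r) T)" for x u T
    by (rule tensor_ext[OF tensor pU_lin(1) lin_comp[OF c' pU_lin(1)]])
      (simp add: Q(2) CT(2)[OF ci D(4)] pU_pure adjoint_X_p[OF ci] D(7))
  have 2: "pU (QT C r a) T = pU a (inv_into UNIV (CT C r) T)" for a T
    unfolding bij_CT(2)[OF C r]
    by (rule tensor_ext[OF R.tensor lin_comp[OF Q(1) pU_lin(2)] pU_lin(2)]) (rule 1)
  have adj: "adjoint_X pU (inv_into UNIV (CT C r)) = QT C r"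
  proof
    fix a
    show "adjoint_X pU (inv_into UNIV (CT C r)) a = QT C r a" unfolding adjoint_X_def
      by (rule the_equality) (use 2 in \<open>auto intro: pU_eqI\<close>)
  qed
  show ?thesis
  proof (rule tensor_map_eq)
    show "lin sW sW (levi pU (CT C r))" unfolding levi_def[abs_def] adj
      by (intro lin_prodI R.vYU vYU prod_scale(2) lin_comp[OF lin_fst_snd(1) Q(1)] lin_comp[OF lin_fst_snd(2) c])
    show "levi pU (CT C r) (sum_tensor tX tY v u) = sum_tensor tX tY (levi p C v) (r u)" for v u
      unfolding levi_def adj by (simp add: sum_tensor_def Q(2) CT(2)[OF C(1) D(1)])
  qed
qed

lemma sp_nondegenerate:
  "(\<And>w. symplectic_form p v w = 0) \<Longrightarrow> v = 0" "symplectic_form p 0 w = 0"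
proof -
  assume 0: "\<And>w. symplectic_form p v w = 0"
  have "p (fst v) y = 0" for y using 0[of "(0, y)"] linD(3)[OF p_lin(2)] by (simp add: symplectic_form_def)
  moreover have "p x (snd v) = 0" for x using 0[of "(x, 0)"] linD(3)[OF p_lin(1)] by (simp add: symplectic_form_def)
  ultimately show "v = 0" using p_nondegenerate by (metis prod.collapse zero_prod_def)
next
  show "symplectic_form p 0 w = 0" by (simp add: symplectic_form_def linD(3)[OF p_lin(2)] linD(3)[OF p_lin(1)])
qed

lemma unipotent_Sp:
  assumes A: "A \<in> symYX"
  shows "unipotent A \<in> carrier SP"
  unfolding Sp_def
proof (rule isometry_groupI[OF unipotent_lin[OF vX vY symYX_D(1)[OF A]]])
  show "symplectic_form p (unipotent A v) (unipotent A w) = symplectic_form p v w" for v w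
    using symYX_D(2)[OF A, of "snd v" "snd w"]
    by (simp add: symplectic_form_def unipotent_def linD(1)[OF p_lin(2)])
qed (use sp_nondegenerate in blast)+

lemma levi_Sp:
  assumes C: "lin sY sY C" "bij C"
  shows "levi p C \<in> carrier SP"
  unfolding Sp_def
proof (rule isometry_groupI)
  note ci = lin_inv[OF C]
  show "lin sV sV (levi p C)" unfolding levi_def[abs_def]
    by (intro lin_prodI vX vY prod_scale(2) lin_comp[OF lin_fst_snd(1) adjoint_X_lin[OF ci]] lin_comp[OF lin_fst_snd(2) C(1)])
  show "symplectic_form p (levi p C v) (levi p C w) = symplectic_form p v w" for v w
    using C(2) by (simp add: symplectic_form_def levi_def adjoint_X_p[OF ci] bij_is_inj)
qed (use sp_nondegenerate in blast)+

lemma levi_id: "levi p id = id"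
  by (auto simp: levi_def fun_eq_iff adjoint_X_id)

section \<open>The form on \<open>X\<close> pulled back along \<open>hat T\<close>, its rank and its
  orbit\<close>

definition formB :: "'yu \<Rightarrow> 'x \<Rightarrow> 'y" where
  "formB T x = (SOME y. \<forall>x'. p x' y = \<beta> (hat T x) (hat T x'))"

lemma formB_p: "p x' (formB T x) = \<beta> (hat T x) (hat T x')"
proof -
  have "\<exists>y. \<forall>x'. \<beta> (hat T x) (hat T x') = p x' y"
    using represents[OF lin_comp[OF hat_lin \<beta>_lin(1)]] .
  hence "\<exists>y. \<forall>x'. p x' y = \<beta> (hat T x) (hat T x')" by metis
  from someI_ex[OF this, folded formB_def] show ?thesis by blast
qed

lemma formB_eqI: "(\<And>x x'. p x' (B x) = \<beta> (hat T x) (hat T x')) \<Longrightarrow> B = formB T"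
  by (intro ext p_eqI) (simp add: formB_p)

lemma formB_lin: "lin sX sY (formB T)"
  by (rule linI[OF vX vY]; rule p_eqI)
    (simp_all add: formB_p linD(1,2)[OF p_lin(1)] linD(1,2)[OF hat_lin] linD(1,2)[OF \<beta>_lin(2)])

lemma formB_symmetric: "formB T \<in> symmetric_XY sX sY p"
  using formB_lin by (auto simp: symmetric_XY_def formB_p \<beta>_sym)

text \<open>A sum of rank-one maps indexed by the basis of \<open>U\<close>; it yields both the
  trace formula and the bound of the rank by \<open>dim U\<close>.\<close>

lemma formB_decomposition: "formB T x = (\<Sum>b\<in>BU. sY (\<beta> (hat T x) b) (yc b T))"
proof (rule p_eqI)
  fix x'
  have "p x' (\<Sum>b\<in>BU. sY (\<beta> (hat T x) b) (yc b T)) = \<beta> (hat T x) (\<Sum>b\<in>BU. sU (coord sU BU b (hat T x')) b)"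
    by (simp add: linD(6)[OF p_lin(1)] linD(2)[OF p_lin(1)] p_yc linD(6)[OF \<beta>_lin(1)] linD(2)[OF \<beta>_lin(1)] mult.commute)
  thus "p x' (formB T x) = p x' (\<Sum>b\<in>BU. sY (\<beta> (hat T x) b) (yc b T))"
    by (simp add: formB_p coord_sum[OF BU])
qed

text \<open>Matches the exponent in the Schroedinger model, evaluated at the point \<open>T\<close>,
  with the trace that defines the character of \<open>N\<close> attached to
  \<open>formB T\<close>.\<close>

lemma trace_formB:
  assumes A: "lin sY sX A"
  shows "lin_trace sY (\<lambda>y. formB T (A y)) = pU (AT A T) T"
proof -
  have "lin_trace sY (\<lambda>y. formB T (A y)) = (\<Sum>b\<in>BU. \<beta> (hat T (A (yc b T))) b)"
    unfolding formB_decomposition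
    by (rule lin_trace_finite_rank[OF vY]) (intro lin_comp[OF A] lin_comp[OF hat_lin \<beta>_lin(2)])
  also have "\<dots> = (\<Sum>b\<in>BU. pU (AT A (tY (yc b T) b)) T)"
    by (rule sum.cong[OF refl]) (simp only: AT(2)[OF A] pU_hat \<beta>_sym)
  also have "\<dots> = pU (AT A (\<Sum>b\<in>BU. tY (yc b T) b)) T"
    by (simp only: linD(6)[OF AT(1)[OF A]] linD(6)[OF pU_lin(2)])
  also have "\<dots> = pU (AT A T) T" by (simp only: decomposition)
  finally show ?thesis .
qed

text \<open>The form factors as \<open>s\<close> after \<open>hat T\<close>, where \<open>s\<close>
  is the transpose of \<open>hat T\<close> preceded by the identification of \<open>U\<close> with
  its dual through \<beta>.\<close>

lemma formB_factor:
  obtains s where "lin sU sY s" "\<And>u x'. \<beta> u (hat T x') = p x' (s u)" "range (formB T) = s ` range (hat T)"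
proof -
  have "\<exists>y. \<forall>x'. \<beta> u (hat T x') = p x' y" for u using represents[OF lin_comp[OF hat_lin \<beta>_lin(1)]] .
  then obtain s where s: "\<And>u x'. \<beta> u (hat T x') = p x' (s u)" by metis
  have ls: "lin sU sY s"
    by (rule linI[OF vU vY]; rule p_eqI) (simp_all add: s[symmetric] linD(1,2)[OF p_lin(1)] linD(1,2)[OF \<beta>_lin(2)])
  have "formB T x = s (hat T x)" for x by (rule p_eqI) (simp add: formB_p s[symmetric])
  hence im: "range (formB T) = s ` range (hat T)" by auto
  show thesis by (rule that[OF ls s im])
qed

text \<open>Because the form factors through the range of \<open>hat T\<close>, rank
  \<open>dim U\<close> leaves no room for a proper subspace.\<close>

lemma surj_if_rank:
  assumes "form_rank sY (formB T) = vector_space.dim sU UNIV"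
  shows "surj (hat T)"
proof -
  interpret U: finite_dimensional_vector_space sU BU by (rule BU)
  obtain BY where BY: "finite_dimensional_vector_space sY BY" using vector_space_finite_basis vY by blast
  interpret Y: finite_dimensional_vector_space sY BY by (rule BY)
  interpret UY: finite_dimensional_vector_space_pair sU BU sY BY ..
  obtain s where ls: "lin sU sY s" and s: "\<And>u x'. \<beta> u (hat T x') = p x' (s u)"
    and im: "range (formB T) = s ` range (hat T)" using formB_factor[of T] by blast
  have "U.dim UNIV \<le> U.dim (range (hat T))"
    using im assms UY.dim_image_le[OF ls, of "range (hat T)"] by (simp add: form_rank_def)
  hence "U.dim (range (hat T)) = U.dimension" using U.dim_subset_UNIV[of "range (hat T)"] U.dim_UNIV U.dimension_def by simp
  hence "U.span (range (hat T)) = UNIV" using U.dim_eq_full by blast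
  moreover have "U.subspace (range (hat T))"
  proof -
    interpret XU: vector_space_pair sX sU using vX vU by (simp add: vector_space_pair_def)
    show ?thesis by (rule XU.linear_subspace_image[OF hat_lin XU.vs1.subspace_UNIV])
  qed
  ultimately show ?thesis using U.span_eq_iff by metis
qed

lemma formB_rank_le: "form_rank sY (formB T) \<le> vector_space.dim sU UNIV"
proof -
  interpret U: finite_dimensional_vector_space sU BU by (rule BU)
  interpret Y: vector_space sY by (rule vY)
  have "range (formB T) \<subseteq> Y.span ((\<lambda>b. yc b T) ` BU)"
    by (auto simp: formB_decomposition intro!: Y.span_sum Y.span_scale intro: Y.span_base)
  hence "Y.dim (range (formB T)) \<le> card ((\<lambda>b. yc b T) ` BU)"
    by (rule Y.dim_le_card) (simp add: U.finite_Basis)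
  also have "\<dots> \<le> card BU" by (rule card_image_le[OF U.finite_Basis])
  finally show ?thesis by (simp add: form_rank_def)
qed

lemma formB_rank:
  assumes T: "surj (hat T)"
  shows "form_rank sY (formB T) = vector_space.dim sU UNIV"
proof -
  interpret U: finite_dimensional_vector_space sU BU by (rule BU)
  obtain BY where BY: "finite_dimensional_vector_space sY BY" using vector_space_finite_basis vY by blast
  interpret Y: finite_dimensional_vector_space sY BY by (rule BY)
  interpret UY: finite_dimensional_vector_space_pair sU BU sY BY ..
  obtain s where ls: "lin sU sY s" and s: "\<And>u x'. \<beta> u (hat T x') = p x' (s u)"
    and im: "range (formB T) = s ` range (hat T)" using formB_factor[of T] by blast
  have r: "range (formB T) = range s" using T im by simp
  have "inj s"
  proof (rule injI)
    fix u v assume "s u = s v"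
    hence "\<beta> u (hat T x') = \<beta> v (hat T x')" for x' by (simp add: s)
    thus "u = v" using T by (intro \<beta>_eqI) (metis surjD)
  qed
  thus ?thesis unfolding form_rank_def r using UY.dim_image_eq[OF ls, of UNIV] by (auto intro: inj_on_subset)
qed

text \<open>An isometry from \<open>X/rad B\<close> onto \<open>U\<close>, composed with the
  projection, is a surjection \<open>hat T\<close>. Conversely a surjective \<open>hat T\<close> has
  the radical of its form as kernel, since \<beta> is non-degenerate, and so descends to the
  quotient.\<close>

lemma orbit_iff: "B \<in> orbit_of sX sY sU p \<beta> \<longleftrightarrow> (\<exists>T. surj (hat T) \<and> B = formB T)"
proof
  assume "B \<in> orbit_of sX sY sU p \<beta>"
  then obtain \<phi> where \<phi>: "bij_betw \<phi> (range (vcoset (radical B))) UNIV"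
    "lin sX sU (\<lambda>x. \<phi> (vcoset (radical B) x))"
    "\<And>x x'. \<beta> (\<phi> (vcoset (radical B) x)) (\<phi> (vcoset (radical B) x')) = p x' (B x)"
    by (auto simp: orbit_of_def)
  obtain T where T: "hat T = (\<lambda>x. \<phi> (vcoset (radical B) x))" using hat_exists[OF \<phi>(2)] .
  have "range (hat T) = \<phi> ` range (vcoset (radical B))" by (auto simp: T)
  hence "surj (hat T)" using \<phi>(1) by (simp add: bij_betw_def)
  moreover have "B = formB T" by (rule formB_eqI) (simp add: T \<phi>(3))
  ultimately show "\<exists>T. surj (hat T) \<and> B = formB T" by blast
next
  assume "\<exists>T. surj (hat T) \<and> B = formB T"
  then obtain T where T: "surj (hat T)" and B: "B = formB T" by blast
  let ?R = "radical B"
  have R: "x \<in> ?R \<longleftrightarrow> hat T x = 0" for x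
  proof
    assume "x \<in> ?R"
    hence "\<beta> (hat T x) (hat T x') = 0" for x'
      using formB_p[of x' T x] linD(3)[OF p_lin(1)] by (simp add: radical_def B)
    thus "hat T x = 0" using T by (intro \<beta>_nondegenerate) (metis surjD)
  next
    assume "hat T x = 0"
    hence "formB T x = 0" by (intro p_nondegenerate(1)) (simp add: formB_p linD(3)[OF \<beta>_lin(2)])
    thus "x \<in> ?R" by (simp add: radical_def B)
  qed
  have mem: "x' \<in> vcoset ?R x \<longleftrightarrow> hat T x' = hat T x" for x x'
  proof -
    have "x' \<in> vcoset ?R x \<longleftrightarrow> x' - x \<in> ?R" by (force simp: vcoset_def)
    thus ?thesis by (simp add: R linD(5)[OF hat_lin])
  qed
  define \<phi> where "\<phi> K = hat T (SOME x. x \<in> K)" for K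
  have \<phi>: "\<phi> (vcoset ?R x) = hat T x" for x
    unfolding \<phi>_def using someI[of "\<lambda>z. z \<in> vcoset ?R x" x] mem by simp
  have "inj_on \<phi> (range (vcoset ?R))"
    by (rule inj_onI) (auto simp: \<phi> mem)
  moreover have "\<phi> ` range (vcoset ?R) = UNIV" using T by (auto simp: image_image \<phi>)
  ultimately have "bij_betw \<phi> (range (vcoset ?R)) UNIV" by (simp add: bij_betw_def)
  moreover have "lin sX sU (\<lambda>x. \<phi> (vcoset ?R x))" using hat_lin by (simp add: \<phi>)
  moreover have "\<forall>x x'. \<beta> (\<phi> (vcoset ?R x)) (\<phi> (vcoset ?R x')) = p x' (B x)" by (simp add: \<phi>[unfolded B] B formB_p)
  ultimately show "B \<in> orbit_of sX sY sU p \<beta>"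
    unfolding orbit_of_def using formB_symmetric formB_rank[OF T] B by blast
qed

text \<open>Here \<open>k < n\<close> enters: a basis of \<open>U\<close> injects into a basis of
  \<open>X\<close>, and the inverse of that injection extends linearly.\<close>

lemma exists_surj:
  assumes "vector_space.dim sU UNIV < vector_space.dim sX UNIV"
  obtains T where "surj (hat T)"
proof -
  interpret U: finite_dimensional_vector_space sU BU by (rule BU)
  obtain BX where BX: "finite_dimensional_vector_space sX BX" using vector_space_finite_basis vX by blast
  interpret X: finite_dimensional_vector_space sX BX by (rule BX)
  interpret XU: finite_dimensional_vector_space_pair sX BX sU BU ..
  have "card BU \<le> card BX" using assms by simp
  then obtain f where f: "inj_on f BU" "f ` BU \<subseteq> BX" using U.finite_Basis X.finite_Basis by (meson inj_on_iff_card_le)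
  have "X.independent (f ` BU)" using X.independent_mono[OF X.independent_Basis f(2)] .
  from XU.linear_independent_extend[OF this, of "inv_into BU f"]
  obtain g where g: "lin sX sU g" "\<And>x. x \<in> f ` BU \<Longrightarrow> g x = inv_into BU f x" by blast
  have "g (f b) = b" if "b \<in> BU" for b using g(2)[of "f b"] that f(1) by simp
  hence "u = g (\<Sum>b\<in>BU. sX (coord sU BU b u) (f b))" for u
    by (simp add: linD(6)[OF g(1)] linD(2)[OF g(1)] coord_sum[OF BU])
  hence "surj g" unfolding surj_def by blast
  thus thesis using hat_exists[OF g(1)] that by metis
qed

lemma transitive_surj:
  assumes "surj (hat T)" "surj (hat T')"
  obtains C where "lin sY sY C" "bij C" "CT C id T = T'"
proof -
  obtain C where C: "lin sY sY C" "bij C" "\<And>b. b \<in> BU \<Longrightarrow> C (yc b T) = yc b T'"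
    using components_automorphism[OF assms] by metis
  note l = CT(1)[OF C(1) id_lin[OF vU]]
  have "CT C id T = CT C id (\<Sum>b\<in>BU. tY (yc b T) b)" by (simp only: decomposition)
  also have "\<dots> = (\<Sum>b\<in>BU. tY (yc b T') b)"
    by (simp add: linD(6)[OF l] CT(2)[OF C(1) id_lin[OF vU]] C(3))
  also have "\<dots> = T'" by (rule decomposition)
  finally show thesis using that C by blast
qed

text \<open>A version of Witt's theorem for surjections: equal forms give \<open>T'\<close> full
  rank and make it vanish on the kernel of \<open>hat T\<close>, so \<open>hat T'\<close> is
  \<open>hat T\<close> followed by a map \<open>r\<close>, and \<open>r\<close> preserves
  \<beta>.\<close>

lemma fibre_surj:
  assumes T: "surj (hat T)" and eq: "formB T' = formB T"
  obtains r where "r \<in> carrier OU" "T' = CT id r T"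
proof -
  interpret U: vector_space sU by (rule vU)
  have T': "surj (hat T')" by (rule surj_if_rank) (simp add: eq formB_rank[OF T])
  interpret XU: vector_space_pair sX sU using vX vU by (simp add: vector_space_pair_def)
  obtain s where s: "lin sU sX s" "\<And>u. hat T (s u) = u"
    using XU.linear_surjective_right_inverse[OF hat_lin T] by (metis comp_apply id_apply)
  have ker: "hat T' x = 0" if "hat T x = 0" for x
  proof (rule \<beta>_nondegenerate)
    fix v
    obtain x' where x': "v = hat T' x'" using T' by (metis surjD)
    have "\<beta> (hat T' x) (hat T' x') = \<beta> (hat T x) (hat T x')" using formB_p[of x' T' x] formB_p[of x' T x] eq by simp
    thus "\<beta> (hat T' x) v = 0" using that x' linD(3)[OF \<beta>_lin(2)] by simp
  qed
  define r where "r u = hat T' (s u)" for u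
  have lr: "lin sU sU r" unfolding r_def by (rule lin_comp[OF s(1) hat_lin])
  have rT: "r (hat T x) = hat T' x" for x
  proof -
    have "hat T (s (hat T x) - x) = 0" by (simp add: linD(5)[OF hat_lin] s(2))
    hence "hat T' (s (hat T x) - x) = 0" by (rule ker)
    thus ?thesis by (simp add: linD(5)[OF hat_lin] r_def)
  qed
  have "r \<in> carrier OU"
  proof (rule isometry_groupI[OF lr])
    fix u v
    obtain x x' where x: "u = hat T x" "v = hat T x'" using T by (metis surjD)
    show "\<beta> (r u) (r v) = \<beta> u v" unfolding x rT using formB_p[of x' T' x] formB_p[of x' T x] eq by simp
  qed (use \<beta>_nondegenerate linD(3)[OF \<beta>_lin(2)] in blast)+
  moreover have "T' = CT id r T"
    by (rule hat_inject) (simp add: hat_CT[OF id_lin[OF vY] lr] adjoint_X_id rT)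
  ultimately show thesis by (rule that)
qed

end

section \<open>The Siegel unipotent radical\<close>

lemma outer_one_inject:
  assumes "v \<in> carrier_vec d" "w \<in> carrier_vec d" "outer 1 v = outer 1 w"
  shows "v = w"
proof -
  have "v = outer 1 v *\<^sub>v unit_vec 1 0" by (rule outer_unit_vec[symmetric, OF _ assms(1)]) simp
  also have "\<dots> = w" unfolding assms(3) by (rule outer_unit_vec[OF _ assms(2)]) simp
  finally show ?thesis .
qed

lemma outer_one_mult: "v \<in> carrier_vec d \<Longrightarrow> outer 1 v * mat 1 1 (\<lambda>_. c) = outer 1 (c \<cdot>\<^sub>v v)"
  by (intro eq_matI) (auto simp: outer_def scalar_prod_def)

lemma outer_one_col: "M \<in> carrier_mat d 1 \<Longrightarrow> M = outer 1 (col M 0)"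
  by (intro eq_matI) (auto simp: outer_def)

context dual_pair
begin

definition siegel_carrier :: "('x \<times> 'y \<Rightarrow> 'x \<times> 'y) set" where
  "siegel_carrier = unipotent ` symYX"

definition form_char :: "('f \<Rightarrow> complex) \<Rightarrow> ('x \<Rightarrow> 'y) \<Rightarrow> ('x \<times> 'y \<Rightarrow> 'x \<times> 'y) \<Rightarrow> complex" where
  "form_char \<psi> B g = \<psi> (lin_trace sY (\<lambda>y. B (fst (g (0, y)))) / 2)"

lemma form_char_unipotent: "form_char \<psi> B (unipotent A) = \<psi> (lin_trace sY (\<lambda>y. B (A y)) / 2)"
  by (simp add: form_char_def unipotent_def)

lemma siegel_degrees:
  assumes "is_rep SP d \<rho>"
  shows "rep_degree (Siegel sX sY p) \<rho> = d" "rep_degree (Siegel sX sY p) (siegel_character sY \<psi> B) = 1"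
  using is_rep_degree[OF assms] by (simp_all add: rep_degree_def Siegel_def siegel_character_def)

lemma siegel_rep_carrier: "is_rep SP d \<rho> \<Longrightarrow> g \<in> siegel_carrier \<Longrightarrow> \<rho> g \<in> carrier_mat d d"
  using is_repD(1)[of SP d \<rho>] unipotent_Sp by (auto simp: siegel_carrier_def)

text \<open>An intertwiner from a representation of degree one is a single column, namely a weight
  vector. This connects the multiplicity of a form with weight spaces.\<close>

lemma intertwiners_siegel:
  assumes \<rho>: "is_rep SP d \<rho>"
  shows "intertwiners (Siegel sX sY p) (siegel_character sY \<psi> B) \<rho> = outer 1 ` weight_space siegel_carrier d \<rho> (form_char \<psi> B)"
proof -
  note d = siegel_degrees[OF \<rho>]
  have car: "carrier (Siegel sX sY p) = siegel_carrier" by (simp add: Siegel_def siegel_carrier_def)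
  note c = siegel_rep_carrier[OF \<rho>]
  have iff: "outer 1 v * siegel_character sY \<psi> B g = \<rho> g * outer 1 v \<longleftrightarrow> \<rho> g *\<^sub>v v = form_char \<psi> B g \<cdot>\<^sub>v v"
    if g: "g \<in> siegel_carrier" and v: "v \<in> carrier_vec d" for g v
    unfolding siegel_character_def form_char_def[symmetric] outer_one_mult[OF v] mult_outer[OF c[OF g] v]
    using outer_one_inject[of "form_char \<psi> B g \<cdot>\<^sub>v v" d "\<rho> g *\<^sub>v v"] c[OF g] v by auto
  show ?thesis
  proof (intro equalityI subsetI)
    fix M assume "M \<in> intertwiners (Siegel sX sY p) (siegel_character sY \<psi> B) \<rho>"
    hence M: "M \<in> carrier_mat d 1" "\<And>g. g \<in> siegel_carrier \<Longrightarrow> M * siegel_character sY \<psi> B g = \<rho> g * M"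
      unfolding intertwiners_def d car by auto
    have v: "col M 0 \<in> carrier_vec d" using M(1) by auto
    note Mo = outer_one_col[OF M(1)]
    have "col M 0 \<in> weight_space siegel_carrier d \<rho> (form_char \<psi> B)"
      using M(2) iff[OF _ v] v unfolding Mo[symmetric] by (auto simp: weight_space_def)
    thus "M \<in> outer 1 ` weight_space siegel_carrier d \<rho> (form_char \<psi> B)" using Mo by blast
  next
    fix M assume "M \<in> outer 1 ` weight_space siegel_carrier d \<rho> (form_char \<psi> B)"
    then obtain v where v: "v \<in> weight_space siegel_carrier d \<rho> (form_char \<psi> B)" "M = outer 1 v" by blast
    thus "M \<in> intertwiners (Siegel sX sY p) (siegel_character sY \<psi> B) \<rho>"
      unfolding intertwiners_def d car using iff by (auto simp: weight_space_def outer_carrier)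
  qed
qed

lemma form_multiplicity_eq:
  assumes \<rho>: "is_rep SP d \<rho>" and A: "A \<in> carrier_mat d e"
    and inj: "\<And>v. v \<in> carrier_vec e \<Longrightarrow> A *\<^sub>v v = 0\<^sub>v d \<Longrightarrow> v = 0\<^sub>v e"
    and range: "(\<lambda>v. A *\<^sub>v v) ` carrier_vec e = weight_space siegel_carrier d \<rho> (form_char \<psi> B)"
  shows "form_multiplicity sX sY p \<psi> \<rho> B = e"
proof -
  note d = siegel_degrees[OF \<rho>]
  show ?thesis unfolding form_multiplicity_def rep_multiplicity_def d
  proof (rule dim_of_linear_bij)
    show "intertwiners (Siegel sX sY p) (siegel_character sY \<psi> B) \<rho> = (\<lambda>v. outer 1 (A *\<^sub>v v)) ` carrier_vec e"
      unfolding intertwiners_siegel[OF \<rho>] range[symmetric] by (simp add: image_image)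
    fix v :: "complex vec" assume v: "v \<in> carrier_vec e"
    have Av: "A *\<^sub>v v \<in> carrier_vec d" using A v by simp
    show "outer 1 (A *\<^sub>v v) \<in> carrier_mat d 1" by (rule outer_carrier[OF Av])
    show "outer 1 (A *\<^sub>v (c \<cdot>\<^sub>v v)) = c \<cdot>\<^sub>m outer 1 (A *\<^sub>v v)" for c
      using mult_mat_vec[OF A v] outer_smult[OF Av] by simp
    show "outer 1 (A *\<^sub>v (v + w)) = outer 1 (A *\<^sub>v v) + outer 1 (A *\<^sub>v w)" if w: "w \<in> carrier_vec e" for w
      using mult_add_distrib_mat_vec[OF A v w] outer_add[OF Av, of "A *\<^sub>v w"] A w by simp
    assume "outer 1 (A *\<^sub>v v) = 0\<^sub>m d 1"
    also have "\<dots> = outer 1 (0\<^sub>v d)" by (intro eq_matI) (auto simp: outer_def)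
    finally have "A *\<^sub>v v = 0\<^sub>v d" by (intro outer_one_inject[OF Av]) auto
    thus "v = 0\<^sub>v e" by (rule inj[OF v])
  qed
qed

lemma form_multiplicity_pos:
  assumes \<rho>: "is_rep SP d \<rho>"
  shows "form_multiplicity sX sY p \<psi> \<rho> B > 0 \<longleftrightarrow> (\<exists>v\<in>weight_space siegel_carrier d \<rho> (form_char \<psi> B). v \<noteq> 0\<^sub>v d)"
proof -
  note c = siegel_rep_carrier[OF \<rho>]
  obtain e J L where J: "J \<in> carrier_mat d e" and L: "L \<in> carrier_mat e d" and LJ: "L * J = 1\<^sub>m e"
    and range: "weight_space siegel_carrier d \<rho> (form_char \<psi> B) = (\<lambda>v. J *\<^sub>v v) ` carrier_vec e"
    using vec_subspace_frame[OF vec_subspace_weight_space[OF c]] .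
  have inj: "v = 0\<^sub>v e" if v: "v \<in> carrier_vec e" and 0: "J *\<^sub>v v = 0\<^sub>v d" for v
  proof -
    have "v = L *\<^sub>v (J *\<^sub>v v)" using assoc_mult_mat_vec[OF L J v] LJ v by simp
    also have "\<dots> = 0\<^sub>v e" unfolding 0 using L by (intro eq_vecI) auto
    finally show ?thesis .
  qed
  have m: "form_multiplicity sX sY p \<psi> \<rho> B = e" by (rule form_multiplicity_eq[OF \<rho> J inj range[symmetric]])
  show ?thesis unfolding m range
  proof
    assume e: "0 < e"
    have "J *\<^sub>v unit_vec e 0 \<noteq> 0\<^sub>v d" using inj[of "unit_vec e 0"] e by auto
    thus "\<exists>v\<in>(\<lambda>v. J *\<^sub>v v) ` carrier_vec e. v \<noteq> 0\<^sub>v d" by auto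
  next
    assume "\<exists>v\<in>(\<lambda>v. J *\<^sub>v v) ` carrier_vec e. v \<noteq> 0\<^sub>v d"
    then obtain v where v: "v \<in> carrier_vec e" "J *\<^sub>v v \<noteq> 0\<^sub>v d" by blast
    show "0 < e"
    proof (rule ccontr)
      assume "\<not> 0 < e"
      hence "J *\<^sub>v v = 0\<^sub>v d" using J v(1) by (intro eq_vecI) (auto simp: scalar_prod_def)
      with v(2) show False ..
    qed
  qed
qed

lemma symYX_zero: "(\<lambda>y. 0) \<in> symYX"
  using lin_const_zero[OF vY vX] linD(3)[OF p_lin(2)] by (simp add: symmetric_YX_def)

lemma symYX_add: "A \<in> symYX \<Longrightarrow> A' \<in> symYX \<Longrightarrow> (\<lambda>y. A y + A' y) \<in> symYX"
proof -
  assume A: "A \<in> symYX" and A': "A' \<in> symYX"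
  have "p (A y + A' y) y' = p (A y' + A' y') y" for y y'
    by (simp only: linD(1)[OF p_lin(2)] symYX_D(2)[OF A, of y y'] symYX_D(2)[OF A', of y y'])
  thus ?thesis using lin_addI[OF symYX_D(1)[OF A] symYX_D(1)[OF A']] by (simp add: symmetric_YX_def)
qed

lemma symYX_neg: "A \<in> symYX \<Longrightarrow> (\<lambda>y. - A y) \<in> symYX"
proof -
  assume A: "A \<in> symYX"
  interpret X: vector_space sX by (rule vX)
  have "lin sY sX (\<lambda>y. - A y)"
    by (rule linI[OF vY vX]) (simp_all add: linD(1,2)[OF symYX_D(1)[OF A]] X.scale_minus_right)
  moreover have "p (- A y) y' = p (- A y') y" for y y'
    by (simp only: linD(4)[OF p_lin(2)] symYX_D(2)[OF A, of y y'])
  ultimately show ?thesis by (simp add: symmetric_YX_def)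
qed

lemma group_SP: "group SP"
  unfolding Sp_def by (rule group_isometry_group[OF prod_scale(2)[OF vX vY]])

lemma SP_simps: "\<one>\<^bsub>SP\<^esub> = id" "g \<otimes>\<^bsub>SP\<^esub> h = g \<circ> h"
  by (simp_all add: Sp_def isometry_group_simps)

lemma unipotent_comp: "unipotent A \<circ> unipotent A' = unipotent (\<lambda>y. A y + A' y)"
  by (auto simp: unipotent_def fun_eq_iff add_ac)

lemma subgroup_siegel: "subgroup siegel_carrier SP"
proof (rule group.subgroupI[OF group_SP])
  show "siegel_carrier \<subseteq> carrier SP" using unipotent_Sp by (auto simp: siegel_carrier_def)
  show "siegel_carrier \<noteq> {}" using symYX_zero by (auto simp: siegel_carrier_def)
  fix g assume "g \<in> siegel_carrier"
  then obtain A where A: "A \<in> symYX" "g = unipotent A" by (auto simp: siegel_carrier_def)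
  have "unipotent (\<lambda>y. - A y) \<otimes>\<^bsub>SP\<^esub> g = \<one>\<^bsub>SP\<^esub>"
    unfolding SP_simps A(2) unipotent_comp by (auto simp: unipotent_def fun_eq_iff)
  hence "inv\<^bsub>SP\<^esub> g = unipotent (\<lambda>y. - A y)"
    using group.inv_equality[OF group_SP] unipotent_Sp[OF A(1)] unipotent_Sp[OF symYX_neg[OF A(1)]] A(2) by blast
  thus "inv\<^bsub>SP\<^esub> g \<in> siegel_carrier" using symYX_neg[OF A(1)] by (auto simp: siegel_carrier_def)
  fix h assume "h \<in> siegel_carrier"
  then obtain A' where A': "A' \<in> symYX" "h = unipotent A'" by (auto simp: siegel_carrier_def)
  thus "g \<otimes>\<^bsub>SP\<^esub> h \<in> siegel_carrier"
    using symYX_add[OF A(1) A'(1)] A by (auto simp: siegel_carrier_def SP_simps unipotent_comp)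
qed

lemma unitary_form_char:
  assumes \<psi>: "nontrivial_additive_character \<psi>"
  shows "unitary_char SP siegel_carrier (form_char \<psi> (formB T))"
proof -
  have "form_char \<psi> (formB T) (g \<otimes>\<^bsub>SP\<^esub> h) = form_char \<psi> (formB T) g * form_char \<psi> (formB T) h"
    if gh: "g \<in> siegel_carrier" "h \<in> siegel_carrier" for g h
  proof -
    obtain A A' where A: "A \<in> symYX" "g = unipotent A" "A' \<in> symYX" "h = unipotent A'"
      using gh by (auto simp: siegel_carrier_def)
    note b = basis_list_props(2)[OF vY]
    have "lin_trace sY (\<lambda>y. formB T (A y + A' y)) = lin_trace sY (\<lambda>y. formB T (A y)) + lin_trace sY (\<lambda>y. formB T (A' y))"
      by (simp add: lin_trace_eq[OF vY] linD(1)[OF formB_lin] linD(1)[OF coord_lin[OF b]] sum.distrib)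
    thus ?thesis using \<psi>
      by (simp add: A SP_simps unipotent_comp form_char_unipotent nontrivial_additive_character_def add_divide_distrib)
  qed
  thus ?thesis using additive_character_norm[OF \<psi>] by (simp add: unitary_char_def form_char_def)
qed

text \<open>Rank-one symmetric maps \<open>A\<close> detect the diagonal values
  \<open>p x (B x)\<close>, and polarisation recovers the form since 2 is invertible.\<close>

lemma form_char_inject:
  assumes \<psi>: "nontrivial_additive_character \<psi>" and B: "B \<in> symmetric_XY sX sY p" "B' \<in> symmetric_XY sX sY p"
    and eq: "\<And>g. g \<in> siegel_carrier \<Longrightarrow> form_char \<psi> B g = form_char \<psi> B' g"
  shows "B = B'"
proof -
  have lB: "lin sX sY B" "lin sX sY B'" and sB: "\<And>x x'. p x' (B x) = p x (B x')" "\<And>x x'. p x' (B' x) = p x (B' x')"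
    using B by (auto simp: symmetric_XY_def)
  have add: "\<And>a b. \<psi> (a + b) = \<psi> a * \<psi> b" using \<psi> by (simp add: nontrivial_additive_character_def)
  have diag: "p x (B x) = p x (B' x)" for x
  proof (rule ccontr)
    assume ne: "p x (B x) \<noteq> p x (B' x)"
    obtain d where d: "\<psi> d \<noteq> 1" using \<psi> by (auto simp: nontrivial_additive_character_def)
    \<comment> \<open>Chosen so that the arguments of \<psi> for the two forms differ by
      \<open>d\<close>, where \<psi> is not 1; the factor 2 offsets the one half in the definition
      of the characters.\<close>
    define c where "c = 2 * d / (p x (B x) - p x (B' x))"
    define A where "A y = sX (c * p x y) x" for y
    have lc: "lin sY (*) (\<lambda>y. c * p x y)" using lin_scaleI[OF p_lin(1)] .
    have A: "A \<in> symYX"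
      using lin_scale_leftI[OF lc vX, of x] by (simp add: symmetric_YX_def A_def[abs_def] linD(2)[OF p_lin(2)])
    have tr: "lin_trace sY (\<lambda>y. C (A y)) = c * p x (C x)" if "lin sX sY C" for C
      using lin_trace_finite_rank[OF vY, of "{()}" "\<lambda>_ y. c * p x y" "\<lambda>_. C x"] lc by (simp add: A_def linD(2)[OF that])
    have "\<psi> (c * p x (B x) / 2) = \<psi> (c * p x (B' x) / 2)"
      using eq[of "unipotent A"] A tr[OF lB(1)] tr[OF lB(2)] by (simp add: siegel_carrier_def form_char_unipotent)
    moreover have "c * p x (B x) / 2 = d + c * p x (B' x) / 2"
      using ne two by (simp add: c_def field_simps)
    ultimately have "\<psi> d * \<psi> (c * p x (B' x) / 2) = \<psi> (c * p x (B' x) / 2)" using add by metis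
    moreover have "\<psi> (c * p x (B' x) / 2) \<noteq> 0" using additive_character_norm[OF \<psi>, of "c * p x (B' x) / 2"] by auto
    ultimately show False using d by simp
  qed
  show ?thesis
  proof (intro ext p_eqI)
    fix x x'
    have "2 * p x' (B x) = p (x + x') (B (x + x')) - p x (B x) - p x' (B x')"
      by (simp add: linD(1)[OF p_lin(1)] linD(1)[OF p_lin(2)] linD(1)[OF lB(1)] sB(1)[of x x'])
    also have "\<dots> = p (x + x') (B' (x + x')) - p x (B' x) - p x' (B' x')" by (simp add: diag)
    also have "\<dots> = 2 * p x' (B' x)"
      by (simp add: linD(1)[OF p_lin(1)] linD(1)[OF p_lin(2)] linD(1)[OF lB(2)] sB(2)[of x x'])
    finally show "p x' (B x) = p x' (B' x)" using two by simp
  qed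
qed

end

section \<open>The oscillator representation restricted to the dual pair\<close>

locale oscillator_dual_pair = dual_pair sX sY sU p sYU tY BU sXU tX \<beta> pU
  for sX :: "'f::{field, finite} \<Rightarrow> 'x::{ab_group_add, finite} \<Rightarrow> 'x"
    and sY :: "'f \<Rightarrow> 'y::{ab_group_add, finite} \<Rightarrow> 'y"
    and sU :: "'f \<Rightarrow> 'u::{ab_group_add, finite} \<Rightarrow> 'u"
    and p :: "'x \<Rightarrow> 'y \<Rightarrow> 'f"
    and sYU :: "'f \<Rightarrow> 'yu::{ab_group_add, finite} \<Rightarrow> 'yu"
    and tY :: "'y \<Rightarrow> 'u \<Rightarrow> 'yu"
    and BU :: "'u set"
    and sXU :: "'f \<Rightarrow> 'xu::{ab_group_add, finite} \<Rightarrow> 'xu"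
    and tX :: "'x \<Rightarrow> 'u \<Rightarrow> 'xu"
    and \<beta> :: "'u \<Rightarrow> 'u \<Rightarrow> 'f" and pU :: "'xu \<Rightarrow> 'yu \<Rightarrow> 'f" +
  fixes \<psi> :: "'f \<Rightarrow> complex"
    and \<omega> :: "('xu \<times> 'yu \<Rightarrow> 'xu \<times> 'yu) \<Rightarrow> ('yu \<Rightarrow> complex) \<Rightarrow> ('yu \<Rightarrow> complex)"
  assumes \<psi>: "nontrivial_additive_character \<psi>" and \<omega>: "is_oscillator_rep sXU sYU pU \<psi> \<omega>"
begin

definition \<omega>_pair :: "('x \<times> 'y \<Rightarrow> 'x \<times> 'y) \<Rightarrow> ('u \<Rightarrow> 'u) \<Rightarrow> ('yu \<Rightarrow> complex) \<Rightarrow> ('yu \<Rightarrow> complex)" where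
  "\<omega>_pair g r = \<omega> (tensor_map sW (sum_tensor tX tY) g r)"

lemma \<omega>_pair_unipotent:
  assumes "g \<in> siegel_carrier"
  shows "\<omega>_pair g id f T = form_char \<psi> (formB T) g * f T"
proof -
  obtain A where A: "A \<in> symYX" "g = unipotent A" using assms by (auto simp: siegel_carrier_def)
  have "\<omega>_pair g id f T = \<psi> (pU (AT A T) T / 2) * f T"
    using \<omega> AT_symmetric[OF A(1)] by (simp add: \<omega>_pair_def A(2) tensor_map_unipotent[OF A(1)] is_oscillator_rep_def)
  thus ?thesis by (simp add: A(2) form_char_unipotent trace_formB[OF symYX_D(1)[OF A(1)]])
qed

text \<open>The scalar is the quadratic character of the determinant of \<open>C \<otimes> r\<close>
  on \<open>Y \<otimes> U\<close>, which is a sign because that map is invertible. It is the same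
  for all \<open>T\<close>.\<close>

lemma \<omega>_pair_levi:
  assumes C: "lin sY sY C" "bij C" and r: "r \<in> carrier OU"
  obtains \<epsilon> where "\<epsilon> \<noteq> 0" "\<And>T. \<omega>_pair (levi p C) r (delta T) = (\<lambda>s. \<epsilon> * delta (CT C r T) s)"
proof (rule that)
  let ?D = "CT C r"
  note l = CT(1)[OF C(1) OU_D(1)[OF r]] and b = bij_CT(1)[OF C r]
  have gi: "?D (inv_into UNIV ?D s) = s" for s using b by (simp add: bij_is_surj surj_f_inv_f)
  have ig: "inv_into UNIV ?D (?D s) = s" for s using b by (simp add: bij_is_inj)
  show "quadratic_character (lin_det sYU ?D) \<noteq> 0"
    using lin_det_nonzero[OF l lin_inv[OF l b] gi] by (simp add: quadratic_character_def)
  fix T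
  show "\<omega>_pair (levi p C) r (delta T) = (\<lambda>s. quadratic_character (lin_det sYU ?D) * delta (?D T) s)"
  proof (rule ext)
    fix s
    have "\<omega>_pair (levi p C) r (delta T) s = quadratic_character (lin_det sYU ?D) * delta T (inv_into UNIV ?D s)"
      using \<omega> l b by (simp add: \<omega>_pair_def tensor_map_levi[OF C r] is_oscillator_rep_def)
    also have "delta T (inv_into UNIV ?D s) = delta (?D T) s"
      using gi[of s] ig[of T] by (auto simp: delta_def)
    finally
    show "\<omega>_pair (levi p C) r (delta T) s = quadratic_character (lin_det sYU ?D) * delta (?D T) s" .
  qed
qed

text \<open>Freeness of the action comes from surjectivity of \<open>hat T\<close>, the torsor
  property from \<open>form_char_inject\<close> with \<open>fibre_surj\<close>, and transitivity
  from Levi elements that match the components of two surjective maps.\<close>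

lemma theta_correspondence_pair:
  assumes \<Theta>: "is_theta_decomposition SP OU \<omega>_pair \<Theta>"
    and dim: "vector_space.dim sU UNIV < vector_space.dim sX UNIV"
  shows "theta_correspondence SP OU \<omega>_pair \<Theta> siegel_carrier (\<lambda>T. form_char \<psi> (formB T)) {T. surj (hat T)} (CT id)"
proof (rule theta_correspondence.intro)
  have id: "id \<in> carrier OU" using id_lin[OF vU] by (auto simp: isometry_group_simps)
  have idY: "lin sY sY id" "bij (id :: 'y \<Rightarrow> 'y)" using id_lin[OF vY] by auto
  show "group SP" by (rule group_SP)
  show "group OU" by (rule group_isometry_group[OF vU])
  show "finite (carrier SP)" "finite (carrier OU)" by (rule finite_subset[OF subset_UNIV]; simp)+
  show "subgroup siegel_carrier SP" by (rule subgroup_siegel)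
  show "is_theta_decomposition SP OU \<omega>_pair \<Theta>" by (rule \<Theta>)
  show "unitary_char SP siegel_carrier (form_char \<psi> (formB T))" for T by (rule unitary_form_char[OF \<psi>])
  show "\<omega>_pair a \<one>\<^bsub>OU\<^esub> f T = form_char \<psi> (formB T) a * f T" if "a \<in> siegel_carrier" for a f T
    using \<omega>_pair_unipotent[OF that] by (simp add: isometry_group_simps)
  show "\<exists>\<epsilon>. \<epsilon> \<noteq> 0 \<and> \<omega>_pair \<one>\<^bsub>SP\<^esub> h (delta T) = (\<lambda>s. \<epsilon> * delta (CT id h T) s)" if "h \<in> carrier OU" for h T
    using \<omega>_pair_levi[OF idY that] unfolding levi_id SP_simps by metis
  show "CT id h T \<in> {T. surj (hat T)}" if h: "h \<in> carrier OU" and T: "T \<in> {T. surj (hat T)}" for h T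
  proof -
    have "hat (CT id h T) = h \<circ> hat T" by (auto simp: hat_CT[OF idY(1) OU_D(1)[OF h]] adjoint_X_id)
    moreover have "surj (h \<circ> hat T)" using T OU_D(2)[OF h] by (intro comp_surj) (auto simp: bij_is_surj)
    ultimately show ?thesis by (simp only: mem_Collect_eq)
  qed
  show "h = h'" if h: "h \<in> carrier OU" "h' \<in> carrier OU" and T: "T \<in> {T. surj (hat T)}" and eq: "CT id h T = CT id h' T" for h h' T
  proof (rule ext)
    fix u
    have "surj (hat T)" using T by simp
    then obtain x where x: "u = hat T x" by (rule surjE)
    have "hat (CT id h T) x = h u" "hat (CT id h' T) x = h' u"
      using OU_D(1)[OF h(1)] OU_D(1)[OF h(2)] by (simp_all add: hat_CT[OF idY(1)] adjoint_X_id x)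
    thus "h u = h' u" using eq by simp
  qed
  show "CT id \<one>\<^bsub>OU\<^esub> T = T" for T
    by (rule hat_inject) (simp add: isometry_group_simps hat_CT[OF idY(1) id_lin[OF vU]] adjoint_X_id)
  show "\<exists>h\<in>carrier OU. T' = CT id h T" if T: "T \<in> {T. surj (hat T)}"
    and eq: "\<And>a. a \<in> siegel_carrier \<Longrightarrow> form_char \<psi> (formB T') a = form_char \<psi> (formB T) a" for T T'
  proof -
    have "formB T' = formB T" by (rule form_char_inject[OF \<psi> formB_symmetric formB_symmetric eq])
    thus ?thesis using fibre_surj[of T T'] T by blast
  qed
  show "\<exists>g\<in>carrier SP. \<exists>\<epsilon>. \<epsilon> \<noteq> 0 \<and> \<omega>_pair g \<one>\<^bsub>OU\<^esub> (delta T) = (\<lambda>s. \<epsilon> * delta T' s)"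
    if T: "T \<in> {T. surj (hat T)}" "T' \<in> {T. surj (hat T)}" for T T'
  proof -
    obtain C where C: "lin sY sY C" "bij C" "CT C id T = T'" using transitive_surj[of T T'] T by blast
    obtain \<epsilon> where "\<epsilon> \<noteq> 0" "\<And>T. \<omega>_pair (levi p C) id (delta T) = (\<lambda>s. \<epsilon> * delta (CT C id T) s)"
      using \<omega>_pair_levi[OF C(1,2) id] by metis
    thus ?thesis using levi_Sp[OF C(1,2)] C(3) by (auto simp: isometry_group_simps)
  qed
  show "{T. surj (hat T)} \<noteq> {}" using exists_surj[OF dim] by blast
qed

end

theorem theorem4p3p3:
  fixes sX :: "'f::{field, finite} \<Rightarrow> 'x::{ab_group_add, finite} \<Rightarrow> 'x"
    and sY :: "'f \<Rightarrow> 'y::{ab_group_add, finite} \<Rightarrow> 'y"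
    and sU :: "'f \<Rightarrow> 'u::{ab_group_add, finite} \<Rightarrow> 'u"
    and p :: "'x \<Rightarrow> 'y \<Rightarrow> 'f"
    and \<beta> :: "'u \<Rightarrow> 'u \<Rightarrow> 'f"
    and sXU :: "'f \<Rightarrow> 'xu::{ab_group_add, finite} \<Rightarrow> 'xu"
    and sYU :: "'f \<Rightarrow> 'yu::{ab_group_add, finite} \<Rightarrow> 'yu"
    and tX :: "'x \<Rightarrow> 'u \<Rightarrow> 'xu"
    and tY :: "'y \<Rightarrow> 'u \<Rightarrow> 'yu"
    and pU :: "'xu \<Rightarrow> 'yu \<Rightarrow> 'f"
    and \<psi> :: "'f \<Rightarrow> complex"
    and \<omega> :: "('xu \<times> 'yu \<Rightarrow> 'xu \<times> 'yu) \<Rightarrow> ('yu \<Rightarrow> complex) \<Rightarrow> ('yu \<Rightarrow> complex)"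
    and \<Theta> :: "(('u \<Rightarrow> 'u) \<Rightarrow> complex mat) set \<Rightarrow> ('x \<times> 'y \<Rightarrow> 'x \<times> 'y) \<Rightarrow> complex mat"
    and G :: "('x \<times> 'y \<Rightarrow> 'x \<times> 'y) monoid"
    and H :: "('u \<Rightarrow> 'u) monoid"
    and n k :: nat
  assumes "odd CARD('f)"
    and "vector_space sX" and "vector_space sY" and "vector_space sU"
    and "vector_space.dim sX UNIV = n" and "vector_space.dim sY UNIV = n"
    and "vector_space.dim sU UNIV = k"
    and "perfect_pairing sX sY p"
    and "nondegenerate_symmetric_form sU \<beta>"
    and "k < n"
    and "G = Sp sX sY p"
    and "H = isometry_group sU \<beta>"
    and "nontrivial_additive_character \<psi>"
    and "vector_space sXU" and "is_tensor_product sX sU sXU tX"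
    and "vector_space sYU" and "is_tensor_product sY sU sYU tY"
    and "bilinear_map sXU sYU (*) pU"
    and "\<forall>x u y u'. pU (tX x u) (tY y u') = p x y * \<beta> u u'"
    and "is_oscillator_rep sXU sYU pU \<psi> \<omega>"
    and "is_theta_decomposition G H
           (\<lambda>g r. \<omega> (tensor_map (module_prod.scale sXU sYU) (sum_tensor tX tY) g r)) \<Theta>"
  shows "\<exists>\<eta>.
    (\<forall>c\<in>Irr H.
       \<eta> c \<in> Irr G \<and>
       (\<forall>\<pi>\<in>\<eta> c. has_rank sX sY p \<psi> \<pi> k \<and> rep_multiplicity G \<pi> (\<Theta> c) = 1) \<and>
       (\<forall>\<pi>. constituent G \<pi> (\<Theta> c) \<and> \<pi> \<notin> \<eta> c \<longrightarrow> (\<exists>j<k. has_rank sX sY p \<psi> \<pi> j))) \<and>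
    \<eta> \<in> Irr H \<rightarrow> Irr_type sX sY sU p \<beta> \<psi> \<and> inj_on \<eta> (Irr H) \<and>
    (\<forall>c\<in>Irr H. \<forall>\<tau>\<in>c. \<forall>\<pi>\<in>\<eta> c. \<forall>B\<in>orbit_of sX sY sU p \<beta>.
       form_multiplicity sX sY p \<psi> \<pi> B = rep_degree H \<tau>)"
proof -
  obtain BU where BU: "finite_dimensional_vector_space sU BU"
    using vector_space_finite_basis[OF \<open>vector_space sU\<close>] by blast
  interpret D: oscillator_dual_pair sX sY sU p sYU tY BU sXU tX \<beta> pU \<psi> \<omega>
  proof (intro oscillator_dual_pair.intro dual_pair.intro tensor_pairing.intro
      dual_pair_axioms.intro oscillator_dual_pair_axioms.intro)
    show "perfect_pairing sY sX (\<lambda>y x. p x y)" by (rule perfect_pairing_swap) fact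
    show "(2 :: 'f) \<noteq> 0" by (rule two_nonzero) fact
    show "pU (tX x u) (tY y u') = p x y * \<beta> u u'" for x u y u' using assms(19) by blast
  qed (use assms BU in simp_all)
  have \<Theta>: "is_theta_decomposition D.SP D.OU D.\<omega>_pair \<Theta>"
    using assms(21) unfolding D.\<omega>_pair_def[abs_def] \<open>G = _\<close> \<open>H = _\<close> .
  interpret T: theta_correspondence D.SP D.OU D.\<omega>_pair \<Theta> D.siegel_carrier
    "\<lambda>T. D.form_char \<psi> (D.formB T)" "{T. surj (D.hat T)}" "D.CT id"
    by (rule D.theta_correspondence_pair[OF \<Theta>]) (use assms in simp)
  have GS: "G = D.SP" and HO: "H = D.OU" by fact+
  let ?mult = "form_multiplicity sX sY p \<psi>"
  let ?sym = "symmetric_XY sX sY p"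
  \<comment> \<open>Only characters of pulled-back forms occur in a constituent, because the whole
    space of functions carries no others.\<close>
  have occurring: "\<exists>T. B = D.formB T"
    if c: "c \<in> Irr H" and \<pi>: "irreducible_rep G \<pi>" "is_rep G e \<pi>" and \<phi>: "intertwines G e (rep_degree G (\<Theta> c)) \<pi> (\<Theta> c) \<phi>"
      "\<phi> \<noteq> 0\<^sub>m (rep_degree G (\<Theta> c)) e" and B: "B \<in> ?sym" "?mult \<pi> B > 0" for c \<pi> e \<phi> B
  proof -
    obtain v where v: "v \<in> weight_space D.siegel_carrier e \<pi> (D.form_char \<psi> B)" "v \<noteq> 0\<^sub>v e"
      using B(2) D.form_multiplicity_pos[OF \<pi>(2)[unfolded GS]] by blast
    obtain T where "\<And>a. a \<in> D.siegel_carrier \<Longrightarrow> D.form_char \<psi> (D.formB T) a = D.form_char \<psi> B a"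
      using T.constituent_weight[OF c[unfolded HO] \<pi>[unfolded GS] \<phi>[unfolded GS] v] by blast
    hence "D.formB T = B" by (rule D.form_char_inject[OF D.\<psi> D.formB_symmetric B(1)])
    thus ?thesis by blast
  qed
  have exists_form: "\<exists>T. ?mult \<pi> (D.formB T) > 0"
    if c: "c \<in> Irr H" and \<pi>: "irreducible_rep G \<pi>" "is_rep G e \<pi>" and \<phi>: "intertwines G e (rep_degree G (\<Theta> c)) \<pi> (\<Theta> c) \<phi>"
      "\<phi> \<noteq> 0\<^sub>m (rep_degree G (\<Theta> c)) e" for c \<pi> e \<phi>
  proof -
    obtain T v where "v \<in> weight_space D.siegel_carrier e \<pi> (D.form_char \<psi> (D.formB T))" "v \<noteq> 0\<^sub>v e"
      using T.constituent_has_weight[OF c[unfolded HO] \<pi>[unfolded GS] \<phi>[unfolded GS]] by blast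
    thus ?thesis using D.form_multiplicity_pos[OF \<pi>(2)[unfolded GS]] by blast
  qed
  have rank_le: "form_rank sY (D.formB T) \<le> k" for T using D.formB_rank_le[of T] assms(7) by simp
  have orbit: "D.formB T \<in> orbit_of sX sY sU p \<beta>" if "form_rank sY (D.formB T) = k" for T
    unfolding D.orbit_iff using D.surj_if_rank[of T] that assms(7) by auto
  have eta_embedding: "\<exists>J. T.top_embedding c \<pi> J" if "\<pi> \<in> T.eta c" for c \<pi>
    using that by (simp add: T.eta_def)
  have embedding_nonzero: "J \<noteq> 0\<^sub>m (rep_degree G (\<Theta> c)) (rep_degree G \<pi>)" if c: "c \<in> Irr H" and J: "T.top_embedding c \<pi> J" for c \<pi> J
  proof
    assume z: "J = 0\<^sub>m (rep_degree G (\<Theta> c)) (rep_degree G \<pi>)"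
    note E = T.top_embeddingD[OF J]
    let ?u = "unit_vec (rep_degree D.SP \<pi>) 0 :: complex vec"
    have "J *\<^sub>v ?u = 0\<^sub>v (rep_degree D.SP (\<Theta> c))" unfolding z GS by (intro eq_vecI) auto
    hence "?u = 0\<^sub>v (rep_degree D.SP \<pi>)" by (intro E(5)) auto
    thus False using irreducible_repD(1)[OF T.G E(1,2)] by simp
  qed
  have spectrum: "?mult \<pi> B = rep_degree H \<tau>"
    if c: "c \<in> Irr H" and \<tau>: "\<tau> \<in> c" and \<pi>: "\<pi> \<in> T.eta c" and B: "B \<in> orbit_of sX sY sU p \<beta>" for c \<tau> \<pi> B
  proof -
    obtain T where T: "T \<in> {T. surj (D.hat T)}" "B = D.formB T" using B unfolding D.orbit_iff by blast
    obtain J where J: "T.top_embedding c \<pi> J" using eta_embedding[OF \<pi>] by blast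
    obtain A where A: "A \<in> carrier_mat (rep_degree D.SP \<pi>) (rep_degree D.OU (class_rep c))"
      "\<And>u. u \<in> carrier_vec (rep_degree D.OU (class_rep c)) \<Longrightarrow> A *\<^sub>v u = 0\<^sub>v (rep_degree D.SP \<pi>) \<Longrightarrow>
         u = 0\<^sub>v (rep_degree D.OU (class_rep c))"
      "(\<lambda>u. A *\<^sub>v u) ` carrier_vec (rep_degree D.OU (class_rep c)) =
         weight_space D.siegel_carrier (rep_degree D.SP \<pi>) \<pi> (D.form_char \<psi> (D.formB T))"
      using T.embedded_weight_space[OF c[unfolded HO] T(1) J] by metis
    have "?mult \<pi> B = rep_degree D.OU (class_rep c)"
      unfolding T(2) by (rule D.form_multiplicity_eq[OF T.top_embeddingD(2)[OF J] A])
    also have "\<dots> = rep_degree H \<tau>"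
      using Irr_mem_degree[OF T.H c[unfolded HO] class_rep_in[OF T.H c[unfolded HO]] \<tau>] HO by simp
    finally show ?thesis .
  qed
  obtain T0 where T0: "surj (D.hat T0)" using T.S_nonempty by blast
  have T0_orbit: "D.formB T0 \<in> orbit_of sX sY sU p \<beta>" unfolding D.orbit_iff using T0 by blast
  have T0_rank: "form_rank sY (D.formB T0) = k" using D.formB_rank[OF T0] assms(7) by simp
  have T0_mult: "?mult \<pi> (D.formB T0) > 0" if c: "c \<in> Irr H" and \<pi>: "\<pi> \<in> T.eta c" for c \<pi>
    using spectrum[OF c class_rep_in[OF T.H c[unfolded HO]] \<pi> T0_orbit] T.dh_pos[OF c[unfolded HO]] HO by simp
  have embedded: "irreducible_rep G \<pi>" "is_rep G (rep_degree G \<pi>) \<pi>"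
      "\<exists>J. intertwines G (rep_degree G \<pi>) (rep_degree G (\<Theta> c)) \<pi> (\<Theta> c) J \<and> J \<noteq> 0\<^sub>m (rep_degree G (\<Theta> c)) (rep_degree G \<pi>)"
    if c: "c \<in> Irr H" and \<pi>: "\<pi> \<in> T.eta c" for c \<pi>
  proof -
    obtain J where J: "T.top_embedding c \<pi> J" using eta_embedding[OF \<pi>] by blast
    show "irreducible_rep G \<pi>" "is_rep G (rep_degree G \<pi>) \<pi>"
      "\<exists>J. intertwines G (rep_degree G \<pi>) (rep_degree G (\<Theta> c)) \<pi> (\<Theta> c) J \<and> J \<noteq> 0\<^sub>m (rep_degree G (\<Theta> c)) (rep_degree G \<pi>)"
      using T.top_embeddingD(1-3)[OF J] embedding_nonzero[OF c J] GS by auto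
  qed
  have eta_forms: "\<exists>T. B = D.formB T" if c: "c \<in> Irr H" and \<pi>: "\<pi> \<in> T.eta c" and B: "B \<in> ?sym" "?mult \<pi> B > 0" for c \<pi> B
    using embedded(3)[OF c \<pi>] occurring[OF c embedded(1,2)[OF c \<pi>] _ _ B] by blast
  have rank: "has_rank sX sY p \<psi> \<pi> k" if c: "c \<in> Irr H" and \<pi>: "\<pi> \<in> T.eta c" for c \<pi>
    unfolding has_rank_def
    using D.formB_symmetric T0_rank T0_mult[OF c \<pi>] eta_forms[OF c \<pi>] rank_le by blast
  have eta_type: "has_type sX sY sU p \<beta> \<psi> \<pi>" if c: "c \<in> Irr H" and \<pi>: "\<pi> \<in> T.eta c" for c \<pi>
  proof -
    have "?mult \<pi> B = 0" if B: "B \<in> ?sym - orbit_of sX sY sU p \<beta>" "form_rank sY B = k" for B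
    proof (rule ccontr)
      assume "?mult \<pi> B \<noteq> 0"
      then obtain T where "B = D.formB T" using eta_forms[OF c \<pi>, of B] B(1) by auto
      thus False using orbit[of T] B by blast
    qed
    thus ?thesis unfolding has_type_def assms(7) using rank[OF c \<pi>] T0_orbit T0_mult[OF c \<pi>] by blast
  qed
  have mult_one: "rep_multiplicity G \<pi> (\<Theta> c) = 1" if c: "c \<in> Irr H" and \<pi>: "\<pi> \<in> T.eta c" for c \<pi>
  proof -
    obtain J where J: "T.top_embedding c \<pi> J" using eta_embedding[OF \<pi>] by blast
    note E = T.top_embeddingD[OF J, folded GS]
    note nz = embedding_nonzero[OF c J]
    \<comment> \<open>The space of intertwiners is the line through \<open>J\<close>, parametrised
      by vectors of length 1 so that its dimension can be read off.\<close>
    have ints: "intertwiners G \<pi> (\<Theta> c) = (\<lambda>v. (v $ 0) \<cdot>\<^sub>m J) ` carrier_vec 1"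
    proof (intro equalityI subsetI)
      fix M assume "M \<in> intertwiners G \<pi> (\<Theta> c)"
      hence "intertwines G (rep_degree G \<pi>) (rep_degree G (\<Theta> c)) \<pi> (\<Theta> c) M"
        using intertwiners_eq[OF E(2)] T.\<Theta>_rep[OF c[unfolded HO]] GS by blast
      then obtain a where a: "M = a \<cdot>\<^sub>m J" using T.intertwiners_eta[OF c[unfolded HO] J] GS by metis
      show "M \<in> (\<lambda>v. (v $ 0) \<cdot>\<^sub>m J) ` carrier_vec 1"
        by (rule image_eqI[of _ _ "vec 1 (\<lambda>_. a)"]) (auto simp: a)
    next
      fix M assume "M \<in> (\<lambda>v. (v $ 0) \<cdot>\<^sub>m J) ` carrier_vec 1"
      then obtain a where a: "M = a \<cdot>\<^sub>m J" by blast
      have "(a \<cdot>\<^sub>m J) * \<pi> g = \<Theta> c g * (a \<cdot>\<^sub>m J)" if g: "g \<in> carrier G" for g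
        using E(3,4) is_repD(1)[OF E(2) g] is_repD(1)[OF T.\<Theta>_rep[OF c[unfolded HO], folded GS] g] g
        by (simp add: intertwines_def mult_smult_assoc_mat mult_smult_distrib)
      thus "M \<in> intertwiners G \<pi> (\<Theta> c)" using E(4) by (simp add: intertwiners_def a)
    qed
    obtain i j where ij: "i < rep_degree G (\<Theta> c)" "j < rep_degree G \<pi>" "J $$ (i,j) \<noteq> 0"
      using nz E(4) by (metis carrier_matD eq_matI index_zero_mat)
    show ?thesis unfolding rep_multiplicity_def
    proof (rule dim_of_linear_bij[where f = "\<lambda>v. (v $ 0) \<cdot>\<^sub>m J"])
      show "intertwiners G \<pi> (\<Theta> c) = (\<lambda>v. (v $ 0) \<cdot>\<^sub>m J) ` carrier_vec 1" by (rule ints)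
      fix v :: "complex vec" assume v: "v \<in> carrier_vec 1"
      show "(v $ 0) \<cdot>\<^sub>m J \<in> carrier_mat (rep_degree G (\<Theta> c)) (rep_degree G \<pi>)" using E(4) by simp
      show "((v + w) $ 0) \<cdot>\<^sub>m J = (v $ 0) \<cdot>\<^sub>m J + (w $ 0) \<cdot>\<^sub>m J" if "w \<in> carrier_vec 1" for w
        using v that by (intro eq_matI) (auto simp: algebra_simps)
      show "((a \<cdot>\<^sub>v v) $ 0) \<cdot>\<^sub>m J = a \<cdot>\<^sub>m ((v $ 0) \<cdot>\<^sub>m J)" for a
        using v by (intro eq_matI) auto
      assume "(v $ 0) \<cdot>\<^sub>m J = 0\<^sub>m (rep_degree G (\<Theta> c)) (rep_degree G \<pi>)"
      hence "((v $ 0) \<cdot>\<^sub>m J) $$ (i,j) = 0" using ij by simp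
      hence "v $ 0 = 0" using ij E(4) by simp
      thus "v = 0\<^sub>v 1" using v by (intro eq_vecI) auto
    qed
  qed
  have others: "\<exists>j<k. has_rank sX sY p \<psi> \<pi> j"
    if c: "c \<in> Irr H" and con: "constituent G \<pi> (\<Theta> c)" and ne: "\<pi> \<notin> T.eta c" for c \<pi>
  proof -
    have irr: "irreducible_rep G \<pi>" and pos: "rep_multiplicity G \<pi> (\<Theta> c) > 0" using con by (auto simp: constituent_def)
    have \<pi>: "is_rep G (rep_degree G \<pi>) \<pi>" using irreducible_is_rep[OF T.G] irr GS by blast
    note \<Theta>c = T.\<Theta>_rep[OF c[unfolded HO], folded GS]
    let ?z = "0\<^sub>m (rep_degree G (\<Theta> c)) (rep_degree G \<pi>) :: complex mat"
    have "intertwiners G \<pi> (\<Theta> c) \<noteq> {?z}"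
    proof
      assume "intertwiners G \<pi> (\<Theta> c) = {?z}"
      \<comment> \<open>The zero map on the space of vectors of length 0 parametrises the zero
        space, giving dimension 0.\<close>
      hence "rep_multiplicity G \<pi> (\<Theta> c) = 0" unfolding rep_multiplicity_def
        by (intro dim_of_linear_bij[where f = "\<lambda>_. ?z"]) (auto intro!: eq_matI rev_image_eqI[of "0\<^sub>v 0"])
      with pos show False by simp
    qed
    moreover have "?z \<in> intertwiners G \<pi> (\<Theta> c)"
      by (simp add: intertwiners_def left_mult_zero_mat[OF is_repD(1)[OF \<pi>]] right_mult_zero_mat[OF is_repD(1)[OF \<Theta>c]])
    ultimately obtain \<phi> where \<phi>: "intertwines G (rep_degree G \<pi>) (rep_degree G (\<Theta> c)) \<pi> (\<Theta> c) \<phi>" "\<phi> \<noteq> ?z"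
      using intertwiners_eq[OF \<pi> \<Theta>c] by blast
    \<comment> \<open>Rank \<open>k\<close> would make \<open>T\<close> surjective, and a weight
      vector at a surjective point places \<pi> in \<open>T.eta c\<close>.\<close>
    have lt: "form_rank sY B < k" if B: "B \<in> ?sym" "?mult \<pi> B > 0" for B
    proof (rule ccontr)
      obtain T where T: "B = D.formB T" using occurring[OF c irr \<pi> \<phi> B] by blast
      assume "\<not> form_rank sY B < k"
      hence "form_rank sY (D.formB T) = k" using rank_le[of T] T by simp
      hence S: "T \<in> {T. surj (D.hat T)}" using D.surj_if_rank[of T] assms(7) by simp
      obtain v where v: "v \<in> weight_space D.siegel_carrier (rep_degree G \<pi>) \<pi> (D.form_char \<psi> (D.formB T))" "v \<noteq> 0\<^sub>v (rep_degree G \<pi>)"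
        using B(2) D.form_multiplicity_pos[OF \<pi>[unfolded GS]] T GS by metis
      have "\<pi> \<in> T.eta c"
        by (rule T.constituent_top_weights[OF c[unfolded HO] irr[unfolded GS] \<pi>[unfolded GS] \<phi>[unfolded GS] S v[unfolded GS]])
      with ne show False ..
    qed
    \<comment> \<open>The ranks that occur in \<pi>. The set is non-empty and bounded by
      \<open>k\<close>, so its maximum is the rank of \<pi>.\<close>
    define R where "R = {form_rank sY B | B. B \<in> ?sym \<and> ?mult \<pi> B > 0}"
    have fin: "finite R" by (rule finite_subset[of _ "{..<k}"]) (use lt in \<open>auto simp: R_def\<close>)
    have "R \<noteq> {}" using exists_form[OF c irr \<pi> \<phi>] D.formB_symmetric by (auto simp: R_def)
    from Max_in[OF fin this] obtain B where B: "B \<in> ?sym" "?mult \<pi> B > 0" "Max R = form_rank sY B"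
      unfolding R_def by blast
    have "form_rank sY B' \<le> Max R" if "B' \<in> ?sym" "?mult \<pi> B' > 0" for B'
      by (rule Max_ge[OF fin]) (use that in \<open>auto simp: R_def\<close>)
    hence "has_rank sX sY p \<psi> \<pi> (Max R)" unfolding has_rank_def using B by auto
    moreover have "Max R < k" using lt[OF B(1,2)] B(3) by simp
    ultimately show ?thesis by blast
  qed
  have irr_G: "T.eta c \<in> Irr G" if "c \<in> Irr H" for c using T.eta_Irr[of c] that GS HO by simp
  show ?thesis
  proof (intro exI[of _ T.eta] conjI ballI allI impI)
    show "T.eta \<in> Irr H \<rightarrow> Irr_type sX sY sU p \<beta> \<psi>"
      using irr_G eta_type assms(11) by (simp add: Irr_type_def)
    show "inj_on T.eta (Irr H)" unfolding HO by (rule inj_onI) (rule T.eta_inj)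
  qed (simp_all add: irr_G rank mult_one others spectrum)
qed

end
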